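(* Let $E_2(\tau,s)$ be the weight $2$ Eisenstein series defined in the context, $E_2'(\tau,s)$ its derivative with respect to $s$, $\tau=u+iv$ with $v>0$, and $q=e^{2\pi i\tau}$. Then $$E_2(\tau,1)=\sum_{m\in\mathbb Z}a(v,1,m)q^m,\qquad E_2'(\tau,1)=\sum_{m\in\mathbb Z}a'(v,1,m)q^m$$ with $$a(v,1,m)=\begin{cases}\sigma(m)&m>0\\ -\frac1{24}+\frac1{8\pi v}&m=0\\ 0&m<0\end{cases}$$ and $$a'(v,1,m)=\begin{cases}\sigma(m)\Big(\dfrac1{4\pi mv}+\dfrac{\sigma'(m)}{\sigma(m)}\Big)&m>0\\[2mm] -\dfrac1{24}\big(24\zeta'(-1)+\gamma-1+\log(4\pi v)\big)-\dfrac1{8\pi v}\big(-\gamma+\log(4\pi v)\big)&m=0\\[2mm] \sigma(|m|)\Big(\mathrm{Ei}(-4\pi|m|v)+\dfrac1{4\pi|m|v}e^{-4\pi|m|v}\Big)&m<0.\end{cases}$$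
   Context: For $\mathrm{Re}\,s>1$ let $E(\tau,s)=\frac12\sum_{(c,d)\in\mathbb Z^2\setminus\{(0,0)\}}\frac{v^s}{|c\tau+d|^{2s}}$ and $E^*(\tau,s)=\pi^{-s}\Gamma(s)E(\tau,s)$, continued meromorphically in $s$. Put $E_2(\tau,s)=\frac1{2\pi i}\partial_\tau E^*(\tau,s)=-\frac1{4\pi}(\partial_v+i\partial_u)E^*(\tau,s)$ (regular at $s=1$). $\sigma(n)=\sum_{d\mid n,\,d>0}d$ for $n\geq1$; $\sigma^*_\nu(m)=|m|^\nu\sum_{d\mid m,\,d>0}d^{-2\nu}$, and $\sigma'(m)/\sigma(m)$ is the abbreviation for $\big(\frac{d}{d\nu}\sigma^*_\nu(m)\big|_{\nu=1/2}\big)/\sigma^*_{1/2}(m)$. $\gamma$ is Euler's constant, $\zeta$ the Riemann zeta function, and $-\mathrm{Ei}(-x)=\int_1^\infty e^{-xt}\frac{dt}{t}$ for $x>0$. *)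

theory Defs
  imports "HOL-Complex_Analysis.Complex_Analysis"
begin

(* THE is unambiguous for open nonempty S, see meromorphic_continuation_eqI; niceness fixes the
   values (limit at removable singularities, 0 at poles). *)
definition meromorphic_continuation :: "complex set \<Rightarrow> (complex \<Rightarrow> complex) \<Rightarrow> complex \<Rightarrow> complex" where
  "meromorphic_continuation S f = (THE g. g nicely_meromorphic_on UNIV \<and> (\<forall>s\<in>S. g s = f s))"

lemma nicely_meromorphic_eq:
  assumes f: "f nicely_meromorphic_on UNIV" and g: "g nicely_meromorphic_on UNIV"
    and S: "open S" "S \<noteq> {}" and eq: "\<And>s. s \<in> S \<Longrightarrow> f s = g s"
  shows "f = g"
proof
  fix z
  obtain z0 where z0: "z0 \<in> S" using S by blast
  have mero: "(\<lambda>s. f s - g s) meromorphic_on UNIV"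
    using f g by (auto simp: nicely_meromorphic_on_def intro!: meromorphic_intros)
  have "eventually (\<lambda>s. s \<in> S) (at z0)"
    using S z0 by (simp add: eventually_at_in_open')
  hence "eventually (\<lambda>s. f s - g s = 0) (at z0)"
    by eventually_elim (simp add: eq)
  moreover have "\<not> eventually (\<lambda>s. f s - g s \<noteq> 0) (at z0)"
  proof
    assume "eventually (\<lambda>s. f s - g s \<noteq> 0) (at z0)"
    with calculation have "eventually (\<lambda>s. False) (at z0)"
      by eventually_elim simp
    thus False by simp
  qed
  ultimately have "eventually (\<lambda>s. f s - g s = 0) (cosparse UNIV)"
    using meromorphic_imp_constant_or_avoid[OF mero, of 0]
      eventually_cosparse_imp_eventually_at[of _ UNIV z0 UNIV]
    by (metis (no_types, lifting) UNIV_I connected_UNIV open_UNIV)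
  hence "eventually (\<lambda>s. f s - g s = 0) (at z)"
    by (rule eventually_cosparse_imp_eventually_at) simp
  hence ev: "eventually (\<lambda>s. f s = g s) (at z)"
    by eventually_elim simp
  have pole: "is_pole f z \<longleftrightarrow> is_pole g z"
    using ev by (intro is_pole_cong) auto
  have lim: "(f \<longlongrightarrow> c) (at z) \<longleftrightarrow> (g \<longlongrightarrow> c) (at z)" for c
    using ev by (rule tendsto_cong)
  have F: "is_pole f z \<and> f z = 0 \<or> (f \<longlongrightarrow> f z) (at z)"
    and G: "is_pole g z \<and> g z = 0 \<or> (g \<longlongrightarrow> g z) (at z)"
    using f g by (auto simp: nicely_meromorphic_on_def)
  show "f z = g z"
  proof (cases "is_pole f z")
    case True
    hence "\<not> (f \<longlongrightarrow> c) (at z)" for c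
      by (meson at_neq_bot is_pole_def not_tendsto_and_filterlim_at_infinity)
    thus ?thesis using F G lim by auto
  next
    case False
    hence "(f \<longlongrightarrow> f z) (at z)" "(f \<longlongrightarrow> g z) (at z)"
      using F G pole lim by auto
    thus ?thesis
      using LIM_unique by blast
  qed
qed

lemma meromorphic_continuation_eqI:
  assumes "g nicely_meromorphic_on UNIV" "open S" "S \<noteq> {}" "\<And>s. s \<in> S \<Longrightarrow> g s = f s"
  shows "meromorphic_continuation S f = g"
  unfolding meromorphic_continuation_def
proof (rule the_equality)
  show "g nicely_meromorphic_on UNIV \<and> (\<forall>s\<in>S. g s = f s)"
    using assms by simp
next
  fix h assume "h nicely_meromorphic_on UNIV \<and> (\<forall>s\<in>S. h s = f s)"
  then show "h = g"
    using assms by (intro nicely_meromorphic_eq[of h g S]) auto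
qed

definition riemann_zeta :: "complex \<Rightarrow> complex" where
  "riemann_zeta = meromorphic_continuation {s. Re s > 1} (\<lambda>s. \<Sum>\<^sub>\<infinity>n\<in>{1..}. of_nat n powr (- s))"

definition eisenstein_E :: "complex \<Rightarrow> complex \<Rightarrow> complex" where
  "eisenstein_E \<tau> s = 1 / 2 * (\<Sum>\<^sub>\<infinity>(c, d)\<in>UNIV - {(0 :: int, 0 :: int)}.
     of_real (Im \<tau>) powr s / of_real (cmod (of_int c * \<tau> + of_int d)) powr (2 * s))"

definition eisenstein_E_star :: "complex \<Rightarrow> complex \<Rightarrow> complex" where
  "eisenstein_E_star \<tau> = meromorphic_continuation {s. Re s > 1}
     (\<lambda>s. of_real pi powr (- s) * Gamma s * eisenstein_E \<tau> s)"

(* Wirtinger derivative with respect to \<tau> = u + iv, i.e. (d/du - i d/dv) / 2 *)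
definition wirtinger_deriv :: "(complex \<Rightarrow> complex) \<Rightarrow> complex \<Rightarrow> complex" where
  "wirtinger_deriv f \<tau> =
     (vector_derivative (\<lambda>u. f (Complex u (Im \<tau>))) (at (Re \<tau>))
      - \<i> * vector_derivative (\<lambda>v. f (Complex (Re \<tau>) v)) (at (Im \<tau>))) / 2"

(* eisenstein_E_star \<tau> has a pole at s = 1, where only the limit of the \<tau>-derivative as s tends
   to 1 is meaningful; remove_sings supplies it. *)
definition eisenstein_E2 :: "complex \<Rightarrow> complex \<Rightarrow> complex" where
  "eisenstein_E2 \<tau> =
     remove_sings (\<lambda>s. 1 / (2 * of_real pi * \<i>) * wirtinger_deriv (\<lambda>t. eisenstein_E_star t s) \<tau>)"

definition sigma :: "int \<Rightarrow> int" where
  "sigma n = (\<Sum>d | d dvd n \<and> d > 0. d)"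

definition sigma_star :: "complex \<Rightarrow> int \<Rightarrow> complex" where
  "sigma_star \<nu> m =
     of_int \<bar>m\<bar> powr \<nu> * (\<Sum>d | d dvd m \<and> d > 0. of_int d powr (- 2 * \<nu>))"

(* the quotient abbreviated \<sigma>'(m)/\<sigma>(m) in the literature *)
definition sigma_log_deriv :: "int \<Rightarrow> complex" where
  "sigma_log_deriv m = deriv (\<lambda>\<nu>. sigma_star \<nu> m) (1 / 2) / sigma_star (1 / 2) m"

(* meaningful for x < 0 only *)
definition Ei :: "real \<Rightarrow> real" where
  "Ei x = - integral {1..} (\<lambda>t. exp (x * t) / t)"

definition coeff_a :: "real \<Rightarrow> int \<Rightarrow> complex" where
  "coeff_a v m =
     (if m > 0 then of_int (sigma m)
      else if m = 0 then of_real (- 1 / 24 + 1 / (8 * pi * v))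
      else 0)"

definition coeff_a' :: "real \<Rightarrow> int \<Rightarrow> complex" where
  "coeff_a' v m =
     (if m > 0 then
        of_int (sigma m) * (of_real (1 / (4 * pi * of_int m * v)) + sigma_log_deriv m)
      else if m = 0 then
        - 1 / 24 * (24 * deriv riemann_zeta (- 1) + euler_mascheroni - 1 + of_real (ln (4 * pi * v)))
        - of_real (1 / (8 * pi * v) * (- euler_mascheroni + ln (4 * pi * v)))
      else
        of_int (sigma \<bar>m\<bar>) *
        of_real (Ei (- 4 * pi * of_int \<bar>m\<bar> * v)
                 + 1 / (4 * pi * of_int \<bar>m\<bar> * v) * exp (- 4 * pi * of_int \<bar>m\<bar> * v)))"

end

theory Submission
  imports Defs "HOL-Probability.Probability"
begin

text \<open>Writing each summand of \<open>E\<^sup>*\<close> as a Gamma integral and applying the theta transformation to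
  the sum over \<open>d\<close> gives, for \<open>Re s > 1\<close>, the expansion
  \<open>E\<^sup>*(\<tau>, s) = Z(s) v\<^sup>s + Z(1 - s) v\<^sup>1\<^sup>-\<^sup>s + (\<Sum>n \<noteq> 0. \<sigma>\<^sup>*(n) 2 \<surd>v K(2\<pi>\<bar>n\<bar>v) exp(2\<pi>inu))\<close> with
  \<open>Z(w) = \<pi>\<^sup>-\<^sup>w \<Gamma>(w) \<zeta>(2w)\<close>; here \<open>\<sigma>\<^sup>*\<close> and the Bessel function \<open>K\<close> have order \<open>s - 1/2\<close>. The right-hand side
  is meromorphic in \<open>s\<close>, so it is the continuation of \<open>E\<^sup>*\<close>, and it can be differentiated termwise in
  \<open>u\<close>, \<open>v\<close> and \<open>s\<close>, its terms being holomorphic in all three variables and decaying exponentially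
  in \<open>n\<close>. At \<open>s = 1\<close> the Bessel function has order \<open>1/2\<close> and is elementary; the derivative of \<open>K\<close> with
  respect to the order at \<open>1/2\<close> is found from a first-order differential equation and is an exponential
  integral. The constant term needs \<open>\<zeta>(2)\<close>, the functional equation of \<open>\<zeta>\<close> (which turns \<open>\<zeta>'(2)\<close> into
  \<open>\<zeta>'(-1)\<close>), and the constant \<open>\<gamma>\<close> in the Laurent expansion of \<open>\<zeta>\<close> at \<open>1\<close>.\<close>

subsection \<open>Parametric integrals and series of holomorphic functions\<close>

text \<open>The Gamma, theta and Bessel integrals run over the real line after the substitution t =
  exp x. Dilations become translations, functional equations become x -> -x, the order derivative of
  K is a factor x, and \<open>exp (R * \<bar>x\<bar> - a * cosh x)\<close> is the standard majorant.
  The obstacle is the pole of E* at s = 1. It sits in \<open>completed_zeta (1 - s)\<close>, whose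
  coefficient v^(1-s) becomes constant in v there: differentiation in v yields a factor 1 - s that
  cancels the pole. The derivative at s = 1 then sees the next Laurent coefficient, one origin of
  gamma. Derivatives in u and v are obtained by letting both be independent complex variables and
  applying the M-test; the exponential in u then grows with |Im u|, so u is kept in the strip |Im u|
  <= Re v / 4, where the decay of K wins. At s = 1 the orders s - 1/2 and s - 3/2 produced by the
  derivative are 1/2 and -1/2. K is even in its order and its order derivative is odd: the terms n <
  0 cancel in E_2(tau,1), and in E_2'(tau,1) the order derivative survives for n < 0 only.\<close>

lemma has_sum_to_nat_iff:
  fixes h :: "'i::countable \<Rightarrow> 'b::{comm_monoid_add,topological_space}"
  shows "((\<lambda>n. if n \<in> to_nat ` A then h (from_nat n) else 0) has_sum s) UNIV \<longleftrightarrow> (h has_sum s) A"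
proof -
  have "((\<lambda>n. if n \<in> to_nat ` A then h (from_nat n) else 0) has_sum s) UNIV \<longleftrightarrow>
        ((\<lambda>n. h (from_nat n)) has_sum s) (to_nat ` A)"
    by (intro has_sum_cong_neutral) auto
  also have "\<dots> \<longleftrightarrow> (((\<lambda>n. h (from_nat n)) \<circ> to_nat) has_sum s) A"
    by (intro has_sum_reindex) (auto intro: inj_onI)
  finally show ?thesis
    by (simp add: o_def)
qed

text \<open>\<open>sums_integral\<close> speaks of sequences, so the family is enumerated by
  \<open>to_nat\<close> and padded with 0. Summability of the integrated norms afterwards turns the
  ordered sum of the integrals back into an unordered one.\<close>

lemma has_sum_integral_swap:
  fixes f :: "'i::countable \<Rightarrow> 'a \<Rightarrow> complex"
  assumes int: "\<And>i. i \<in> A \<Longrightarrow> integrable M (f i)"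
    and summ: "(\<lambda>i. \<integral>x. norm (f i x) \<partial>M) summable_on A"
    and lim: "\<And>x. ((\<lambda>i. f i x) has_sum g x) A"
  shows "((\<lambda>i. \<integral>x. f i x \<partial>M) has_sum (\<integral>x. g x \<partial>M)) A"
proof -
  define F where "F n x = (if n \<in> to_nat ` A then f (from_nat n) x else 0)" for n x
  have F_int: "integrable M (F n)" for n
    unfolding F_def by (cases "n \<in> to_nat ` A") (auto intro: int)
  have F_sum: "((\<lambda>n. F n x) has_sum g x) UNIV" for x
    using lim[of x] has_sum_to_nat_iff[of A "\<lambda>i. f i x" "g x"] by (simp add: F_def)
  \<comment> \<open>Unordered convergence of complex numbers is absolute; this supplies the
    pointwise absolute summability that \<open>sums_integral\<close> asks for.\<close>
  have F_abs: "summable (\<lambda>n. norm (F n x))" for x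
  proof -
    have "(\<lambda>n. F n x) summable_on UNIV"
      using F_sum[of x] by (auto simp: summable_on_def)
    thus ?thesis
      by (intro summable_on_imp_summable) (simp add: summable_on_iff_abs_summable_on_complex)
  qed
  have F_g: "(\<Sum>n. F n x) = g x" for x
    using sums_unique[OF has_sum_imp_sums[OF F_sum[of x]]] by simp
  have "((\<lambda>n. if n \<in> to_nat ` A then \<integral>x. norm (f (from_nat n) x) \<partial>M else 0)
          has_sum (\<Sum>\<^sub>\<infinity>i\<in>A. \<integral>x. norm (f i x) \<partial>M)) UNIV"
    by (subst has_sum_to_nat_iff[of A "\<lambda>i. \<integral>x. norm (f i x) \<partial>M"]) (rule has_sum_infsum[OF summ])
  also have "(\<lambda>n. if n \<in> to_nat ` A then \<integral>x. norm (f (from_nat n) x) \<partial>M else 0) =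
             (\<lambda>n. \<integral>x. norm (F n x) \<partial>M)"
    by (auto simp: F_def fun_eq_iff)
  finally have F_norm: "summable (\<lambda>n. \<integral>x. norm (F n x) \<partial>M)"
    by (intro sums_summable[OF has_sum_imp_sums])
  have "(\<lambda>n. \<integral>x. F n x \<partial>M) sums (\<integral>x. (\<Sum>n. F n x) \<partial>M)"
    using F_abs by (auto intro!: sums_integral F_int F_norm)
  hence sums: "(\<lambda>n. \<integral>x. F n x \<partial>M) sums (\<integral>x. g x \<partial>M)"
    by (simp add: F_g)
  have "summable (\<lambda>n. norm (\<integral>x. F n x \<partial>M))"
    by (rule summable_comparison_test'[OF F_norm, of 0]) simp
  hence "((\<lambda>n. \<integral>x. F n x \<partial>M) has_sum (\<integral>x. g x \<partial>M)) UNIV"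
    using sums by (rule norm_summable_imp_has_sum)
  also have "(\<lambda>n. \<integral>x. F n x \<partial>M) =
     (\<lambda>n. if n \<in> to_nat ` A then \<integral>x. f (from_nat n) x \<partial>M else 0)"
    by (auto simp: F_def fun_eq_iff)
  finally show "((\<lambda>i. \<integral>x. f i x \<partial>M) has_sum (\<integral>x. g x \<partial>M)) A"
    using has_sum_to_nat_iff[of A "\<lambda>i. \<integral>x. f i x \<partial>M"] by simp
qed

section \<open>Differentiation under the integral sign\<close>

lemma norm_exp_minus_linear_le:
  fixes w :: complex
  shows "norm (exp w - 1 - w) \<le> (norm w)\<^sup>2 * exp (norm w)"
proof -
  have "norm (exp w - (\<Sum>k\<le>1. w ^ k / fact k)) \<le> exp \<bar>Re w\<bar> * norm w ^ Suc 1 / fact 1"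
    by (rule Taylor_exp)
  also have "\<dots> \<le> (norm w)\<^sup>2 * exp (norm w)"
    using abs_Re_le_cmod[of w] by (simp add: power2_eq_square mult_right_mono mult.commute)
  finally show ?thesis
    by (simp add: atMost_Suc algebra_simps)
qed

text \<open>The extra factor exp(r|g|) in the majorant is slack: for |h| <= r/2 one half of it pays
  for exp(h g), the other half absorbs the g^2 of the Taylor remainder, because g^2 <= 8/r^2 *
  exp(r|g|/2). The difference quotient then differs from the claimed derivative by O(|h|).\<close>

lemma has_field_derivative_exp_integral:
  fixes f :: "'a::euclidean_space \<Rightarrow> complex" and g :: "'a \<Rightarrow> real"
  assumes meas [measurable]: "f \<in> borel_measurable M" "g \<in> borel_measurable M" and r: "r > 0"
    and int: "integrable M (\<lambda>x. norm (f x) * exp (Re z * g x + r * \<bar>g x\<bar>))"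
  shows "((\<lambda>z. \<integral>x. f x * exp (z * of_real (g x)) \<partial>M) has_field_derivative
           (\<integral>x. f x * of_real (g x) * exp (z * of_real (g x)) \<partial>M)) (at z)"
proof -
  define W where "W x = norm (f x) * exp (Re z * g x + r * \<bar>g x\<bar>)" for x
  define I where "I z = (\<integral>x. f x * exp (z * of_real (g x)) \<partial>M)" for z
  define D where "D = (\<integral>x. f x * of_real (g x) * exp (z * of_real (g x)) \<partial>M)"
  have W_int: "integrable M W" using int unfolding W_def .
  have int1: "integrable M (\<lambda>x. f x * exp ((z + h) * of_real (g x)))" if "norm h \<le> r / 2" for h
  proof (rule Bochner_Integration.integrable_bound[OF W_int])
    show "AE x in M. norm (f x * exp ((z + h) * of_real (g x))) \<le> norm (W x)"
    proof (rule AE_I2)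
      fix x
      have "Re h * g x \<le> \<bar>Re h\<bar> * \<bar>g x\<bar>" by (metis abs_ge_self abs_mult)
      also have "\<dots> \<le> r * \<bar>g x\<bar>"
        using abs_Re_le_cmod[of h] that r by (intro mult_right_mono) linarith+
      finally show "norm (f x * exp ((z + h) * of_real (g x))) \<le> norm (W x)"
        by (simp add: norm_mult W_def distrib_right mult_left_mono)
    qed
  qed measurable
  have g_le: "r * \<bar>g x\<bar> / 2 \<le> exp (r / 2 * \<bar>g x\<bar>)" 
     "(g x)\<^sup>2 \<le> 8 / r\<^sup>2 * exp (r / 2 * \<bar>g x\<bar>)" for x
  proof -
    have *: "1 + r / 2 * \<bar>g x\<bar> + (r / 2 * \<bar>g x\<bar>)\<^sup>2 / 2 \<le> exp (r / 2 * \<bar>g x\<bar>)"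
      using r by (intro exp_lower_Taylor_quadratic) auto
    show "r * \<bar>g x\<bar> / 2 \<le> exp (r / 2 * \<bar>g x\<bar>)"
      using * zero_le_power2[of "r / 2 * \<bar>g x\<bar>"] by linarith
    have "(r / 2 * \<bar>g x\<bar>)\<^sup>2 / 2 \<le> exp (r / 2 * \<bar>g x\<bar>)"
      using * r mult_nonneg_nonneg[of "r/2" "\<bar>g x\<bar>"] by linarith
    thus "(g x)\<^sup>2 \<le> 8 / r\<^sup>2 * exp (r / 2 * \<bar>g x\<bar>)"
      using r by (simp add: power_mult_distrib power_divide field_simps)
  qed
  have int2: "integrable M (\<lambda>x. f x * of_real (g x) * exp (z * of_real (g x)))"
  proof (rule Bochner_Integration.integrable_bound[of M "\<lambda>x. 2 / r * W x"])
    show "AE x in M. norm (f x * of_real (g x) * exp (z * of_real (g x))) \<le> norm (2 / r * W x)"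
    proof (rule AE_I2)
      fix x
      have "\<bar>g x\<bar> \<le> 2 / r * exp (r / 2 * \<bar>g x\<bar>)"
        using g_le(1)[of x] r by (simp add: field_simps)
      also have "\<dots> \<le> 2 / r * exp (r * \<bar>g x\<bar>)"
        using r by (intro mult_left_mono) auto
      finally have "norm (f x) * exp (Re z * g x) * \<bar>g x\<bar> \<le> norm (f x) * exp (Re z * g x) * (2 / r * exp (r * \<bar>g x\<bar>))"
        by (intro mult_left_mono) auto
      thus "norm (f x * of_real (g x) * exp (z * of_real (g x))) \<le> norm (2 / r * W x)"
        using r by (simp add: norm_mult W_def exp_add mult_ac)
    qed
  qed (use W_int in simp_all)
  define K where "K = 8 / r\<^sup>2 * (\<integral>x. W x \<partial>M)"
  have bound: "norm ((I (z + h) - I z) / h - D) \<le> K * norm h" if h: "h \<noteq> 0" "norm h \<le> r / 2" for h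
  proof -
    have "norm (I (z + h) - I z - h * D) =
        norm (\<integral>x. f x * exp ((z + h) * of_real (g x)) - f x * exp (z * of_real (g x))
               - h * (f x * of_real (g x) * exp (z * of_real (g x))) \<partial>M)"
      unfolding I_def D_def using int1[of h] int1[of 0] int2 h r by simp
    also have "\<dots> \<le> (\<integral>x. (norm h)\<^sup>2 * (8 / r\<^sup>2) * W x \<partial>M)"
    proof (rule Bochner_Integration.integral_norm_bound_integral)
      show "integrable M (\<lambda>x. f x * exp ((z + h) * of_real (g x)) - f x * exp (z * of_real (g x))
               - h * (f x * of_real (g x) * exp (z * of_real (g x))))"
        using int1[of h] int1[of 0] int2 h r by auto
      show "integrable M (\<lambda>x. (norm h)\<^sup>2 * (8 / r\<^sup>2) * W x)"
        using W_int by auto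
    next
      fix x
      have "norm (f x * exp ((z + h) * of_real (g x)) - f x * exp (z * of_real (g x))
               - h * (f x * of_real (g x) * exp (z * of_real (g x)))) =
            norm (f x * exp (z * of_real (g x)) * (exp (h * of_real (g x)) - 1 - h * of_real (g x)))"
        by (simp add: algebra_simps exp_add)
      also have "\<dots> \<le> norm (f x) * exp (Re z * g x) *
          ((norm (h * of_real (g x)))\<^sup>2 * exp (norm (h * of_real (g x))))"
        unfolding norm_mult using norm_exp_minus_linear_le[of "h * of_real (g x)"]
        by (intro mult_mono) (auto simp: norm_mult)
      also have "\<dots> = norm (f x) * exp (Re z * g x) * (norm h)\<^sup>2 * ((g x)\<^sup>2 * exp (norm h * \<bar>g x\<bar>))"
        by (simp add: norm_mult power_mult_distrib)
      also have "\<dots> \<le> norm (f x) * exp (Re z * g x) * (norm h)\<^sup>2 *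
           ((8 / r\<^sup>2 * exp (r / 2 * \<bar>g x\<bar>)) * exp (r / 2 * \<bar>g x\<bar>))"
        using g_le(2)[of x] mult_right_mono[OF h(2) abs_ge_zero[of "g x"]]
        by (intro mult_left_mono mult_mono) auto
      also have "\<dots> = (norm h)\<^sup>2 * (8 / r\<^sup>2) * W x"
      proof -
        have "exp (r / 2 * \<bar>g x\<bar>) * exp (r / 2 * \<bar>g x\<bar>) = exp (r * \<bar>g x\<bar>)"
          by (simp add: mult_exp_exp)
        thus ?thesis
          by (simp add: W_def exp_add mult_ac)
      qed
      finally show "norm (f x * exp ((z + h) * of_real (g x)) - f x * exp (z * of_real (g x))
               - h * (f x * of_real (g x) * exp (z * of_real (g x)))) \<le> (norm h)\<^sup>2 * (8 / r\<^sup>2) * W x" .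
    qed
    also have "\<dots> = K * norm h * norm h"
      by (simp add: K_def power2_eq_square)
    finally have "norm (I (z + h) - I z - h * D) \<le> K * norm h * norm h" .
    moreover have "(I (z + h) - I z) / h - D = (I (z + h) - I z - h * D) / h"
      using h by (simp add: field_simps)
    ultimately show ?thesis
      using h by (simp add: norm_divide divide_le_eq)
  qed
  have "((\<lambda>h. (I (z + h) - I z) / h - D) \<longlongrightarrow> 0) (at 0)"
  proof (rule Lim_null_comparison)
    have "eventually (\<lambda>h::complex. h \<in> ball 0 (r / 2) - {0}) (at 0)"
      using r by (intro eventually_at_in_open) auto
    thus "eventually (\<lambda>h. norm ((I (z + h) - I z) / h - D) \<le> K * norm h) (at 0)"
      by eventually_elim (auto intro: bound)
    show "((\<lambda>h::complex. K * norm h) \<longlongrightarrow> 0) (at 0)"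
      by (auto intro!: tendsto_eq_intros)
  qed
  hence "((\<lambda>h. (I (z + h) - I z) / h) \<longlongrightarrow> D) (at 0)"
    by (simp add: Lim_null[of _ D])
  thus ?thesis
    unfolding I_def[symmetric] D_def[symmetric] by (simp add: DERIV_def)
qed

section \<open>Integrable majorants on the real line\<close>

lemma integrable_inverse_one_plus_square: "integrable lborel (\<lambda>x::real. inverse (1 + x\<^sup>2))"
  using integrable_inverse_1_plus_square by (simp add: set_integrable_def einterval_def)

lemma integrable_dominated_inverse_square:
  fixes f :: "real \<Rightarrow> 'b::{banach, second_countable_topology}"
  assumes "f \<in> borel_measurable borel" "\<And>x. norm (f x) \<le> C * inverse (1 + x\<^sup>2)"
  shows "integrable lborel f"
proof (rule Bochner_Integration.integrable_bound)
  show "integrable lborel (\<lambda>x::real. C * inverse (1 + x\<^sup>2))"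
    using integrable_inverse_one_plus_square by simp
  show "AE x in lborel. norm (f x) \<le> norm (C * inverse (1 + x\<^sup>2))"
    using assms(2) by (intro AE_I2) (metis abs_ge_self order_trans real_norm_def)
qed (use assms in auto)

lemma one_plus_square_le_exp: "1 + x\<^sup>2 \<le> 2 * exp \<bar>x\<bar>" for x :: real
proof -
  have "1 + \<bar>x\<bar> + \<bar>x\<bar>\<^sup>2 / 2 \<le> exp \<bar>x\<bar>" by (rule exp_lower_Taylor_quadratic) simp
  thus ?thesis by simp
qed

lemma cosh_ge_square: "x\<^sup>2 / 4 \<le> cosh x" for x :: real
proof -
  have "1 + \<bar>x\<bar> + \<bar>x\<bar>\<^sup>2 / 2 \<le> exp \<bar>x\<bar>" by (rule exp_lower_Taylor_quadratic) simp
  moreover have "cosh x = (exp \<bar>x\<bar> + exp (-\<bar>x\<bar>)) / 2"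
    by (simp add: cosh_def abs_if)
  ultimately show ?thesis
    using exp_ge_zero[of "-\<bar>x\<bar>"] abs_ge_zero[of x] unfolding power2_abs by argo
qed

text \<open>Since cosh x >= x^2/4, the exponent is dominated by a negative quadratic in |x|, which
  leaves room for the factor 1 + x^2.\<close>

lemma exp_cosh_majorant:
  fixes a R :: real
  assumes a: "a > 0"
  shows "exp (R * \<bar>x\<bar> - a * cosh x) \<le> 2 * exp ((R + 1)\<^sup>2 / a) * inverse (1 + x\<^sup>2)"
proof -
  \<comment> \<open>Completing the square. \<open>R + 1\<close> in place of \<open>R\<close> keeps a
    factor exp|x| in reserve, which absorbs 1 + x^2 <= 2 exp|x|.\<close>
  have "0 \<le> ((R + 1) - a * \<bar>x\<bar> / 2)\<^sup>2" by simp
  hence "a * ((R + 1) * \<bar>x\<bar>) \<le> (R + 1)\<^sup>2 + a * (a * (x\<^sup>2 / 4))"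
    by (simp add: power2_eq_square algebra_simps abs_mult_self_eq)
  hence "(R + 1) * \<bar>x\<bar> \<le> (R + 1)\<^sup>2 / a + a * (x\<^sup>2 / 4)"
    using a by (simp add: field_simps)
  also have "a * (x\<^sup>2 / 4) \<le> a * cosh x"
    using a cosh_ge_square by (intro mult_left_mono) auto
  finally have "\<bar>x\<bar> + (R * \<bar>x\<bar> - a * cosh x) \<le> (R + 1)\<^sup>2 / a"
    by (simp add: algebra_simps)
  hence "exp (\<bar>x\<bar> + (R * \<bar>x\<bar> - a * cosh x)) \<le> exp ((R + 1)\<^sup>2 / a)"
    by simp
  hence "2 * exp \<bar>x\<bar> * exp (R * \<bar>x\<bar> - a * cosh x) \<le> 2 * exp ((R + 1)\<^sup>2 / a)"
    by (simp add: exp_add)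
  moreover have "(1 + x\<^sup>2) * exp (R * \<bar>x\<bar> - a * cosh x) \<le> 2 * exp \<bar>x\<bar> * exp (R * \<bar>x\<bar> - a * cosh x)"
    using one_plus_square_le_exp by (intro mult_right_mono) auto
  ultimately have "(1 + x\<^sup>2) * exp (R * \<bar>x\<bar> - a * cosh x) \<le> 2 * exp ((R + 1)\<^sup>2 / a)"
    by linarith
  moreover have "1 + x\<^sup>2 > 0" by (simp add: add_pos_nonneg)
  ultimately show ?thesis by (simp add: field_simps)
qed

lemma integrable_exp_cosh:
  fixes a R :: real
  assumes "a > 0"
  shows "integrable lborel (\<lambda>x. exp (R * \<bar>x\<bar> - a * cosh x))"
  by (rule integrable_dominated_inverse_square[of _ "2 * exp ((R + 1)\<^sup>2 / a)"])
     (use exp_cosh_majorant[OF assms, of R] in \<open>simp_all add: cosh_def\<close>)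

section \<open>Termwise differentiation of unordered series of holomorphic functions\<close>

text \<open>The M-test gives uniform convergence of the finite partial sums on a closed disc, along
  the filter of finite index sets; a uniform limit of holomorphic functions can be differentiated
  termwise. It is applied to the variables u, v and s in turn.\<close>

lemma
  fixes f :: "'i \<Rightarrow> complex \<Rightarrow> complex"
  assumes S: "open S" and hol: "\<And>i. i \<in> A \<Longrightarrow> f i holomorphic_on S"
    and bound: "\<And>i z. i \<in> A \<Longrightarrow> z \<in> S \<Longrightarrow> norm (f i z) \<le> M i" and M: "M summable_on A"
    and F: "\<And>z. z \<in> S \<Longrightarrow> ((\<lambda>i. f i z) has_sum F z) A"
  shows holomorphic_on_has_sum: "F holomorphic_on S"
    and has_sum_deriv: "z \<in> S \<Longrightarrow> ((\<lambda>i. deriv (f i) z) has_sum deriv F z) A"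
proof -
  have *: "\<exists>D. (F has_field_derivative D) (at z) \<and> ((\<lambda>i. deriv (f i) z) has_sum D) A" if z: "z \<in> S" for z
  proof -
    obtain r where r: "r > 0" "cball z r \<subseteq> S"
      using S z open_contains_cball by blast
    have ul: "uniform_limit (cball z r) (\<lambda>X w. \<Sum>i\<in>X. f i w) F (finite_subsets_at_top A)"
      by (rule Weierstrass_m_test_general'[OF _ _ M]) (use r bound F in auto)
    have ev: "eventually (\<lambda>X. continuous_on (cball z r) (\<lambda>w. \<Sum>i\<in>X. f i w) \<and>
       (\<forall>w\<in>ball z r. ((\<lambda>w. \<Sum>i\<in>X. f i w) has_field_derivative (\<Sum>i\<in>X. deriv (f i) w)) (at w)))
       (finite_subsets_at_top A)"
    proof (rule eventually_finite_subsets_at_top_weakI)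
      fix X assume X: "finite X" "X \<subseteq> A"
      show "continuous_on (cball z r) (\<lambda>w. \<Sum>i\<in>X. f i w) \<and>
       (\<forall>w\<in>ball z r. ((\<lambda>w. \<Sum>i\<in>X. f i w) has_field_derivative (\<Sum>i\<in>X. deriv (f i) w)) (at w))"
      proof (intro conjI ballI)
        show "continuous_on (cball z r) (\<lambda>w. \<Sum>i\<in>X. f i w)"
          using X r hol by (intro continuous_on_sum)
            (meson holomorphic_on_imp_continuous_on continuous_on_subset subsetD)
        fix w assume w: "w \<in> ball z r"
        show "((\<lambda>w. \<Sum>i\<in>X. f i w) has_field_derivative (\<Sum>i\<in>X. deriv (f i) w)) (at w)"
          using X r w S hol ball_subset_cball[of z r]
          by (intro DERIV_sum) (meson holomorphic_derivI subsetD)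
      qed
    qed
    obtain g' where "\<And>w. w \<in> ball z r \<Longrightarrow> (F has_field_derivative g' w) (at w) \<and>
         ((\<lambda>X. \<Sum>i\<in>X. deriv (f i) w) \<longlongrightarrow> g' w) (finite_subsets_at_top A)"
      using has_complex_derivative_uniform_limit[OF ev ul] r(1) finite_subsets_at_top_neq_bot by metis
    thus ?thesis using r by (intro exI[of _ "g' z"]) (auto simp: has_sum_def)
  qed
  show "F holomorphic_on S"
    unfolding holomorphic_on_def field_differentiable_def using * has_field_derivative_at_within by blast
  show "((\<lambda>i. deriv (f i) z) has_sum deriv F z) A" if "z \<in> S"
    using *[OF that] DERIV_imp_deriv by blast
qed

section \<open>Exponentially convergent sums over the integers\<close>

lemma polynomial_exp_bound:
  fixes a :: real
  assumes a: "a > 0"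
  obtains C where "C > 0" "\<And>x. x \<ge> 0 \<Longrightarrow> (1 + x) ^ k * exp (- (a * x)) \<le> C * exp (- (a / 2 * x))"
proof
  \<comment> \<open>From 1 + x <= (1 + 1/b) exp(b x), the k-th power costs exp(b k x); this
    \<open>b\<close> makes b k <= a/2, half of the available decay. The \<open>k + 1\<close> avoids
    a division by zero for k = 0.\<close>
  define b where "b = a / (2 * (real k + 1))"
  have b: "b > 0" using a by (simp add: b_def)
  have bk: "b * real k \<le> a / 2" 
    using a by (simp add: b_def field_simps)
  show "(1 + 1 / b) ^ k > 0" using b by (simp add: add_pos_pos)
  fix x :: real assume x: "x \<ge> 0"
  have "1 + x \<le> (1 + 1 / b) * exp (b * x)"
  proof -
    have "1 + b * x \<le> exp (b * x)" by (rule exp_ge_add_one_self)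
    hence "(1 + 1 / b) * (1 + b * x) \<le> (1 + 1 / b) * exp (b * x)"
      using b by (intro mult_left_mono) auto
    moreover have "1 + x \<le> (1 + 1 / b) * (1 + b * x)" using b x by (simp add: field_simps)
    ultimately show ?thesis by linarith
  qed
  hence "(1 + x) ^ k \<le> ((1 + 1 / b) * exp (b * x)) ^ k"
    using x by (intro power_mono) auto
  also have "\<dots> = (1 + 1 / b) ^ k * exp (b * real k * x)"
    by (simp add: power_mult_distrib exp_of_nat_mult[symmetric] mult_ac)
  also have "\<dots> \<le> (1 + 1 / b) ^ k * exp (a / 2 * x)"
    using mult_right_mono[OF bk x] b by (intro mult_left_mono) auto
  finally have "(1 + x) ^ k * exp (- (a * x)) \<le> (1 + 1 / b) ^ k * exp (a / 2 * x) * exp (- (a * x))"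
    by (intro mult_right_mono) auto
  also have "\<dots> = (1 + 1 / b) ^ k * exp (- (a / 2 * x))"
    by (simp add: mult.assoc mult_exp_exp)
  finally show "(1 + x) ^ k * exp (- (a * x)) \<le> (1 + 1 / b) ^ k * exp (- (a / 2 * x))" .
qed

lemma summable_exp_minus: "a > 0 \<Longrightarrow> summable (\<lambda>n. exp (- (a * real n)))"
proof -
  assume a: "a > 0"
  have "exp (- (a * real n)) = exp (- a) ^ n" for n
    by (simp add: exp_of_nat_mult[symmetric] mult.commute)
  thus ?thesis using a by (simp add: summable_geometric)
qed

lemma summable_on_int_even:
  fixes f :: "nat \<Rightarrow> real"
  assumes nat: "f summable_on UNIV"
  shows "(\<lambda>m::int. f (nat \<bar>m\<bar>)) summable_on A"
proof -
  have "(\<lambda>m::int. f (nat \<bar>m\<bar>)) summable_on (range int \<union> range (\<lambda>n. - int n))"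
  proof (rule summable_on_union)
    show "(\<lambda>m::int. f (nat \<bar>m\<bar>)) summable_on range int"
      by (subst summable_on_reindex) (use nat in \<open>auto simp: o_def\<close>)
    show "(\<lambda>m::int. f (nat \<bar>m\<bar>)) summable_on range (\<lambda>n. - int n)"
      by (subst summable_on_reindex) (use nat in \<open>auto simp: o_def inj_on_def\<close>)
  qed
  moreover have "A \<subseteq> range int \<union> range (\<lambda>n. - int n)"
    by (auto simp: image_def) (metis int_cases2)
  ultimately show ?thesis by (rule summable_on_subset)
qed

lemma summable_on_int_exp_minus:
  assumes a: "a > 0"
  shows "(\<lambda>m::int. exp (- (a * real_of_int \<bar>m\<bar>))) summable_on A"
  using summable_on_int_even[OF summable_nonneg_imp_summable_on[OF summable_exp_minus[OF a]], of A] by simp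

lemma summable_on_int_polynomial_exp:
  assumes a: "a > 0"
  shows "(\<lambda>m::int. (1 + real_of_int \<bar>m\<bar>) ^ k * exp (- (a * real_of_int \<bar>m\<bar>))) summable_on A"
proof -
  obtain C where C: "C > 0" "\<And>x. x \<ge> 0 \<Longrightarrow> (1 + x) ^ k * exp (- (a * x)) \<le> C * exp (- (a / 2 * x))"
    using polynomial_exp_bound[OF a, of k] by blast
  have "(\<lambda>m::int. C * exp (- (a / 2 * real_of_int \<bar>m\<bar>))) summable_on UNIV"
    by (intro summable_on_cmult_right summable_on_int_exp_minus) (use a in auto)
  hence "(\<lambda>m::int. (1 + real_of_int \<bar>m\<bar>) ^ k * exp (- (a * real_of_int \<bar>m\<bar>))) summable_on UNIV"
    by (rule summable_on_comparison_test) (use C in auto)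
  thus ?thesis by (rule summable_on_subset) auto
qed

subsection \<open>Poisson summation and the theta transformation\<close>

lemma summable_on_norm_comparison:
  fixes f :: "'i \<Rightarrow> 'b::banach"
  assumes "g summable_on A" "\<And>i. i \<in> A \<Longrightarrow> norm (f i) \<le> g i"
  shows "f summable_on A"
  by (rule abs_summable_summable, rule summable_on_comparison_test[OF assms(1)]) (use assms(2) in auto)

section \<open>Fourier coefficients of periodic entire functions\<close>

definition unit_exp :: "complex \<Rightarrow> complex" where
  "unit_exp z = exp (2 * of_real pi * \<i> * z)"

lemma unit_exp_add: "unit_exp (z + w) = unit_exp z * unit_exp w"
  by (simp add: unit_exp_def distrib_left exp_add)

lemma unit_exp_of_int [simp]: "unit_exp (of_int n) = 1"
  using exp_two_pi_i'[of] exp_integer_2pi[of "of_int n"] by (simp add: unit_exp_def mult_ac)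

lemma unit_exp_eq_1_iff: "unit_exp z = 1 \<longleftrightarrow> z \<in> \<int>"
proof
  assume "unit_exp z = 1"
  then obtain n :: int where n: "Re (2 * of_real pi * \<i> * z) = 0" "Im (2 * of_real pi * \<i> * z) = of_int (2 * n) * pi"
    unfolding unit_exp_def exp_eq_1 by blast
  hence "z = of_int n" by (auto simp: complex_eq_iff)
  thus "z \<in> \<int>" by simp
qed (auto elim!: Ints_cases)

lemma holomorphic_unit_exp [holomorphic_intros]:
  "f holomorphic_on A \<Longrightarrow> (\<lambda>z. unit_exp (f z)) holomorphic_on A"
  unfolding unit_exp_def by (intro holomorphic_intros)

lemma analytic_unit_exp [analytic_intros]:
  "f analytic_on A \<Longrightarrow> (\<lambda>z. unit_exp (f z)) analytic_on A"
  unfolding unit_exp_def by (intro analytic_intros)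

lemma continuous_on_unit_exp [continuous_intros]:
  "continuous_on A f \<Longrightarrow> continuous_on A (\<lambda>z. unit_exp (f z))"
  unfolding unit_exp_def by (intro continuous_intros)

lemma has_field_derivative_unit_exp [derivative_intros]:
  "(f has_field_derivative f') (at z within A) \<Longrightarrow>
   ((\<lambda>z. unit_exp (f z)) has_field_derivative 2 * of_real pi * \<i> * f' * unit_exp (f z)) (at z within A)"
  unfolding unit_exp_def by (auto intro!: derivative_eq_intros)

lemma norm_unit_exp: "norm (unit_exp z) = exp (- (2 * pi * Im z))"
  by (simp add: unit_exp_def)

lemma unit_exp_minus_mult: "unit_exp (- z) * unit_exp z = 1"
  by (simp add: unit_exp_def mult_exp_exp)

lemma periodic_add_of_int:
  fixes F :: "complex \<Rightarrow> 'a"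
  assumes "\<And>z. F (z + 1) = F z"
  shows "F (z + of_int n) = F z"
proof (induction n rule: int_induct[where k = 0])
  case (step1 i)
  thus ?case using assms[of "z + of_int i"] by (simp add: algebra_simps)
next
  case (step2 i)
  thus ?case using assms[of "z + of_int (i - 1)"] by (simp add: algebra_simps)
qed simp

lemma integral_unit_exp_of_int:
  "integral {0..1} (\<lambda>x. unit_exp (of_int m * of_real x)) = (if m = 0 then 1 else 0)"
proof (cases "m = 0")
  case True
  thus ?thesis by (simp add: unit_exp_def)
next
  case False
  have "((\<lambda>x. unit_exp (of_int m * of_real x)) has_integral
          unit_exp (of_int m * of_real 1) / (2 * of_real pi * \<i> * of_int m)
            - unit_exp (of_int m * of_real 0) / (2 * of_real pi * \<i> * of_int m)) {0..1}"
  proof (rule fundamental_theorem_of_calculus)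
    fix x :: real assume "x \<in> {0..1}"
    have "((\<lambda>z. unit_exp (of_int m * z) / (2 * of_real pi * \<i> * of_int m)) has_field_derivative
            unit_exp (of_int m * of_real x)) (at (of_real x))"
      using False by (auto intro!: derivative_eq_intros)
    thus "((\<lambda>x. unit_exp (of_int m * of_real x) / (2 * of_real pi * \<i> * of_int m)) has_vector_derivative
            unit_exp (of_int m * of_real x)) (at x within {0..1})"
      by (rule has_vector_derivative_at_within[OF has_vector_derivative_real_field])
  qed auto
  thus ?thesis using False unit_exp_of_int[of m] unit_exp_of_int[of 0] by (simp add: integral_unique)
qed

text \<open>The difference quotient \<open>G = (F - F 0) / (unit_exp - 1)\<close> is entire, so each Fourier coefficient of
  \<open>F - F 0\<close> is a difference of consecutive Fourier coefficients of \<open>G\<close>; the partial sums telescope, and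
  the Fourier coefficients of \<open>G\<close> tend to \<open>0\<close>.\<close>

lemma fourier_series_periodic_entire:
  fixes F :: "complex \<Rightarrow> complex"
  assumes hol: "F holomorphic_on UNIV" and per: "\<And>z. F (z + 1) = F z"
  shows "(\<lambda>N. \<Sum>m\<in>{-int N..int N}. integral {0..1} (\<lambda>x. F (of_real x) * unit_exp (- (of_int m * of_real x))))
           \<longlonglongrightarrow> F 0"
proof -
  define q where "q z = (F z - F 0) / (unit_exp z - 1)" for z
  define G where "G = remove_sings q"
  have F_ana: "F analytic_on A" for A
    using hol by (meson analytic_on_open analytic_on_subset open_UNIV subset_UNIV)
  have q_ana: "q analytic_on {z}" if "z \<notin> \<int>" for z
    unfolding q_def using that
    by (auto intro!: analytic_intros F_ana analytic_on_subset[OF F_ana] simp: unit_exp_eq_1_iff)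
  have F_int: "F (of_int n) = F 0" for n
    using periodic_add_of_int[of F 0 n] per by simp
  have q_mero: "q meromorphic_on UNIV"
    unfolding q_def
    by (intro meromorphic_intros analytic_on_imp_meromorphic_on F_ana) (auto intro!: analytic_intros)
  have G_ana: "G analytic_on {z}" for z
    unfolding G_def
  proof (cases "z \<in> \<int>")
    case True
    then obtain n where n: "z = of_int n" by (auto elim: Ints_cases)
    obtain F' where F': "(F has_field_derivative F') (at z)"
      using hol by (meson UNIV_I field_differentiable_def holomorphic_on_imp_differentiable_at open_UNIV)
    \<comment> \<open>By periodicity the numerator vanishes at every integer, and the denominator
      has simple zeros there: the singularities are removable.\<close>
    have "((\<lambda>w. (F w - F 0) / (unit_exp w - 1)) \<longlongrightarrow> F' / (2 * of_real pi * \<i>)) (at z)"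
    proof (rule lhopital_complex_simple)
      show "((\<lambda>w. F w - F 0) has_field_derivative F') (at z)"
        using F' by (auto intro!: derivative_eq_intros)
      show "((\<lambda>w. unit_exp w - 1) has_field_derivative 2 * of_real pi * \<i>) (at z)"
        by (auto intro!: derivative_eq_intros simp: n)
    qed (auto simp: n F_int)
    hence "q \<midarrow>z\<rightarrow> F' / (2 * of_real pi * \<i>)"
      unfolding q_def[abs_def] .
    moreover have "isolated_singularity_at q z"
      using q_mero by (metis UNIV_I insert_subset meromorphic_on_isolated_singularity meromorphic_on_subset subset_UNIV)
    ultimately show "remove_sings q analytic_on {z}"
      using remove_sings_analytic_at by blast
  next
    case False
    thus "remove_sings q analytic_on {z}"
      using q_ana remove_sings_analytic_on by blast
  qed
  have G_hol: "G holomorphic_on UNIV"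
    using G_ana analytic_imp_holomorphic analytic_on_analytic_at by blast
  have F_eq: "F z = F 0 + G z * (unit_exp z - 1)" for z
  proof (cases "z \<in> \<int>")
    case True
    thus ?thesis by (auto elim!: Ints_cases simp: F_int)
  next
    case False
    hence "G z = q z" unfolding G_def using q_ana remove_sings_at_analytic by blast
    thus ?thesis using False by (simp add: q_def unit_exp_eq_1_iff)
  qed
  have G_cont [continuous_intros]: "continuous_on A (\<lambda>x. G (f x))" if "continuous_on A f" for A :: "real set" and f
    using continuous_on_compose2[OF holomorphic_on_imp_continuous_on[OF G_hol] that] by simp
  define g where "g m = integral {0..1} (\<lambda>x. G (of_real x) * unit_exp (- (of_int m * of_real x)))" for m :: int
  define c where "c m = integral {0..1} (\<lambda>x. F (of_real x) * unit_exp (- (of_int m * of_real x)))" for m :: int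
  have c_eq: "c m = (if m = 0 then F 0 else 0) + (g (m - 1) - g m)" for m
  proof -
    have "c m = integral {0..1} (\<lambda>x. F 0 * unit_exp (of_int (-m) * of_real x) +
        (G (of_real x) * unit_exp (- (of_int (m - 1) * of_real x))
          - G (of_real x) * unit_exp (- (of_int m * of_real x))))"
      unfolding c_def
    proof (rule integral_cong)
      fix x :: real
      \<comment> \<open>Multiplication of \<open>G\<close> by \<open>unit_exp\<close> shifts its
        Fourier index by one; this is where the difference of consecutive coefficients comes
        from.\<close>
      have "unit_exp (- (of_int (m - 1) * of_real x)) = unit_exp (of_real x) * unit_exp (- (of_int m * of_real x))"
        by (simp add: unit_exp_add[symmetric] algebra_simps)
      thus "F (of_real x) * unit_exp (- (of_int m * of_real x)) = F 0 * unit_exp (of_int (-m) * of_real x) +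
        (G (of_real x) * unit_exp (- (of_int (m - 1) * of_real x))
          - G (of_real x) * unit_exp (- (of_int m * of_real x)))"
        by (subst F_eq) (simp add: algebra_simps)
    qed
    also have "\<dots> = F 0 * integral {0..1} (\<lambda>x. unit_exp (of_int (-m) * of_real x)) + (g (m - 1) - g m)"
      unfolding g_def
      by (subst Henstock_Kurzweil_Integration.integral_add Henstock_Kurzweil_Integration.integral_diff
            integral_mult_right;
          (intro integrable_continuous_interval continuous_intros)?)+ simp
    also have "\<dots> = (if m = 0 then F 0 else 0) + (g (m - 1) - g m)"
      by (subst integral_unit_exp_of_int) auto
    finally show ?thesis .
  qed
  have sum_c: "(\<Sum>m\<in>{-int N..int N}. c m) = F 0 + g (- int N - 1) - g (int N)" for N
  proof (induction N)
    case 0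
    thus ?case by (simp add: c_eq)
  next
    case (Suc N)
    have "{-int (Suc N)..int (Suc N)} = insert (int N + 1) (insert (- int N - 1) {-int N..int N})"
      by auto
    hence "(\<Sum>m\<in>{-int (Suc N)..int (Suc N)}. c m) = c (int N + 1) + (c (- int N - 1) + (\<Sum>m\<in>{-int N..int N}. c m))"
      by simp
    thus ?case unfolding Suc.IH by (simp add: c_eq algebra_simps)
  qed
  have G_der: "(G has_field_derivative deriv G z) (at z)" for z
    using G_hol holomorphic_derivI by blast
  have G'_hol: "deriv G holomorphic_on UNIV"
    using G_hol by (intro holomorphic_deriv) auto
  have G'_cont: "continuous_on A (\<lambda>x. deriv G (f x))" if "continuous_on A f" for A :: "real set" and f
    using continuous_on_compose2[OF holomorphic_on_imp_continuous_on[OF G'_hol] that] by simp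
  obtain K where K: "\<And>x. x \<in> {0..1} \<Longrightarrow> norm (deriv G (of_real x)) \<le> K"
  proof -
    have "compact ((\<lambda>x::real. deriv G (of_real x)) ` {0..1})"
      by (intro compact_continuous_image G'_cont continuous_intros) auto
    then obtain K where "\<forall>y\<in>(\<lambda>x::real. deriv G (of_real x)) ` {0..1}. norm y \<le> K"
      using compact_imp_bounded bounded_iff by metis
    thus ?thesis using that[of K] by blast
  qed
  have g_bound: "norm (g m) \<le> (norm (G 1) + norm (G 0) + K) / real_of_int \<bar>m\<bar>" if m: "m \<noteq> 0" for m
  proof -
    define k where "k = - (2 * of_real pi * \<i> * of_int m)"
    have k: "k \<noteq> 0" "norm k = 2 * pi * real_of_int \<bar>m\<bar>" using m by (simp_all add: k_def norm_mult)
    \<comment> \<open>Integration by parts against the exponential gives \<open>g m\<close> =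
      O(1/|m|), enough for the two end terms of the telescoped sum to vanish.\<close>
    have "((\<lambda>x. deriv G (of_real x) * unit_exp (- (of_int m * of_real x)) +
             G (of_real x) * (k * unit_exp (- (of_int m * of_real x)))) has_integral
          G (of_real 1) * unit_exp (- (of_int m * of_real 1)) - G (of_real 0) * unit_exp (- (of_int m * of_real 0))) {0..1}"
    proof (rule fundamental_theorem_of_calculus)
      fix x :: real assume "x \<in> {0..1}"
      have "((\<lambda>z. G z * unit_exp (- (of_int m * z))) has_field_derivative
             deriv G (of_real x) * unit_exp (- (of_int m * of_real x)) +
             G (of_real x) * (k * unit_exp (- (of_int m * of_real x)))) (at (of_real x))"
        by (rule derivative_eq_intros G_der refl | simp add: k_def)+
      thus "((\<lambda>x. G (of_real x) * unit_exp (- (of_int m * of_real x))) has_vector_derivative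
             deriv G (of_real x) * unit_exp (- (of_int m * of_real x)) +
             G (of_real x) * (k * unit_exp (- (of_int m * of_real x)))) (at x within {0..1})"
        by (rule has_vector_derivative_at_within[OF has_vector_derivative_real_field])
    qed auto
    hence "integral {0..1} (\<lambda>x. deriv G (of_real x) * unit_exp (- (of_int m * of_real x)) +
             G (of_real x) * (k * unit_exp (- (of_int m * of_real x)))) = G 1 - G 0"
      using unit_exp_of_int[of "-m"] unit_exp_of_int[of 0] by (simp add: integral_unique)
    also have "integral {0..1} (\<lambda>x. deriv G (of_real x) * unit_exp (- (of_int m * of_real x)) +
             G (of_real x) * (k * unit_exp (- (of_int m * of_real x)))) =
         integral {0..1} (\<lambda>x. deriv G (of_real x) * unit_exp (- (of_int m * of_real x))) +
         integral {0..1} (\<lambda>x. k * (G (of_real x) * unit_exp (- (of_int m * of_real x))))"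
      by (subst Henstock_Kurzweil_Integration.integral_add)
         (auto intro!: integrable_continuous_interval continuous_intros G'_cont simp: mult_ac)
    also have "integral {0..1} (\<lambda>x. k * (G (of_real x) * unit_exp (- (of_int m * of_real x)))) = k * g m"
      by (simp add: g_def)
    finally have "k * g m = G 1 - G 0 - integral {0..1} (\<lambda>x. deriv G (of_real x) * unit_exp (- (of_int m * of_real x)))"
      by (simp add: algebra_simps)
    also have "norm \<dots> \<le> norm (G 1) + norm (G 0) + K"
    proof -
      have "norm (integral {0..1} (\<lambda>x. deriv G (of_real x) * unit_exp (- (of_int m * of_real x)))) \<le> K * (1 - 0)"
        by (rule integral_bound)
           (use K in \<open>auto intro!: continuous_intros G'_cont simp: norm_mult norm_unit_exp\<close>)
      moreover have "norm (G 1 - G 0) \<le> norm (G 1) + norm (G 0)"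
        by (rule norm_triangle_ineq4)
      ultimately show ?thesis
        by (intro order_trans[OF norm_triangle_ineq4]) simp
    qed
    finally have *: "2 * pi * real_of_int \<bar>m\<bar> * norm (g m) \<le> norm (G 1) + norm (G 0) + K"
      by (simp add: norm_mult k)
    have "real_of_int \<bar>m\<bar> * norm (g m) \<le> (2 * pi) * (real_of_int \<bar>m\<bar> * norm (g m))"
      using mult_right_mono[of 1 "2 * pi" "real_of_int \<bar>m\<bar> * norm (g m)"] pi_ge_two by auto
    with * have "real_of_int \<bar>m\<bar> * norm (g m) \<le> norm (G 1) + norm (G 0) + K"
      by (simp only: mult.assoc)
    thus ?thesis using m by (simp add: field_simps)
  qed
  define B where "B = norm (G 1) + norm (G 0) + K"
  have B_lim: "(\<lambda>n. B / real n) \<longlonglongrightarrow> 0" "(\<lambda>n. B / real (Suc n)) \<longlonglongrightarrow> 0"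
    using lim_const_over_n[of B] LIMSEQ_Suc[OF lim_const_over_n[of B]] by simp_all
  have "(\<lambda>N. g (int N)) \<longlonglongrightarrow> 0"
    by (rule Lim_null_comparison[OF _ B_lim(1)])
       (use g_bound[of "int _"] in \<open>auto intro!: eventually_sequentiallyI[of 1] simp: B_def\<close>)
  moreover have "(\<lambda>N. g (- int N - 1)) \<longlonglongrightarrow> 0"
  proof (rule Lim_null_comparison[OF _ B_lim(2)])
    show "\<forall>\<^sub>F N in sequentially. norm (g (- int N - 1)) \<le> B / real (Suc N)"
    proof (intro always_eventually allI)
      fix N
      have "\<bar>- int N - 1\<bar> = int (Suc N)" by simp
      thus "norm (g (- int N - 1)) \<le> B / real (Suc N)"
        using g_bound[of "- int N - 1"] by (simp add: B_def)
    qed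
  qed
  ultimately have "(\<lambda>N. F 0 + g (- int N - 1) - g (int N)) \<longlonglongrightarrow> F 0 + 0 - 0"
    by (intro tendsto_intros)
  thus ?thesis unfolding sum_c[symmetric] c_def by simp
qed

text \<open>Links the two modes of convergence: the Fourier argument controls symmetric partial sums
  only, while the theta series are unordered sums.\<close>

lemma has_sum_int_imp_symmetric_limit:
  fixes f :: "int \<Rightarrow> 'a::{comm_monoid_add, topological_space}"
  assumes "(f has_sum S) UNIV"
  shows "(\<lambda>N. \<Sum>m\<in>{-int N..int N}. f m) \<longlonglongrightarrow> S"
proof -
  have "filterlim (\<lambda>N. {-int N..int N}) (finite_subsets_at_top UNIV) sequentially"
    unfolding filterlim_finite_subsets_at_top
  proof safe
    fix X :: "int set" assume "finite X"
    hence "eventually (\<lambda>N. \<forall>x\<in>X. nat \<bar>x\<bar> \<le> N) sequentially"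
      by (intro eventually_ball_finite) (auto intro: eventually_ge_at_top)
    thus "eventually (\<lambda>N. finite {-int N..int N} \<and> X \<subseteq> {-int N..int N} \<and> {-int N..int N} \<subseteq> UNIV) sequentially"
      by eventually_elim force
  qed
  thus ?thesis using assms unfolding has_sum_def by (rule filterlim_compose[rotated])
qed

section \<open>Poisson summation for the Gaussian\<close>

text \<open>The characteristic function of the standard normal distribution, after the substitution
  y = sqrt(2 pi t) (x + x0); the shift x0 becomes the phase on the right.\<close>

lemma gaussian_fourier_transform:
  fixes t x0 :: real
  assumes t: "t > 0"
  shows "integrable lborel (\<lambda>x. exp (- (of_real (pi * t) * (of_real (x + x0))\<^sup>2)) * unit_exp (- (of_int m * of_real x)))"
    and "(\<integral>x. exp (- (of_real (pi * t) * (of_real (x + x0))\<^sup>2)) * unit_exp (- (of_int m * of_real x)) \<partial>lborel) =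
         of_real (exp (- (pi * (of_int m)\<^sup>2 / t)) / sqrt t) * unit_exp (of_int m * of_real x0)"
proof -
  define c where "c = sqrt (2 * pi * t)"
  have c: "c > 0" "c\<^sup>2 = 2 * pi * t" using t by (auto simp: c_def)
  define \<phi> where "\<phi> x = exp (- (of_real (pi * t) * (of_real (x + x0))\<^sup>2)) * unit_exp (- (of_int m * of_real x))" for x :: real
  define s where "s = - (2 * pi * of_int m / c)"
  have eq: "of_real (std_normal_density y) * iexp (s * y) = 
        (1 / of_real (sqrt (2 * pi)) * unit_exp (- (of_int m * of_real x0))) * \<phi> (- x0 + (1 / c) * y)" for y
  proof -
    have "pi * t * ((1 / c) * y)\<^sup>2 = y\<^sup>2 / 2"
      using c t by (simp add: power_mult_distrib power_divide)
    hence 1: "exp (- (of_real (pi * t) * (of_real (- x0 + (1 / c) * y + x0))\<^sup>2)) = (of_real (exp (- y\<^sup>2 / 2)) :: complex)"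
      unfolding exp_of_real[symmetric]
      by (intro arg_cong[where f = exp]) (simp flip: of_real_power of_real_mult of_real_minus of_real_divide)
    have 2: "unit_exp (- (of_int m * of_real (- x0 + (1 / c) * y))) = unit_exp (of_int m * of_real x0) * iexp (s * y)"
      by (simp add: unit_exp_def s_def exp_add[symmetric] algebra_simps)
    have 3: "unit_exp (- (of_int m * of_real x0)) * unit_exp (of_int m * of_real x0) = 1"
      by (rule unit_exp_minus_mult)
    show ?thesis unfolding \<phi>_def 1 2 using 3
      by (simp add: std_normal_density_def mult_ac)
  qed
  have int: "integrable lborel (\<lambda>y. of_real (std_normal_density y) * iexp (s * y))"
    by (rule Bochner_Integration.integrable_bound[OF integrable_normal_density[of 1 0]])
       (auto simp: norm_mult)
  have nz: "1 / of_real (sqrt (2 * pi)) * unit_exp (- (of_int m * of_real x0)) \<noteq> 0"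
    by (simp add: unit_exp_def)
  have "integrable lborel (\<lambda>y. inverse (1 / of_real (sqrt (2 * pi)) * unit_exp (- (of_int m * of_real x0))) *
          (of_real (std_normal_density y) * iexp (s * y)))"
    by (intro integrable_mult_right int)
  hence "integrable lborel (\<lambda>y. \<phi> (- x0 + (1 / c) * y))"
    unfolding eq using nz by (simp add: mult.assoc[symmetric])
  thus int\<phi>: "integrable lborel (\<lambda>x. exp (- (of_real (pi * t) * (of_real (x + x0))\<^sup>2)) * unit_exp (- (of_int m * of_real x)))"
    unfolding \<phi>_def[symmetric] using c by (subst (asm) lborel_integrable_real_affine_iff) auto
  have "of_real (exp (- s\<^sup>2 / 2)) = (\<integral>y. std_normal_density y *\<^sub>R iexp (s * y) \<partial>lborel)"
    unfolding fun_cong[OF char_std_normal_distribution, of s, symmetric] char_def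
    by (subst integral_density) (auto simp: normal_density_nonneg)
  also have "\<dots> = (1 / of_real (sqrt (2 * pi)) * unit_exp (- (of_int m * of_real x0))) * (\<integral>y. \<phi> (- x0 + (1 / c) * y) \<partial>lborel)"
    unfolding scaleR_conv_of_real eq by (rule Bochner_Integration.integral_mult_right_zero)
  also have "(\<integral>y. \<phi> (- x0 + (1 / c) * y) \<partial>lborel) = of_real c * (\<integral>x. \<phi> x \<partial>lborel)"
    using c lborel_integral_real_affine[of "1 / c" \<phi> "- x0"] by (simp add: scaleR_conv_of_real field_simps)
  finally have "of_real (exp (- s\<^sup>2 / 2)) = of_real (c / sqrt (2 * pi)) * (unit_exp (- (of_int m * of_real x0)) * (\<integral>x. \<phi> x \<partial>lborel))"
    by (simp add: field_simps)
  also have "c / sqrt (2 * pi) = sqrt t"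
    unfolding c_def by (simp add: real_sqrt_mult)
  finally have *: "of_real (exp (- s\<^sup>2 / 2) / sqrt t) = unit_exp (- (of_int m * of_real x0)) * (\<integral>x. \<phi> x \<partial>lborel)"
    using t by (simp add: field_simps)
  have s_sq: "s\<^sup>2 / 2 = pi * (of_int m)\<^sup>2 / t"
    using c t by (simp add: s_def power_divide power_mult_distrib field_simps power2_eq_square)
  have "(\<integral>x. \<phi> x \<partial>lborel) = of_real (exp (- (pi * (of_int m)\<^sup>2 / t)) / sqrt t) * unit_exp (of_int m * of_real x0)"
  proof -
    have "(\<integral>x. \<phi> x \<partial>lborel) = 
        (unit_exp (- (of_int m * of_real x0)) * (\<integral>x. \<phi> x \<partial>lborel)) * unit_exp (of_int m * of_real x0)"
      using unit_exp_minus_mult[of "of_int m * of_real x0"] by (simp add: algebra_simps)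
    thus ?thesis using * s_sq by simp
  qed
  thus "(\<integral>x. exp (- (of_real (pi * t) * (of_real (x + x0))\<^sup>2)) * unit_exp (- (of_int m * of_real x)) \<partial>lborel) =
         of_real (exp (- (pi * (of_int m)\<^sup>2 / t)) / sqrt t) * unit_exp (of_int m * of_real x0)"
    by (simp add: \<phi>_def)
qed

lemma abs_of_int_le_square: "real_of_int \<bar>d\<bar> \<le> (of_int d)\<^sup>2"
proof -
  have "d = 0 \<or> 1 \<le> \<bar>d\<bar>" by auto
  hence "\<bar>d\<bar> * 1 \<le> \<bar>d\<bar> * \<bar>d\<bar>"
    by (elim disjE) (simp, intro mult_left_mono, auto)
  hence "\<bar>d\<bar> \<le> d\<^sup>2" by (simp add: power2_eq_square)
  thus ?thesis by (metis of_int_le_iff of_int_power)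
qed

text \<open>From (2 Re w + d)^2 >= 0 one gets (Re w + d)^2 >= d^2/2 - (Re w)^2. The quadratic decay
  in d is then weakened to a linear one, so that a geometric series serves as majorant on each
  disc.\<close>

lemma norm_gaussian_translate_le:
  fixes w :: complex
  assumes "t > 0" "norm w \<le> R"
  shows "norm (exp (- (of_real (pi * t) * (w + of_int d)\<^sup>2))) \<le>
         exp (pi * t * R\<^sup>2) * exp (- (pi * t / 2 * real_of_int \<bar>d\<bar>))"
proof -
  have "(Re w)\<^sup>2 + (Im w)\<^sup>2 \<le> R\<^sup>2"
    using assms(2) unfolding cmod_power2[symmetric] by (intro power_mono) auto
  moreover have "0 \<le> (2 * Re w + of_int d)\<^sup>2" by simp
  hence "(of_int d)\<^sup>2 / 2 - (Re w)\<^sup>2 \<le> (Re w + of_int d)\<^sup>2"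
    by (simp add: power2_eq_square algebra_simps)
  moreover have "real_of_int \<bar>d\<bar> \<le> (of_int d)\<^sup>2" by (rule abs_of_int_le_square)
  ultimately have "real_of_int \<bar>d\<bar> / 2 - R\<^sup>2 \<le> (Re w + of_int d)\<^sup>2 - (Im w)\<^sup>2"
    by linarith
  also have "(Re w + of_int d)\<^sup>2 - (Im w)\<^sup>2 = Re ((w + of_int d)\<^sup>2)"
    by (simp add: power2_eq_square)
  finally have "(pi * t) * (real_of_int \<bar>d\<bar> / 2 - R\<^sup>2) \<le> (pi * t) * Re ((w + of_int d)\<^sup>2)"
    using assms by (intro mult_left_mono) auto
  hence "- (pi * t * Re ((w + of_int d)\<^sup>2)) \<le> pi * t * R\<^sup>2 + - (pi * t / 2 * real_of_int \<bar>d\<bar>)"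
    by (simp add: algebra_simps)
  thus ?thesis
    by (simp add: mult_exp_exp)
qed

text \<open>The sum over d is the value at 0 of an entire function \<open>F\<close> of period 1.
  Unfolding its Fourier integrals over [0,1] into integrals over the line identifies the
  coefficients with Fourier transforms of a single Gaussian.\<close>

lemma
  fixes t x0 :: real
  assumes t: "t > 0"
  shows theta_has_sum: "((\<lambda>d::int. exp (- (of_real (pi * t) * (of_real x0 + of_int d)\<^sup>2))) has_sum
            (\<Sum>\<^sub>\<infinity>d::int. exp (- (of_real (pi * t) * (of_real x0 + of_int d)\<^sup>2)) :: complex)) UNIV"
    and theta_transformation:
     "((\<lambda>m::int. of_real (exp (- (pi * (of_int m)\<^sup>2 / t)) / sqrt t) * unit_exp (of_int m * of_real x0)) has_sum
       (\<Sum>\<^sub>\<infinity>d::int. exp (- (of_real (pi * t) * (of_real x0 + of_int d)\<^sup>2)))) UNIV"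
proof -
  define f where "f d z = exp (- (of_real (pi * t) * (z + of_real x0 + of_int d)\<^sup>2))" for d :: int and z :: complex
  define M where "M R d = exp (pi * t * (R + \<bar>x0\<bar>)\<^sup>2) * exp (- (pi * t / 2 * real_of_int \<bar>d\<bar>))" for R and d :: int
  have f_le: "norm (f d z) \<le> M R d" if "norm z \<le> R" for d z R
    unfolding f_def M_def using that norm_triangle_ineq[of z "of_real x0"] t
    by (intro norm_gaussian_translate_le) auto
  have M: "M R summable_on UNIV" for R
    unfolding M_def by (intro summable_on_cmult_right summable_on_int_exp_minus) (use t in auto)
  define F where "F z = (\<Sum>\<^sub>\<infinity>d. f d z)" for z
  have F: "((\<lambda>d. f d z) has_sum F z) UNIV" for z
    unfolding F_def
    by (intro has_sum_infsum summable_on_norm_comparison[OF M[of "norm z"]] f_le) auto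
  have F_hol: "F holomorphic_on UNIV"
  proof -
    have "F analytic_on {z}" for z
    proof -
      have "F holomorphic_on ball 0 (norm z + 1)"
        by (rule holomorphic_on_has_sum[where f = f and A = UNIV and M = "M (norm z + 1)"])
           (use F M f_le[of _ "norm z + 1"] in \<open>auto simp: f_def[abs_def] intro!: holomorphic_intros\<close>)
      thus ?thesis by (auto simp: analytic_at intro!: exI[of _ "ball 0 (norm z + 1)"])
    qed
    thus ?thesis using analytic_imp_holomorphic analytic_on_analytic_at by blast
  qed
  have F_cont: "continuous_on A (\<lambda>x. F (of_real x))" for A :: "real set"
    using continuous_on_compose2[OF holomorphic_on_imp_continuous_on[OF F_hol], of A of_real]
    by (auto intro: continuous_intros)
  have F_per: "F (z + 1) = F z" for z
    unfolding F_def
    by (rule infsum_reindex_bij_witness[of _ "\<lambda>d. d - 1" "\<lambda>d. d + 1"]) (auto simp: f_def algebra_simps)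
  have coeff: "integral {0..1} (\<lambda>x. F (of_real x) * unit_exp (- (of_int m * of_real x))) =
     of_real (exp (- (pi * (of_int m)\<^sup>2 / t)) / sqrt t) * unit_exp (of_int m * of_real x0)" for m :: int
  proof -
    define \<phi> where "\<phi> x = exp (- (of_real (pi * t) * (of_real (x + x0))\<^sup>2)) * unit_exp (- (of_int m * of_real x))" for x :: real
    note G = gaussian_fourier_transform[OF t, of x0 m, folded \<phi>_def]
    have \<phi>_shift: "\<phi> (of_int d + x) = f d (of_real x) * unit_exp (- (of_int m * of_real x))" for d :: int and x
    proof -
      have "- (of_int m * of_real (of_int d + x)) = of_int (- (m * d)) + (- (of_int m * of_real x) :: complex)"
        by (simp add: algebra_simps)
      hence "unit_exp (- (of_int m * of_real (of_int d + x))) = unit_exp (- (of_int m * of_real x))"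
        by (simp only: unit_exp_add unit_exp_of_int mult_1_left)
      thus ?thesis by (simp add: \<phi>_def f_def add_ac)
    qed
    \<comment> \<open>The unfolding: \<open>A d\<close> is the piece of the Gaussian integrand on
      [d, d+1), and \<open>B d\<close> is the same piece moved to [0,1). The exponential has period
      1, so moving it affects the Gaussian factor only.\<close>
    define A where "A d x = indicator {of_int d..<of_int d + 1} x *\<^sub>R \<phi> x" for d :: int and x :: real
    define B where "B d x = indicator {0..<1} x *\<^sub>R \<phi> (of_int d + x)" for d :: int and x :: real
    have A_B: "A d (of_int d + 1 * x) = B d x" for d x
      by (simp add: A_def B_def indicator_def)
    have A_int: "integrable lborel (A d)" for d
      unfolding A_def using G(1) by (intro integrable_mult_indicator) auto
    have B_int: "integrable lborel (B d)" for d
      using lborel_integrable_real_affine[OF A_int[of d], of 1 "of_int d"] by (simp only: A_B)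
    have AB: "(\<integral>x. A d x \<partial>lborel) = (\<integral>x. B d x \<partial>lborel)" "(\<integral>x. norm (A d x) \<partial>lborel) = (\<integral>x. norm (B d x) \<partial>lborel)" for d
      using lborel_integral_real_affine[of 1 "A d" "of_int d"] lborel_integral_real_affine[of 1 "\<lambda>x. norm (A d x)" "of_int d"]
      by (simp_all only: A_B) simp_all
    have B_le: "norm (B d x) \<le> M 1 d * indicator {0..<1} x" for d x
      using f_le[of "of_real x" 1 d] unfolding B_def \<phi>_shift
      by (auto simp: indicator_def norm_mult norm_unit_exp M_def)
    have B_norm: "(\<integral>x. norm (B d x) \<partial>lborel) \<le> M 1 d" for d
    proof -
      have "(\<integral>x. norm (B d x) \<partial>lborel) \<le> (\<integral>x. M 1 d * indicator {0..<1} (x::real) \<partial>lborel)"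
        using B_int B_le by (intro integral_mono) auto
      thus ?thesis by simp
    qed
    have B_summ: "(\<lambda>d. \<integral>x. norm (B d x) \<partial>lborel) summable_on UNIV"
      by (rule summable_on_comparison_test[OF M[of 1]]) (use B_norm in auto)
    have "((\<lambda>d. A d x) has_sum \<phi> x) UNIV" for x
      \<comment> \<open>The intervals are half-open, so exactly one index, the floor of x,
        contributes at each point.\<close>
      by (rule has_sum_finite_neutralI[of "{\<lfloor>x\<rfloor>}"]) 
         (auto simp: A_def indicator_def floor_unique)
    hence "((\<lambda>d. \<integral>x. A d x \<partial>lborel) has_sum (\<integral>x. \<phi> x \<partial>lborel)) UNIV"
      using A_int B_summ by (intro has_sum_integral_swap) (auto simp: AB)
    moreover have "((\<lambda>d. B d x) has_sum (indicator {0..<1} x *\<^sub>R (F (of_real x) * unit_exp (- (of_int m * of_real x))))) UNIV" for x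
      unfolding B_def \<phi>_shift scaleR_conv_of_real
      by (intro has_sum_cmult_right has_sum_cmult_left F)
    hence "((\<lambda>d. \<integral>x. B d x \<partial>lborel) has_sum (\<integral>x. indicator {0..<1} x *\<^sub>R (F (of_real x) * unit_exp (- (of_int m * of_real x))) \<partial>lborel)) UNIV"
      using B_int B_summ by (intro has_sum_integral_swap) auto
    ultimately have "(\<integral>x. \<phi> x \<partial>lborel) = (\<integral>x. indicator {0..<1} x *\<^sub>R (F (of_real x) * unit_exp (- (of_int m * of_real x))) \<partial>lborel)"
      unfolding AB using has_sum_unique by blast
    also have "\<dots> = (\<integral>x. indicator {0..1} x *\<^sub>R (F (of_real x) * unit_exp (- (of_int m * of_real x))) \<partial>lborel)"
    proof (rule integral_cong_AE)
      have [measurable]: "(\<lambda>x::real. F (of_real x) * unit_exp (- (of_int m * of_real x))) \<in> borel_measurable borel"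
        by (intro borel_measurable_continuous_onI continuous_intros F_cont)
      show "(\<lambda>x. indicator {0..<1} x *\<^sub>R (F (of_real x) * unit_exp (- (of_int m * of_real x)))) \<in> borel_measurable lborel"
           "(\<lambda>x. indicator {0..1} x *\<^sub>R (F (of_real x) * unit_exp (- (of_int m * of_real x)))) \<in> borel_measurable lborel"
        by measurable
      show "AE x in lborel. indicator {0..<1} x *\<^sub>R (F (of_real x) * unit_exp (- (of_int m * of_real x))) =
              indicator {0..1} x *\<^sub>R (F (of_real x) * unit_exp (- (of_int m * of_real x)))"
        using AE_lborel_singleton[of 1] by eventually_elim (auto simp: indicator_def)
    qed
    also have "\<dots> = integral {0..1} (\<lambda>x. F (of_real x) * unit_exp (- (of_int m * of_real x)))"
    proof -
      have "set_integrable lborel {0..1} (\<lambda>x. F (of_real x) * unit_exp (- (of_int m * of_real x)))"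
        by (intro borel_integrable_atLeastAtMost' continuous_intros F_cont)
      thus ?thesis using set_borel_integral_eq_integral(2) by (simp add: set_lebesgue_integral_def)
    qed
    finally show ?thesis using G(2) by simp
  qed
  have F0: "F 0 = (\<Sum>\<^sub>\<infinity>d::int. exp (- (of_real (pi * t) * (of_real x0 + of_int d)\<^sup>2)))"
    by (simp add: F_def f_def)
  show "((\<lambda>d::int. exp (- (of_real (pi * t) * (of_real x0 + of_int d)\<^sup>2))) has_sum
            (\<Sum>\<^sub>\<infinity>d::int. exp (- (of_real (pi * t) * (of_real x0 + of_int d)\<^sup>2)) :: complex)) UNIV"
    using F[of 0] unfolding F0 by (simp add: f_def)
  have "(\<lambda>m::int. of_real (exp (- (pi * (of_int m)\<^sup>2 / t)) / sqrt t) * unit_exp (of_int m * of_real x0)) summable_on UNIV"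
  proof (rule summable_on_norm_comparison)
    show "(\<lambda>m::int. (1 / sqrt t) * exp (- (pi / t * real_of_int \<bar>m\<bar>))) summable_on UNIV"
      by (intro summable_on_cmult_right summable_on_int_exp_minus) (use t in auto)
    fix m :: int
    have "pi / t * real_of_int \<bar>m\<bar> \<le> pi / t * (of_int m)\<^sup>2"
      using t abs_of_int_le_square[of m] by (intro mult_left_mono) auto
    thus "norm (of_real (exp (- (pi * (of_int m)\<^sup>2 / t)) / sqrt t) * unit_exp (of_int m * of_real x0))
          \<le> (1 / sqrt t) * exp (- (pi / t * real_of_int \<bar>m\<bar>))"
      using t by (simp add: norm_mult norm_divide norm_unit_exp divide_right_mono)
  qed
  then obtain S where S: "((\<lambda>m::int. of_real (exp (- (pi * (of_int m)\<^sup>2 / t)) / sqrt t) * unit_exp (of_int m * of_real x0)) has_sum S) UNIV"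
    by (auto simp: summable_on_def)
  \<comment> \<open>The coefficient series converges unconditionally to some \<open>S\<close>, and
    its symmetric partial sums tend to \<open>F 0\<close>.\<close>
  have "S = F 0"
    using has_sum_int_imp_symmetric_limit[OF S] fourier_series_periodic_entire[OF F_hol F_per]
    unfolding coeff by (rule LIMSEQ_unique)
  thus "((\<lambda>m::int. of_real (exp (- (pi * (of_int m)\<^sup>2 / t)) / sqrt t) * unit_exp (of_int m * of_real x0)) has_sum
       (\<Sum>\<^sub>\<infinity>d::int. exp (- (of_real (pi * t) * (of_real x0 + of_int d)\<^sup>2)))) UNIV"
    using S F0 by simp
qed

subsection \<open>Modified Bessel functions\<close>

lemma exp_le_cosh: "x \<ge> 0 \<Longrightarrow> cosh x \<le> exp (x::real)"
  by (simp add: cosh_def field_simps)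

lemma exp_nonpos_majorant:
  fixes a :: real
  assumes a: "a > 0"
  obtains C where "C > 0" "\<And>x. x \<le> 0 \<Longrightarrow> exp (a * x) \<le> C * inverse (1 + x\<^sup>2)"
proof -
  obtain C where C: "C > 0" "\<And>x. x \<ge> 0 \<Longrightarrow> (1 + x) ^ 2 * exp (- (a * x)) \<le> C * exp (- (a / 2 * x))"
    using polynomial_exp_bound[OF a, of 2] by blast
  show ?thesis
  proof (rule that[OF C(1)])
    fix x :: real assume x: "x \<le> 0"
    have "1 + x\<^sup>2 \<le> (1 + (-x)) ^ 2"
      using x by (simp add: power2_eq_square algebra_simps)
    hence "(1 + x\<^sup>2) * exp (a * x) \<le> (1 + (-x)) ^ 2 * exp (- (a * (-x)))"
      by (rule mult_mono) auto
    also have "\<dots> \<le> C * exp (- (a / 2 * (-x)))"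
      using x by (intro C(2)) auto
    also have "\<dots> \<le> C * 1"
      using x a C(1) by (intro mult_left_mono) (auto simp: mult_nonneg_nonpos)
    finally have "(1 + x\<^sup>2) * exp (a * x) \<le> C" by simp
    moreover have "1 + x\<^sup>2 > 0" by (simp add: add_pos_nonneg)
    ultimately show "exp (a * x) \<le> C * inverse (1 + x\<^sup>2)" by (simp add: field_simps)
  qed
qed

text \<open>On the right exp x >= cosh x allows the majorant for cosh; on the left exp(\<sigma> x)
  decays by itself since \<sigma> > 0.\<close>

lemma integrable_exp_minus_exp:
  fixes \<sigma> a :: real
  assumes \<sigma>: "\<sigma> > 0" and a: "a > 0"
  shows "integrable lborel (\<lambda>x. exp (\<sigma> * x - a * exp x))"
proof -
  obtain C where C: "C > 0" "\<And>x. x \<le> 0 \<Longrightarrow> exp (\<sigma> * x) \<le> C * inverse (1 + x\<^sup>2)"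
    using exp_nonpos_majorant[OF \<sigma>] by blast
  define C' where "C' = 2 * exp ((\<sigma> + 1)\<^sup>2 / a)"
  show ?thesis
  proof (rule integrable_dominated_inverse_square[where C = "C + C'"])
    fix x :: real
    have pos: "1 + x\<^sup>2 > 0" by (simp add: add_pos_nonneg)
    show "norm (exp (\<sigma> * x - a * exp x)) \<le> (C + C') * inverse (1 + x\<^sup>2)"
    proof (cases "x \<ge> 0")
      case True
      have "exp (\<sigma> * x - a * exp x) \<le> exp (\<sigma> * \<bar>x\<bar> - a * cosh x)"
        using True a exp_le_cosh[OF True] by simp
      also have "\<dots> \<le> C' * inverse (1 + x\<^sup>2)"
        unfolding C'_def by (rule exp_cosh_majorant[OF a])
      also have "\<dots> \<le> (C + C') * inverse (1 + x\<^sup>2)"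
        using C(1) pos by (intro mult_right_mono) auto
      finally show ?thesis by simp
    next
      case False
      have "exp (\<sigma> * x - a * exp x) \<le> exp (\<sigma> * x)" using a by simp
      also have "\<dots> \<le> C * inverse (1 + x\<^sup>2)" using False by (intro C(2)) auto
      also have "\<dots> \<le> (C + C') * inverse (1 + x\<^sup>2)"
        using pos by (intro mult_right_mono) (auto simp: C'_def)
      finally show ?thesis by simp
    qed
  qed auto
qed

lemma exp_tendsto_0_at_right_MInfty: "((ereal \<circ> exp \<circ> real_of_ereal) \<longlongrightarrow> 0) (at_right (-\<infinity>))"
  and exp_tendsto_PInfty_at_left: "((ereal \<circ> exp \<circ> real_of_ereal) \<longlongrightarrow> \<infinity>) (at_left \<infinity>)"
  unfolding zero_ereal_def ereal_tendsto_simps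
  using exp_at_bot exp_at_top by auto

text \<open>Euler's integral with t = exp x; the Jacobian exp x turns t^(s-1) into exp(s x).\<close>

lemma Gamma_exp_integral:
  assumes s: "Re s > 0"
  shows "(\<integral>x. exp (s * of_real x - of_real (exp x)) \<partial>lborel) = Gamma s"
proof -
  define f where "f t = complex_of_real t powr (s - 1) / of_real (exp t)" for t
  have eq: "exp x *\<^sub>R f (exp x) = exp (s * of_real x - of_real (exp x))" for x
  proof -
    have "Ln (complex_of_real (exp x)) = of_real x"
      by (simp add: Ln_of_real del: exp_of_real)
    hence "exp x *\<^sub>R f (exp x) = exp (of_real x) * (exp ((s - 1) * of_real x) / exp (of_real (exp x)))"
      unfolding f_def powr_def scaleR_conv_of_real exp_of_real[symmetric] by simp
    also have "\<dots> = exp (s * of_real x - of_real (exp x))"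
      by (simp add: algebra_simps mult_exp_exp flip: exp_diff)
    finally show ?thesis .
  qed
  have int1: "integrable lborel (\<lambda>x. exp (s * of_real x - of_real (exp x)) :: complex)"
    by (rule Bochner_Integration.integrable_bound[OF integrable_exp_minus_exp[OF s, of 1]]) auto
  have f_cont: "isCont f x" if "x > 0" for x
    using that unfolding f_def by (intro continuous_intros) (auto simp: complex_nonpos_Reals_iff)
  have f_abs: "f absolutely_integrable_on {0<..}"
    unfolding f_def using absolutely_integrable_Gamma_integral'[OF s] .
  have "set_borel_measurable borel {0<..} f"
    unfolding set_borel_measurable_def
    by (rule borel_measurable_continuous_on_indicator) (auto intro!: continuous_at_imp_continuous_on f_cont)
  hence f_int: "set_integrable lborel {0<..} f"
    using f_abs unfolding set_integrable_def set_borel_measurable_def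
    by (subst (asm) integrable_completion) auto
  have "(LBINT x=0..\<infinity>. f x) = (LBINT x=-\<infinity>..\<infinity>. exp x *\<^sub>R f (exp x))"
    by (rule interval_integral_substitution_integrable
        [OF _ _ _ _ _ exp_tendsto_0_at_right_MInfty exp_tendsto_PInfty_at_left])
       (use int1 f_int in \<open>auto simp: eq set_integrable_def einterval_def f_cont intro!: derivative_eq_intros\<close>,
        simp add: greaterThan_def)
  also have "\<dots> = (\<integral>x. exp (s * of_real x - of_real (exp x)) \<partial>lborel)"
    by (simp add: eq interval_lebesgue_integral_def einterval_def set_lebesgue_integral_def)
  finally have "(\<integral>x. exp (s * of_real x - of_real (exp x)) \<partial>lborel) = (LBINT x:{0<..}. f x)"
    by (simp add: interval_lebesgue_integral_def einterval_def greaterThan_def)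
  also have "\<dots> = integral {0<..} f"
    by (rule set_borel_integral_eq_integral(2)[OF f_int])
  also have "\<dots> = Gamma s"
    using Gamma_integral_complex'[OF s] by (simp add: f_def[abs_def] integral_unique)
  finally show ?thesis .
qed

text \<open>A translation by - ln a removes the factor a from a * exp x at the price of a^(-s). This
  is how every power n^(-s) or |c tau + d|^(-2s) enters the proof as an integral.\<close>

lemma
  assumes s: "Re s > 0" and a: "a > 0"
  shows integrable_Gamma_exp: "integrable lborel (\<lambda>x. exp (s * of_real x - of_real (a * exp x)))"
    and Gamma_exp_integral_scaled:
      "(\<integral>x. exp (s * of_real x - of_real (a * exp x)) \<partial>lborel) = Gamma s * exp (- (s * of_real (ln a)))"
proof -
  show "integrable lborel (\<lambda>x. exp (s * of_real x - of_real (a * exp x)))"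
    by (rule Bochner_Integration.integrable_bound[OF integrable_exp_minus_exp[OF s a]]) auto
  have "exp (s * of_real (- ln a + 1 * x) - of_real (a * exp (- ln a + 1 * x))) =
        exp (- (s * of_real (ln a))) * exp (s * of_real x - of_real (exp x))" for x
    using a by (simp add: mult_exp_exp algebra_simps exp_diff)
  hence "(\<integral>x. exp (s * of_real x - of_real (a * exp x)) \<partial>lborel) =
        (\<integral>x. exp (- (s * of_real (ln a))) * exp (s * of_real x - of_real (exp x)) \<partial>lborel)"
    using lborel_integral_real_affine[of 1 "\<lambda>x. exp (s * of_real x - of_real (a * exp x))" "- ln a"] by simp
  also have "\<dots> = exp (- (s * of_real (ln a))) * Gamma s"
    using Gamma_exp_integral[OF s] by simp
  finally show "(\<integral>x. exp (s * of_real x - of_real (a * exp x)) \<partial>lborel) = Gamma s * exp (- (s * of_real (ln a)))"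
    by (simp add: mult.commute)
qed

lemma integral_norm_Gamma_exp:
  assumes s: "Re s > 0" and a: "a > 0"
  shows "(\<integral>x. norm (exp (s * of_real x - of_real (a * exp x))) \<partial>lborel) = Gamma (Re s) * a powr (- Re s)"
proof -
  have "complex_of_real (\<integral>x. norm (exp (s * of_real x - of_real (a * exp x))) \<partial>lborel) =
      (\<integral>x. exp (of_real (Re s) * of_real x - of_real (a * exp x)) \<partial>lborel)"
    unfolding integral_complex_of_real[symmetric]
    by (intro Bochner_Integration.integral_cong) (simp_all flip: exp_of_real)
  also have "\<dots> = Gamma (of_real (Re s)) * exp (- (of_real (Re s) * of_real (ln a)))"
    using assms by (intro Gamma_exp_integral_scaled) auto
  also have "\<dots> = of_real (Gamma (Re s) * a powr (- Re s))"
    using a by (simp add: powr_def Gamma_complex_of_real flip: exp_of_real)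
  finally show ?thesis unfolding of_real_eq_iff .
qed

text \<open>\<open>bessel_B \<nu> y\<close> is \<open>2 * K\<^sub>\<nu> y\<close> in terms of the modified Bessel function, and
  \<open>bessel_M\<close> is its derivative with respect to \<open>\<nu>\<close>.\<close>

definition bessel_B :: "complex \<Rightarrow> complex \<Rightarrow> complex" where
  "bessel_B \<nu> y = (\<integral>x. exp (\<nu> * of_real x - y * of_real (cosh x)) \<partial>lborel)"

definition bessel_M :: "complex \<Rightarrow> complex \<Rightarrow> complex" where
  "bessel_M \<nu> y = (\<integral>x. of_real x * exp (\<nu> * of_real x - y * of_real (cosh x)) \<partial>lborel)"

section \<open>Estimates, derivatives and recurrences for the Bessel integrals\<close>

lemma norm_exp_bessel_le:
  assumes "\<bar>Re \<nu>\<bar> \<le> R"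
  shows "norm (exp (\<nu> * of_real x - y * of_real (cosh x))) \<le> exp (R * \<bar>x\<bar> - Re y * cosh x)"
proof -
  have "Re \<nu> * x \<le> \<bar>Re \<nu>\<bar> * \<bar>x\<bar>" by (metis abs_ge_self abs_mult)
  also have "\<dots> \<le> R * \<bar>x\<bar>" using assms by (intro mult_right_mono) auto
  finally show ?thesis by simp
qed

lemma integrable_bessel_B:
  assumes "Re y > 0"
  shows "integrable lborel (\<lambda>x. exp (\<nu> * of_real x - y * of_real (cosh x)))"
  by (rule Bochner_Integration.integrable_bound[OF integrable_exp_cosh[OF assms, of "\<bar>Re \<nu>\<bar>"]])
     (use norm_exp_bessel_le[of \<nu> "\<bar>Re \<nu>\<bar>"] in \<open>auto simp: cosh_def\<close>)

lemma norm_bessel_M_integrand_le: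
  assumes "\<bar>Re \<nu>\<bar> \<le> R"
  shows "norm (of_real x * exp (\<nu> * of_real x - y * of_real (cosh x))) \<le> exp ((R + 1) * \<bar>x\<bar> - Re y * cosh x)"
proof -
  have "\<bar>x\<bar> \<le> exp \<bar>x\<bar>" using exp_ge_add_one_self[of "\<bar>x\<bar>"] by linarith
  hence "norm (of_real x * exp (\<nu> * of_real x - y * of_real (cosh x))) \<le> exp \<bar>x\<bar> * exp (R * \<bar>x\<bar> - Re y * cosh x)"
    unfolding norm_mult using norm_exp_bessel_le[OF assms] by (intro mult_mono) auto
  thus ?thesis by (simp add: mult_exp_exp algebra_simps)
qed

lemma integrable_bessel_M:
  assumes "Re y > 0"
  shows "integrable lborel (\<lambda>x. of_real x * exp (\<nu> * of_real x - y * of_real (cosh x)))"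
  by (rule Bochner_Integration.integrable_bound[OF integrable_exp_cosh[OF assms, of "\<bar>Re \<nu>\<bar> + 1"]])
     (use norm_bessel_M_integrand_le[of \<nu> "\<bar>Re \<nu>\<bar>"] in \<open>auto simp: cosh_def\<close>)

text \<open>The exponent Re y * cosh x is split into two halves: one is bounded below by a/2 * cosh
  x and keeps the integral finite uniformly in y, the other is at least Re y / 2 and gives the
  exponential decay that makes the Fourier series converge.\<close>

lemma norm_bessel_B_le:
  assumes a: "a > 0" and y: "Re y \<ge> a" and R: "\<bar>Re \<nu>\<bar> \<le> R"
  shows "norm (bessel_B \<nu> y) \<le> (\<integral>x. exp (R * \<bar>x\<bar> - a / 2 * cosh x) \<partial>lborel) * exp (- (Re y / 2))"
proof -
  have "norm (bessel_B \<nu> y) \<le> (\<integral>x. exp (R * \<bar>x\<bar> - a / 2 * cosh x) * exp (- (Re y / 2)) \<partial>lborel)"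
    unfolding bessel_B_def
  proof (rule Bochner_Integration.integral_norm_bound_integral)
    show "integrable lborel (\<lambda>x. exp (\<nu> * of_real x - y * of_real (cosh x)))"
      using a y by (intro integrable_bessel_B) auto
    show "integrable lborel (\<lambda>x. exp (R * \<bar>x\<bar> - a / 2 * cosh x) * exp (- (Re y / 2)))"
      using a integrable_exp_cosh[of "a / 2" R] by (intro integrable_mult_left) auto
    fix x :: real
    have "a / 2 * cosh x \<le> Re y / 2 * cosh x" using y a by (intro mult_right_mono) auto
    moreover have "Re y / 2 * 1 \<le> Re y / 2 * cosh x"
      using y a cosh_real_ge_1[of x] by (intro mult_left_mono) auto
    ultimately have "R * \<bar>x\<bar> - Re y * cosh x \<le> R * \<bar>x\<bar> - a / 2 * cosh x + - (Re y / 2)"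
      by linarith
    hence "exp (R * \<bar>x\<bar> - Re y * cosh x) \<le> exp (R * \<bar>x\<bar> - a / 2 * cosh x) * exp (- (Re y / 2))"
      unfolding mult_exp_exp exp_le_cancel_iff .
    thus "norm (exp (\<nu> * of_real x - y * of_real (cosh x))) \<le> exp (R * \<bar>x\<bar> - a / 2 * cosh x) * exp (- (Re y / 2))"
      using norm_exp_bessel_le[OF R, of x y] by linarith
  qed
  thus ?thesis by simp
qed

lemma bessel_B_uminus: "bessel_B (- \<nu>) y = bessel_B \<nu> y"
  using lborel_integral_real_affine[of "-1" "\<lambda>x. exp (\<nu> * of_real x - y * of_real (cosh x))" 0]
  by (simp add: bessel_B_def)

lemma bessel_M_uminus: "bessel_M (- \<nu>) y = - bessel_M \<nu> y"
  using lborel_integral_real_affine[of "-1" "\<lambda>x. of_real x * exp (\<nu> * of_real x - y * of_real (cosh x))" 0]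
  by (simp add: bessel_M_def)

lemma has_field_derivative_bessel_order:
  assumes "Re y > 0"
  shows "((\<lambda>\<nu>. bessel_B \<nu> y) has_field_derivative bessel_M \<nu> y) (at \<nu>)"
proof -
  have "((\<lambda>z. \<integral>x. exp (- (y * of_real (cosh x))) * exp (z * of_real x) \<partial>lborel) has_field_derivative
           (\<integral>x. exp (- (y * of_real (cosh x))) * of_real x * exp (\<nu> * of_real x) \<partial>lborel)) (at \<nu>)"
  proof (rule has_field_derivative_exp_integral[where r = 1 and g = "\<lambda>x. x"])
    show "integrable lborel (\<lambda>x. norm (exp (- (y * of_real (cosh x)))) * exp (Re \<nu> * x + 1 * \<bar>x\<bar>))"
    proof (rule Bochner_Integration.integrable_bound[OF integrable_exp_cosh[OF assms, of "\<bar>Re \<nu>\<bar> + 1"]])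
      show "AE x in lborel. norm (norm (exp (- (y * of_real (cosh x)))) * exp (Re \<nu> * x + 1 * \<bar>x\<bar>))
              \<le> norm (exp ((\<bar>Re \<nu>\<bar> + 1) * \<bar>x\<bar> - Re y * cosh x))"
      proof (rule AE_I2)
        fix x :: real
        have "Re \<nu> * x \<le> \<bar>Re \<nu>\<bar> * \<bar>x\<bar>" by (metis abs_ge_self abs_mult)
        thus "norm (norm (exp (- (y * of_real (cosh x)))) * exp (Re \<nu> * x + 1 * \<bar>x\<bar>))
              \<le> norm (exp ((\<bar>Re \<nu>\<bar> + 1) * \<bar>x\<bar> - Re y * cosh x))"
          by (simp add: mult_exp_exp algebra_simps)
      qed
    qed (simp add: cosh_def)
  qed (simp_all add: cosh_def)
  moreover have "exp (- (y * of_real (cosh x))) * exp (z * of_real x) = exp (z * of_real x - y * of_real (cosh x))" for x z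
    by (simp add: mult_exp_exp)
  moreover have "exp (- (y * of_real (cosh x))) * of_real x * exp (z * of_real x) = of_real x * exp (z * of_real x - y * of_real (cosh x))" for x z
    by (simp add: exp_diff exp_minus field_simps)
  ultimately show ?thesis
    unfolding bessel_B_def bessel_M_def by simp
qed

lemma has_field_derivative_integral_cosh:
  assumes y: "Re y > 0" and f [measurable]: "f \<in> borel_measurable borel"
    and R: "\<And>x. norm (f x) \<le> exp (R * \<bar>x\<bar>)"
  shows "((\<lambda>y. \<integral>x. f x * exp (- (y * of_real (cosh x))) \<partial>lborel) has_field_derivative
          - (\<integral>x. f x * of_real (cosh x) * exp (- (y * of_real (cosh x))) \<partial>lborel)) (at y)"
proof -
  have "((\<lambda>z. \<integral>x. f x * exp (z * of_real (- cosh x)) \<partial>lborel) has_field_derivative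
           (\<integral>x. f x * of_real (- cosh x) * exp (y * of_real (- cosh x)) \<partial>lborel)) (at y)"
  proof (rule has_field_derivative_exp_integral[where r = "Re y / 2" and g = "\<lambda>x. - cosh x"])
    show "integrable lborel (\<lambda>x. norm (f x) * exp (Re y * - cosh x + Re y / 2 * \<bar>- cosh x\<bar>))"
    proof (rule Bochner_Integration.integrable_bound[OF integrable_exp_cosh[of "Re y / 2" R]])
      show "AE x in lborel. norm (norm (f x) * exp (Re y * - cosh x + Re y / 2 * \<bar>- cosh x\<bar>))
              \<le> norm (exp (R * \<bar>x\<bar> - Re y / 2 * cosh x))"
      proof (rule AE_I2)
        fix x :: real
        have "norm (norm (f x) * exp (Re y * - cosh x + Re y / 2 * \<bar>- cosh x\<bar>)) =
              norm (f x) * exp (- (Re y / 2 * cosh x))"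
          by (simp add: algebra_simps)
        also have "\<dots> \<le> exp (R * \<bar>x\<bar>) * exp (- (Re y / 2 * cosh x))"
          using R by (intro mult_right_mono) auto
        also have "\<dots> = norm (exp (R * \<bar>x\<bar> - Re y / 2 * cosh x))"
          by (simp add: mult_exp_exp)
        finally show "norm (norm (f x) * exp (Re y * - cosh x + Re y / 2 * \<bar>- cosh x\<bar>))
              \<le> norm (exp (R * \<bar>x\<bar> - Re y / 2 * cosh x))" .
      qed
    qed (use y in \<open>auto simp: cosh_def\<close>)
  qed (use y in \<open>auto simp: cosh_def\<close>)
  thus ?thesis by simp
qed

lemma of_real_cosh: "complex_of_real (cosh x) = (exp (of_real x) + exp (- of_real x)) / 2"
  by (simp add: cosh_def flip: exp_of_real)

lemma exp_order_shift:
  fixes \<nu> w x :: complex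
  shows "exp ((\<nu> + 1) * x - w) = exp x * exp (\<nu> * x - w)" "exp ((\<nu> - 1) * x - w) = exp (- x) * exp (\<nu> * x - w)"
  by (simp_all add: mult_exp_exp algebra_simps)

text \<open>Differentiation in y brings down - cosh x, and the two exponentials of cosh x shift the
  order by +1 and -1.\<close>

lemma has_field_derivative_bessel_B_arg_aux:
  assumes y: "Re y > 0"
  shows "((\<lambda>y. bessel_B \<nu> y) has_field_derivative - (bessel_B (\<nu> + 1) y + bessel_B (\<nu> - 1) y) / 2) (at y)"
    and "((\<lambda>y. bessel_M \<nu> y) has_field_derivative - (bessel_M (\<nu> + 1) y + bessel_M (\<nu> - 1) y) / 2) (at y)"
proof -
  have cosh: "exp (\<nu> * of_real x) * of_real (cosh x) * exp (- (y * of_real (cosh x))) =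
     exp ((\<nu> + 1) * of_real x - y * of_real (cosh x)) / 2 + exp ((\<nu> - 1) * of_real x - y * of_real (cosh x)) / 2" for x
  proof -
    have "exp (\<nu> * of_real x) * of_real (cosh x) * exp (- (y * of_real (cosh x))) =
          of_real (cosh x) * exp (\<nu> * of_real x - y * of_real (cosh x))"
      by (simp add: mult_exp_exp[symmetric] exp_diff exp_minus field_simps)
    also have "\<dots> = (exp (of_real x) + exp (- of_real x)) / 2 * exp (\<nu> * of_real x - y * of_real (cosh x))"
      by (rule arg_cong[OF of_real_cosh])
    finally show ?thesis
      unfolding exp_order_shift by (simp add: algebra_simps add_divide_distrib)
  qed
  have "((\<lambda>y. \<integral>x. exp (\<nu> * of_real x) * exp (- (y * of_real (cosh x))) \<partial>lborel) has_field_derivative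
          - (\<integral>x. exp (\<nu> * of_real x) * of_real (cosh x) * exp (- (y * of_real (cosh x))) \<partial>lborel)) (at y)"
  proof (rule has_field_derivative_integral_cosh[OF y, where R = "\<bar>Re \<nu>\<bar>"])
    fix x :: real
    have "Re \<nu> * x \<le> \<bar>Re \<nu>\<bar> * \<bar>x\<bar>" by (metis abs_ge_self abs_mult)
    thus "norm (exp (\<nu> * of_real x)) \<le> exp (\<bar>Re \<nu>\<bar> * \<bar>x\<bar>)" by simp
  qed auto
  moreover have "(\<integral>x. exp (\<nu> * of_real x) * of_real (cosh x) * exp (- (y * of_real (cosh x))) \<partial>lborel) =
      bessel_B (\<nu> + 1) y / 2 + bessel_B (\<nu> - 1) y / 2"
    unfolding cosh bessel_B_def using y by (subst Bochner_Integration.integral_add) (auto intro!: integrable_bessel_B)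
  ultimately show "((\<lambda>y. bessel_B \<nu> y) has_field_derivative - (bessel_B (\<nu> + 1) y + bessel_B (\<nu> - 1) y) / 2) (at y)"
    unfolding mult_exp_exp by (simp add: bessel_B_def[abs_def] add_divide_distrib diff_divide_distrib)
  have "((\<lambda>y. \<integral>x. (of_real x * exp (\<nu> * of_real x)) * exp (- (y * of_real (cosh x))) \<partial>lborel) has_field_derivative
          - (\<integral>x. (of_real x * exp (\<nu> * of_real x)) * of_real (cosh x) * exp (- (y * of_real (cosh x))) \<partial>lborel)) (at y)"
  proof (rule has_field_derivative_integral_cosh[OF y, where R = "\<bar>Re \<nu>\<bar> + 1"])
    fix x :: real
    have "Re \<nu> * x \<le> \<bar>Re \<nu>\<bar> * \<bar>x\<bar>" by (metis abs_ge_self abs_mult)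
    moreover have "\<bar>x\<bar> \<le> exp \<bar>x\<bar>" using exp_ge_add_one_self[of "\<bar>x\<bar>"] by linarith
    ultimately have "norm (of_real x * exp (\<nu> * of_real x)) \<le> exp \<bar>x\<bar> * exp (\<bar>Re \<nu>\<bar> * \<bar>x\<bar>)"
      unfolding norm_mult by (intro mult_mono) auto
    thus "norm (of_real x * exp (\<nu> * of_real x)) \<le> exp ((\<bar>Re \<nu>\<bar> + 1) * \<bar>x\<bar>)"
      by (simp add: mult_exp_exp algebra_simps)
  qed auto
  moreover have "(of_real x * exp (\<nu> * of_real x)) * of_real (cosh x) * exp (- (y * of_real (cosh x))) =
     of_real x * exp ((\<nu> + 1) * of_real x - y * of_real (cosh x)) / 2 + of_real x * exp ((\<nu> - 1) * of_real x - y * of_real (cosh x)) / 2" for x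
    using arg_cong[OF cosh[of x], of "\<lambda>w. of_real x * w"] by (simp add: algebra_simps)
  hence "(\<integral>x. (of_real x * exp (\<nu> * of_real x)) * of_real (cosh x) * exp (- (y * of_real (cosh x))) \<partial>lborel) =
      bessel_M (\<nu> + 1) y / 2 + bessel_M (\<nu> - 1) y / 2"
    unfolding bessel_M_def using y
    by (simp only:, subst Bochner_Integration.integral_add) (auto intro!: integrable_bessel_M)
  ultimately show "((\<lambda>y. bessel_M \<nu> y) has_field_derivative - (bessel_M (\<nu> + 1) y + bessel_M (\<nu> - 1) y) / 2) (at y)"
    unfolding mult.assoc[of _ "exp (\<nu> * of_real _)" "exp _"] mult_exp_exp
    by (simp add: bessel_M_def[abs_def] add_divide_distrib diff_divide_distrib)
qed

text \<open>The integrand vanishes at both infinities, so the integral of its x-derivative is 0;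
  that derivative is a combination of the integrands of orders \<nu>, \<nu> + 1 and \<nu> -
  1.\<close>

lemma bessel_B_recurrence:
  assumes y: "Re y > 0"
  shows "2 * \<nu> * bessel_B \<nu> y = y * (bessel_B (\<nu> + 1) y - bessel_B (\<nu> - 1) y)"
proof -
  define E where "E x = exp (\<nu> * of_real x - y * of_real (cosh x))" for x
  define E' where "E' x = \<nu> * E x - y / 2 * exp ((\<nu> + 1) * of_real x - y * of_real (cosh x))
     + y / 2 * exp ((\<nu> - 1) * of_real x - y * of_real (cosh x))" for x
  have int: "integrable lborel E" "integrable lborel (\<lambda>x. y / 2 * exp ((\<nu> + 1) * of_real x - y * of_real (cosh x)))"
     "integrable lborel (\<lambda>x. y / 2 * exp ((\<nu> - 1) * of_real x - y * of_real (cosh x)))"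
    unfolding E_def using y by (auto intro!: integrable_bessel_B)
  have der: "(E has_vector_derivative E' x) (at x)" for x
  proof -
    have "((\<lambda>z. exp (\<nu> * z - y * ((exp z + exp (- z)) / 2))) has_field_derivative
            exp (\<nu> * of_real x - y * ((exp (of_real x) + exp (- of_real x)) / 2)) * (\<nu> - y * ((exp (of_real x) - exp (- of_real x)) / 2)))
          (at (of_real x))"
      by (auto intro!: derivative_eq_intros simp: field_simps)
    from has_vector_derivative_real_field[OF this]
    have "((\<lambda>x. exp (\<nu> * of_real x - y * ((exp (of_real x) + exp (- of_real x)) / 2))) has_vector_derivative
        exp (\<nu> * of_real x - y * ((exp (of_real x) + exp (- of_real x)) / 2)) * (\<nu> - y * ((exp (of_real x) - exp (- of_real x)) / 2))) (at x)" .
    moreover have "exp (\<nu> * of_real x - y * of_real (cosh x)) * (\<nu> - y * ((exp (of_real x) - exp (- of_real x)) / 2)) = E' x"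
      unfolding E'_def E_def exp_order_shift by (simp add: algebra_simps diff_divide_distrib)
    ultimately show ?thesis unfolding of_real_cosh[symmetric] by (simp add: E_def[abs_def])
  qed
  have bnd: "norm (E x) \<le> 2 * exp ((\<bar>Re \<nu>\<bar> + 1)\<^sup>2 / Re y) * inverse (1 + x\<^sup>2)" for x
    unfolding E_def using norm_exp_bessel_le[of \<nu> "\<bar>Re \<nu>\<bar>" x y] exp_cosh_majorant[OF y, of "\<bar>Re \<nu>\<bar>" x] by linarith
  have lim: "(E \<longlongrightarrow> 0) at_top" "(E \<longlongrightarrow> 0) at_bot"
    by (rule Lim_null_comparison[OF always_eventually[OF allI[OF bnd]]], real_asymp)+
  have "(LBINT x=-\<infinity>..\<infinity>. E' x) = 0 - 0"
  proof (rule interval_integral_FTC_integrable)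
    show "isCont E' x" for x
      unfolding E'_def E_def cosh_def by (intro continuous_intros)
    show "set_integrable lborel (einterval (-\<infinity>) \<infinity>) E'"
      unfolding E'_def using int by (auto simp: set_integrable_def einterval_def)
    show "((E \<circ> real_of_ereal) \<longlongrightarrow> 0) (at_right (-\<infinity>))" "((E \<circ> real_of_ereal) \<longlongrightarrow> 0) (at_left \<infinity>)"
      unfolding ereal_tendsto_simps using lim by auto
  qed (use der in auto)
  hence "(\<integral>x. E' x \<partial>lborel) = 0"
    by (simp add: interval_lebesgue_integral_def einterval_def set_lebesgue_integral_def)
  also have "(\<integral>x. E' x \<partial>lborel) = \<nu> * bessel_B \<nu> y - y / 2 * bessel_B (\<nu> + 1) y + y / 2 * bessel_B (\<nu> - 1) y"
  proof -
    have int1: "integrable lborel (\<lambda>x. \<nu> * E x)" using int(1) by simp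
    show ?thesis
      unfolding E'_def Bochner_Integration.integral_add[OF Bochner_Integration.integrable_diff[OF int1 int(2)] int(3)]
        Bochner_Integration.integral_diff[OF int1 int(2)] Bochner_Integration.integral_mult_right_zero
      by (simp add: bessel_B_def E_def)
  qed
  finally show ?thesis by (simp add: field_simps)
qed

text \<open>The recurrence for \<open>bessel_B\<close> holds for every order, so both sides may be
  differentiated with respect to \<nu>.\<close>

lemma bessel_M_recurrence:
  assumes y: "Re y > 0"
  shows "2 * bessel_B \<nu> y + 2 * \<nu> * bessel_M \<nu> y = y * (bessel_M (\<nu> + 1) y - bessel_M (\<nu> - 1) y)"
proof -
  note [derivative_intros] = has_field_derivative_bessel_order[OF y, THEN DERIV_chain2]
  have "((\<lambda>\<nu>. 2 * \<nu> * bessel_B \<nu> y) has_field_derivative 2 * bessel_B \<nu> y + 2 * \<nu> * bessel_M \<nu> y) (at \<nu>)"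
    by (auto intro!: derivative_eq_intros)
  moreover have "((\<lambda>\<nu>. y * (bessel_B (\<nu> + 1) y - bessel_B (\<nu> - 1) y)) has_field_derivative
      y * (bessel_M (\<nu> + 1) y - bessel_M (\<nu> - 1) y)) (at \<nu>)"
    by (auto intro!: derivative_eq_intros)
  ultimately show ?thesis
    unfolding bessel_B_recurrence[OF y] by (rule DERIV_unique)
qed

text \<open>The recurrence eliminates order \<nu> + 1. With \<nu> = 1/2 only the orders 1/2 and -1/2
  remain, and these are related by reflection.\<close>

lemma has_field_derivative_bessel_B_arg:
  assumes y: "Re y > 0"
  shows "((\<lambda>y. bessel_B \<nu> y) has_field_derivative - bessel_B (\<nu> - 1) y - \<nu> / y * bessel_B \<nu> y) (at y)"
proof -
  have [simp]: "y \<noteq> 0" using y by auto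
  have "- (bessel_B (\<nu> + 1) y + bessel_B (\<nu> - 1) y) / 2 = - bessel_B (\<nu> - 1) y - \<nu> / y * bessel_B \<nu> y"
    using bessel_B_recurrence[OF y, of \<nu>] by (simp add: field_simps)
  thus ?thesis by (rule DERIV_cong[OF has_field_derivative_bessel_B_arg_aux(1)[OF y]])
qed

lemma has_field_derivative_bessel_M_arg:
  assumes y: "Re y > 0"
  shows "((\<lambda>y. bessel_M \<nu> y) has_field_derivative
            - bessel_M (\<nu> - 1) y - (bessel_B \<nu> y + \<nu> * bessel_M \<nu> y) / y) (at y)"
proof -
  have [simp]: "y \<noteq> 0" using y by auto
  have "- (bessel_M (\<nu> + 1) y + bessel_M (\<nu> - 1) y) / 2 = - bessel_M (\<nu> - 1) y - (bessel_B \<nu> y + \<nu> * bessel_M \<nu> y) / y"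
    using bessel_M_recurrence[OF y, of \<nu>] by (simp add: field_simps)
  thus ?thesis by (rule DERIV_cong[OF has_field_derivative_bessel_B_arg_aux(2)[OF y]])
qed

section \<open>Bessel functions of order one half\<close>

text \<open>With w = sinh(x/2) one has cosh x = 1 + 2 w^2, and the Jacobian cosh(x/2)/2 is an
  average of exp(x/2) and exp(-x/2). The Gaussian integral in w therefore equals a combination of
  orders 1/2 and -1/2, which coincide.\<close>

lemma bessel_B_half:
  assumes y: "y > 0"
  shows "bessel_B (1 / 2) (of_real y) = of_real (sqrt (2 * pi / y) * exp (- y))"
proof -
  \<comment> \<open>This \<open>t\<close> turns exp(-2 y w^2) into exp(- pi t w^2), whose integral
    is the case m = 0 of \<open>gaussian_fourier_transform\<close>.\<close>
  define t where "t = 2 * y / pi"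
  have t: "t > 0" "pi * t = 2 * y" using y by (auto simp: t_def)
  define f where "f w = complex_of_real (exp (- y - 2 * y * w\<^sup>2))" for w
  have f_eq: "f w = of_real (exp (- y)) * (exp (- (of_real (pi * t) * (of_real (w + 0))\<^sup>2)) * unit_exp (- (of_int 0 * of_real w)))" for w
  proof -
    have "exp (- (of_real (pi * t) * (of_real (w + 0))\<^sup>2)) = complex_of_real (exp (- (2 * y * w\<^sup>2)))"
      unfolding t exp_of_real[symmetric] by simp
    moreover have "unit_exp 0 = 1" by (simp add: unit_exp_def)
    ultimately show ?thesis by (simp add: f_def flip: of_real_mult exp_add)
  qed
  have int_f: "integrable lborel f"
    unfolding f_eq using gaussian_fourier_transform(1)[OF t(1), of 0 0] by (intro integrable_mult_right) simp
  have "(\<integral>w. f w \<partial>lborel) = of_real (exp (- y)) * of_real (1 / sqrt t)"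
    unfolding f_eq using gaussian_fourier_transform(2)[OF t(1), of 0 0]
    by (simp add: unit_exp_def)
  define g where "g x = sinh (x / 2)" for x :: real
  define g' where "g' x = cosh (x / 2) / 2" for x :: real
  have eq: "g' x *\<^sub>R f (g x) = 1 / 4 * exp (1 / 2 * of_real x - of_real y * of_real (cosh x))
       + 1 / 4 * exp (- (1 / 2) * of_real x - of_real y * of_real (cosh x))" for x
  proof -
    have "cosh x = 1 + 2 * (sinh (x / 2))\<^sup>2"
      using cosh_double[of "x / 2"] cosh_square_eq[of "x / 2"] by simp
    hence "f (g x) = exp (- (of_real y * of_real (cosh x)))"
      by (simp add: f_def g_def algebra_simps flip: exp_of_real)
    moreover have "complex_of_real (g' x) = 1 / 4 * exp (1 / 2 * of_real x) + 1 / 4 * exp (- (1 / 2) * of_real x)"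
      by (simp add: g'_def cosh_def flip: exp_of_real)
    moreover have "exp (w - of_real y * of_real (cosh x)) = exp w * exp (- (of_real y * of_real (cosh x)))" for w :: complex
      by (simp add: mult_exp_exp)
    ultimately show ?thesis
      by (simp only: scaleR_conv_of_real) (simp add: algebra_simps)
  qed
  have int: "integrable lborel (\<lambda>x. exp (\<nu> * of_real x - of_real y * of_real (cosh x)) :: complex)" for \<nu>
    using y by (intro integrable_bessel_B) auto
  have "(LBINT x=-\<infinity>..\<infinity>. f x) = (LBINT x=-\<infinity>..\<infinity>. g' x *\<^sub>R f (g x))"
  proof (rule interval_integral_substitution_integrable)
    show "(g has_real_derivative g' x) (at x)" for x
      unfolding g_def g'_def by (auto intro!: derivative_eq_intros)
    show "isCont f (g x)" "isCont g' x" for x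
      unfolding f_def g'_def by (auto intro!: continuous_intros)
    show "((ereal \<circ> g \<circ> real_of_ereal) \<longlongrightarrow> - \<infinity>) (at_right (- \<infinity>))"
      unfolding ereal_tendsto_simps g_def sinh_field_def by real_asymp
    show "((ereal \<circ> g \<circ> real_of_ereal) \<longlongrightarrow> \<infinity>) (at_left \<infinity>)"
      unfolding ereal_tendsto_simps g_def sinh_field_def by real_asymp
    show "set_integrable lborel (einterval (- \<infinity>) \<infinity>) (\<lambda>x. g' x *\<^sub>R f (g x))"
    proof -
      have "integrable lborel (\<lambda>x. g' x *\<^sub>R f (g x))"
        unfolding eq by (intro Bochner_Integration.integrable_add integrable_mult_right int)
      thus ?thesis by (simp add: set_integrable_def einterval_def)
    qed
    show "set_integrable lborel (einterval (- \<infinity>) \<infinity>) f"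
      using int_f by (simp add: set_integrable_def einterval_def)
  qed (auto simp: g'_def)
  hence "(\<integral>x. f x \<partial>lborel) = (\<integral>x. g' x *\<^sub>R f (g x) \<partial>lborel)"
    by (simp add: interval_lebesgue_integral_def einterval_def set_lebesgue_integral_def)
  also have "\<dots> = 1 / 4 * bessel_B (1 / 2) (of_real y) + 1 / 4 * bessel_B (- (1 / 2)) (of_real y)"
    unfolding eq bessel_B_def
    by (subst Bochner_Integration.integral_add)
       (use int[of "1 / 2"] int[of "- (1 / 2)"] in \<open>auto simp del: times_divide_eq_left mult_minus_left\<close>)
  also have "\<dots> = bessel_B (1 / 2) (of_real y) / 2"
    by (simp add: bessel_B_uminus)
  finally have "bessel_B (1 / 2) (of_real y) = of_real (2 * (exp (- y) * (1 / sqrt t)))"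
    using \<open>(\<integral>w. f w \<partial>lborel) = of_real (exp (- y)) * of_real (1 / sqrt t)\<close> by (simp add: field_simps)
  also have "2 * (exp (- y) * (1 / sqrt t)) = sqrt (2 * pi / y) * exp (- y)"
  proof -
    have "sqrt (2 * pi / y) = sqrt (4 / t)" using y by (simp add: t_def)
    also have "\<dots> = 2 / sqrt t" by (simp add: real_sqrt_divide)
    finally show ?thesis by simp
  qed
  finally show ?thesis .
qed

text \<open>By the recurrences, \<open>H y = sqrt y * exp (- y) * bessel_M (1/2) y\<close> has derivative
  \<open>- sqrt (2 * pi) * exp (- 2 * y) / y\<close>, and it vanishes at infinity.\<close>

lemma bessel_M_half:
  assumes y: "y > 0"
  shows "bessel_M (1 / 2) (of_real y) = - of_real (sqrt (2 * pi / y) * exp y * Ei (- 2 * y))"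
proof -
  define H where "H y = sqrt y * exp (- y) * Re (bessel_M (1 / 2) (of_real y))" for y :: real
  have M_real: "bessel_M (1 / 2) (of_real y) = of_real (Re (bessel_M (1 / 2) (of_real y)))" for y :: real
  proof -
    have "bessel_M (1 / 2) (of_real y) = (\<integral>x. of_real (x * exp (x / 2 - y * cosh x)) \<partial>lborel)"
      unfolding bessel_M_def by (intro Bochner_Integration.integral_cong) (simp_all flip: exp_of_real)
    thus ?thesis unfolding integral_complex_of_real by simp
  qed
  have H_der: "(H has_real_derivative - (sqrt (2 * pi) * exp (- 2 * y) / y)) (at y)" if y: "y > 0" for y
  proof -
    define m where "m = Re (bessel_M (1 / 2) (of_real y))"
    define b where "b = sqrt (2 * pi / y) * exp (- y)"
    have "((\<lambda>x. bessel_M (1 / 2) (of_real x)) has_vector_derivative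
            - bessel_M (1 / 2 - 1) (of_real y) - (bessel_B (1 / 2) (of_real y) + 1 / 2 * bessel_M (1 / 2) (of_real y)) / of_real y) (at y)"
      using y by (intro has_vector_derivative_real_field has_field_derivative_bessel_M_arg) auto
    \<comment> \<open>\<open>bessel_M\<close> is odd in the order, so order -1/2 returns to 1/2 and
      a first-order equation for \<open>m\<close> alone results.\<close>
    also have "bessel_M (1 / 2 - 1) (of_real y) = - of_real m"
      using bessel_M_uminus[of "1 / 2" "of_real y"] M_real[of y] by (simp add: m_def)
    also have "bessel_B (1 / 2) (of_real y) = of_real b"
      unfolding b_def by (rule bessel_B_half[OF y])
    also have "bessel_M (1 / 2) (of_real y) = of_real m"
      unfolding m_def by (rule M_real)
    also have "- (- complex_of_real m) - (of_real b + 1 / 2 * of_real m) / of_real y = of_real (m - (b + m / 2) / y)"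
      by simp
    finally have "((\<lambda>x. Re (bessel_M (1 / 2) (of_real x))) has_vector_derivative Re (of_real (m - (b + m / 2) / y))) (at y)"
      by (rule bounded_linear.has_vector_derivative[OF bounded_linear_Re])
    hence der: "((\<lambda>x. Re (bessel_M (1 / 2) (of_real x))) has_real_derivative m - (b + m / 2) / y) (at y)"
      by (simp add: has_real_derivative_iff_has_vector_derivative)
    have "((\<lambda>y. sqrt y * exp (- y)) has_real_derivative inverse (sqrt y) / 2 * exp (- y) - sqrt y * exp (- y)) (at y)"
      using y by (auto intro!: derivative_eq_intros)
    from DERIV_mult[OF this der]
    have "(H has_real_derivative (inverse (sqrt y) / 2 * exp (- y) - sqrt y * exp (- y)) * m
            + sqrt y * exp (- y) * (m - (b + m / 2) / y)) (at y)"
      unfolding H_def[abs_def] m_def[symmetric] by (simp add: mult.commute)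
    also have "(inverse (sqrt y) / 2 * exp (- y) - sqrt y * exp (- y)) * m
            + sqrt y * exp (- y) * (m - (b + m / 2) / y) = - (sqrt (2 * pi) * exp (- 2 * y) / y)"
    proof -
      have "sqrt y * sqrt y = y" using y by simp
      hence "inverse (sqrt y) = sqrt y / y" using y by (simp add: field_simps)
      moreover have "sqrt y * b = sqrt (2 * pi) * exp (- y)" using y by (simp add: b_def real_sqrt_divide)
      moreover have "exp (- 2 * y) = exp (- y) * exp (- y)" by (simp add: mult_exp_exp)
      moreover have "(r / y / 2 * e - r * e) * m + r * e * (m - (b + m / 2) / y) = - (e * (r * b) / y)" for r e :: real
        by (simp add: algebra_simps add_divide_distrib diff_divide_distrib)
      ultimately show ?thesis by simp
    qed
    finally show ?thesis .
  qed
  have H_lim: "(H \<longlongrightarrow> 0) at_top"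
  proof -
    \<comment> \<open>The majorant at y = 1 bounds \<open>bessel_M\<close> for all y >= 1; the limit
      is then forced by sqrt y * exp(-y).\<close>
    define K :: real where "K = (\<integral>x. exp ((1 / 2 + 1) * \<bar>x\<bar> - 1 * cosh x) \<partial>lborel)"
    have "norm (H y) \<le> sqrt y * exp (- y) * K" if "y \<ge> 1" for y
    proof -
      have "norm (bessel_M (1 / 2) (of_real y)) \<le> K"
        unfolding bessel_M_def K_def
      proof (rule Bochner_Integration.integral_norm_bound_integral)
        show "integrable lborel (\<lambda>x. exp ((1 / 2 + 1) * \<bar>x\<bar> - 1 * cosh x :: real))"
          by (rule integrable_exp_cosh) simp
        show "integrable lborel (\<lambda>x. complex_of_real x * exp (1 / 2 * of_real x - of_real y * of_real (cosh x)))"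
          using that by (intro integrable_bessel_M) auto
        fix x :: real
        have "1 * cosh x \<le> y * cosh x" using that by (intro mult_right_mono) auto
        hence "exp ((1 / 2 + 1) * \<bar>x\<bar> - y * cosh x) \<le> exp ((1 / 2 + 1) * \<bar>x\<bar> - 1 * cosh x)" by simp
        moreover have "norm (complex_of_real x * exp (1 / 2 * of_real x - of_real y * of_real (cosh x)))
            \<le> exp ((1 / 2 + 1) * \<bar>x\<bar> - y * cosh x)"
          using norm_bessel_M_integrand_le[of "1 / 2" "1 / 2" x "of_real y"] by simp
        ultimately show "norm (complex_of_real x * exp (1 / 2 * of_real x - of_real y * of_real (cosh x)))
                \<le> exp ((1 / 2 + 1) * \<bar>x\<bar> - 1 * cosh x)"
          by (rule order_trans[rotated])
      qed
      hence "\<bar>Re (bessel_M (1 / 2) (of_real y))\<bar> \<le> K"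
        using abs_Re_le_cmod order_trans by blast
      thus ?thesis using that by (simp add: H_def abs_mult mult_left_mono)
    qed
    hence "eventually (\<lambda>y. norm (H y) \<le> sqrt y * exp (- y) * K) at_top"
      by (intro eventually_at_top_linorderI)
    moreover have "((\<lambda>y. sqrt y * exp (- y) * K) \<longlongrightarrow> 0) at_top"
      by real_asymp
    ultimately show ?thesis by (rule Lim_null_comparison)
  qed
  define h where "h t = exp (- 2 * y * t) / t" for t :: real
  have FTC: "(h has_integral (H y - H (y * b)) / sqrt (2 * pi)) {1..b}" if b: "b \<ge> 1" for b
  proof -
    \<comment> \<open>A primitive of \<open>h\<close> in t is - H(y t) / sqrt(2 pi): the inner
      derivative y cancels the y in the denominator y t.\<close>
    have "(h has_integral (- H (y * b) / sqrt (2 * pi)) - (- H (y * 1) / sqrt (2 * pi))) {1..b}"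
    proof (rule fundamental_theorem_of_calculus)
      fix t assume t: "t \<in> {1..b}"
      have "((\<lambda>t. - H (y * t) / sqrt (2 * pi)) has_real_derivative
          - ((- (sqrt (2 * pi) * exp (- 2 * (y * t)) / (y * t))) * y) / sqrt (2 * pi)) (at t)"
      proof (rule DERIV_cdivide, rule DERIV_minus, rule DERIV_chain2[OF H_der])
        show "((\<lambda>t. y * t) has_real_derivative y) (at t)"
          by (auto intro!: derivative_eq_intros)
      qed (use t y in auto)
      also have "- ((- (sqrt (2 * pi) * exp (- 2 * (y * t)) / (y * t))) * y) / sqrt (2 * pi) = h t"
      proof -
        have "- ((- (c * e / (y * t))) * y) / c = e / t" if "c > 0" for c e :: real
          using that t y by (simp add: field_simps)
        from this[of "sqrt (2 * pi)" "exp (- 2 * (y * t))"] show ?thesis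
          by (simp add: h_def mult.assoc)
      qed
      finally show "((\<lambda>t. - H (y * t) / sqrt (2 * pi)) has_vector_derivative h t) (at t within {1..b})"
        unfolding has_real_derivative_iff_has_vector_derivative by (rule has_vector_derivative_at_within)
    qed (use b in auto)
    thus ?thesis by (simp add: diff_divide_distrib)
  qed
  have "(h has_integral H y / sqrt (2 * pi)) {1..}"
  proof (rule has_integral_to_inf)
    show "h integrable_on {1..b}" for b
      using FTC[of b] by (cases "b \<ge> 1") (auto simp: integrable_on_def intro: has_integral_empty)
    show "h t \<ge> 0" if "t \<ge> 1" for t using that by (simp add: h_def)
    have "filterlim (\<lambda>b. y * b) at_top at_top" using y by real_asymp
    hence "((\<lambda>b. (H y - H (y * b)) / sqrt (2 * pi)) \<longlongrightarrow> (H y - 0) / sqrt (2 * pi)) at_top"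
      by (intro tendsto_intros filterlim_compose[OF H_lim]) auto
    moreover have "eventually (\<lambda>b. (H y - H (y * b)) / sqrt (2 * pi) = integral {1..b} h) at_top"
      using eventually_ge_at_top[of 1] by eventually_elim (rule integral_unique[OF FTC, symmetric])
    ultimately show "((\<lambda>b. integral {1..b} h) \<longlongrightarrow> H y / sqrt (2 * pi)) at_top"
      by (simp add: tendsto_cong)
  qed
  hence "Ei (- 2 * y) = - (H y / sqrt (2 * pi))"
    unfolding Ei_def h_def[abs_def] by (simp add: integral_unique)
  hence "- (sqrt (2 * pi / y) * exp y * Ei (- 2 * y)) = sqrt (2 * pi / y) * exp y * (H y / sqrt (2 * pi))"
    by simp
  also have "\<dots> = Re (bessel_M (1 / 2) (of_real y))"
    using y by (simp add: H_def real_sqrt_divide exp_minus)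
  finally have eq: "- (sqrt (2 * pi / y) * exp y * Ei (- 2 * y)) = Re (bessel_M (1 / 2) (of_real y))" .
  show ?thesis by (subst M_real, subst eq[symmetric]) simp
qed

subsection \<open>The Riemann zeta function\<close>

text \<open>For t > 0 this is (\<theta>(t) - 1)/2, where \<theta>(t) is the sum of exp(- pi m^2 t)
  over all integers m.\<close>

definition theta_tail :: "real \<Rightarrow> real" where
  "theta_tail t = (\<Sum>n. exp (- (pi * (real (Suc n))\<^sup>2 * t)))"

lemma summable_theta_tail:
  assumes "t > 0"
  shows "summable (\<lambda>n. exp (- (pi * (real (Suc n))\<^sup>2 * t)))"
proof (rule summable_comparison_test'[OF summable_exp_minus[of "pi * t"], of 0])
  fix n :: nat
  have "real n \<le> (real (Suc n))\<^sup>2" by (simp add: power2_eq_square algebra_simps)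
  hence "pi * t * real n \<le> pi * t * (real (Suc n))\<^sup>2" using assms by (intro mult_left_mono) auto
  thus "norm (exp (- (pi * (real (Suc n))\<^sup>2 * t))) \<le> exp (- (pi * t * real n))"
    by (simp add: mult_ac)
qed (use assms in auto)

lemma theta_tail_nonneg: "t > 0 \<Longrightarrow> theta_tail t \<ge> 0"
  unfolding theta_tail_def by (intro suminf_nonneg summable_theta_tail) auto

lemma has_sum_theta_tail:
  "t > 0 \<Longrightarrow> ((\<lambda>n. exp (- (pi * (real (Suc n))\<^sup>2 * t))) has_sum theta_tail t) UNIV"
  unfolding theta_tail_def
  by (intro norm_summable_imp_has_sum) (use summable_theta_tail in auto)

lemma has_sum_theta:
  assumes t: "t > 0"
  shows "((\<lambda>m::int. exp (- (pi * (real_of_int m)\<^sup>2 * t))) has_sum (1 + 2 * theta_tail t)) UNIV"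
proof -
  let ?f = "\<lambda>m::int. exp (- (pi * (real_of_int m)\<^sup>2 * t))"
  have "(?f has_sum theta_tail t) (range (\<lambda>n. int (Suc n)))"
    by (subst has_sum_reindex) (use has_sum_theta_tail[OF t] in \<open>auto simp: inj_on_def o_def\<close>)
  moreover have "(?f has_sum theta_tail t) (range (\<lambda>n. - int (Suc n)))"
  proof (subst has_sum_reindex)
    have "(?f \<circ> (\<lambda>n. - int (Suc n))) = (\<lambda>n. exp (- (pi * (real (Suc n))\<^sup>2 * t)))"
      by (simp add: fun_eq_iff power2_eq_square algebra_simps)
    thus "((?f \<circ> (\<lambda>n. - int (Suc n))) has_sum theta_tail t) UNIV" using has_sum_theta_tail[OF t] by simp
  qed (auto simp: inj_on_def)
  moreover have "(?f has_sum 1) {0}" by (rule has_sum_finiteI) auto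
  ultimately have "(?f has_sum (1 + (theta_tail t + theta_tail t)))
      ({0} \<union> (range (\<lambda>n. int (Suc n)) \<union> range (\<lambda>n. - int (Suc n))))"
    by (intro has_sum_Un_disjoint) auto
  moreover have "{0} \<union> (range (\<lambda>n. int (Suc n)) \<union> range (\<lambda>n. - int (Suc n))) = UNIV"
  proof -
    have "m \<in> {0} \<union> (range (\<lambda>n. int (Suc n)) \<union> range (\<lambda>n. - int (Suc n)))" for m :: int
    proof (cases m rule: int_cases3)
      case (pos n)
      thus ?thesis using Suc_pred[of n] by (metis UnI1 UnI2 rangeI)
    next
      case (neg n)
      thus ?thesis using Suc_pred[of n] by (metis UnI2 rangeI)
    qed auto
    thus ?thesis by blast
  qed
  ultimately show ?thesis by simp
qed

lemma theta_tail_functional_equation: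
  assumes t: "t > 0"
  shows "1 + 2 * theta_tail t = (1 + 2 * theta_tail (1 / t)) / sqrt t"
proof -
  have "((\<lambda>d::int. complex_of_real (exp (- (pi * (real_of_int d)\<^sup>2 * t)))) has_sum of_real (1 + 2 * theta_tail t)) UNIV"
    by (intro has_sum_of_real has_sum_theta t)
  also have "(\<lambda>d::int. complex_of_real (exp (- (pi * (real_of_int d)\<^sup>2 * t)))) =
      (\<lambda>d::int. exp (- (of_real (pi * t) * (of_real 0 + of_int d)\<^sup>2)))"
    by (simp add: fun_eq_iff mult_ac flip: exp_of_real)
  finally have 1: "of_real (1 + 2 * theta_tail t) = (\<Sum>\<^sub>\<infinity>d::int. exp (- (of_real (pi * t) * (of_real 0 + of_int d)\<^sup>2)) :: complex)"
    by (simp only: infsumI)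
  have "((\<lambda>m::int. complex_of_real (exp (- (pi * (real_of_int m)\<^sup>2 * (1 / t))) * (1 / sqrt t))) has_sum
      of_real ((1 + 2 * theta_tail (1 / t)) * (1 / sqrt t))) UNIV"
    by (intro has_sum_of_real has_sum_cmult_left has_sum_theta) (use t in auto)
  also have "(\<lambda>m::int. complex_of_real (exp (- (pi * (real_of_int m)\<^sup>2 * (1 / t))) * (1 / sqrt t))) =
     (\<lambda>m::int. of_real (exp (- (pi * (of_int m)\<^sup>2 / t)) / sqrt t) * unit_exp (of_int m * of_real 0))"
    by (simp add: fun_eq_iff unit_exp_def)
  finally have "complex_of_real ((1 + 2 * theta_tail (1 / t)) * (1 / sqrt t)) = of_real (1 + 2 * theta_tail t)"
    using theta_transformation[OF t, of 0] unfolding 1[symmetric] by (rule has_sum_unique)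
  thus ?thesis unfolding of_real_eq_iff by simp
qed

text \<open>For t >= 1 one has (n+1)^2 t >= t + n, so exp(- pi t) splits off and a geometric series
  remains.\<close>

lemma theta_tail_le:
  obtains C where "C > 0" "\<And>t. t \<ge> 1 \<Longrightarrow> theta_tail t \<le> C * exp (- (pi * t))"
proof
  define C where "C = (\<Sum>n. exp (- (pi * real n)))"
  have summ: "summable (\<lambda>n. exp (- (pi * real n)))" by (rule summable_exp_minus) simp
  show "C > 0" unfolding C_def by (rule suminf_pos[OF summ]) simp
  fix t :: real assume t: "t \<ge> 1"
  have "theta_tail t \<le> (\<Sum>n. exp (- (pi * real n)) * exp (- (pi * t)))"
    unfolding theta_tail_def
  proof (rule suminf_le)
    fix n :: nat
    have "real n * t \<ge> real n" using t mult_left_mono[of 1 t "real n"] by simp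
    moreover have "(real (Suc n))\<^sup>2 * t \<ge> real (Suc n) * t"
      using t by (intro mult_right_mono) (auto simp: power2_eq_square)
    ultimately have "t + real n \<le> (real (Suc n))\<^sup>2 * t" by (simp add: algebra_simps)
    hence "pi * (t + real n) \<le> pi * ((real (Suc n))\<^sup>2 * t)" by (intro mult_left_mono) auto
    thus "exp (- (pi * (real (Suc n))\<^sup>2 * t)) \<le> exp (- (pi * real n)) * exp (- (pi * t))"
      by (simp add: mult_exp_exp algebra_simps)
  next
    show "summable (\<lambda>n. exp (- (pi * (real (Suc n))\<^sup>2 * t)))"
      using t by (intro summable_theta_tail) auto
    show "summable (\<lambda>n. exp (- (pi * real n)) * exp (- (pi * t)))"
      by (intro summable_mult2 summ)
  qed
  also have "\<dots> = C * exp (- (pi * t))"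
    unfolding C_def by (rule suminf_mult2[OF summ, symmetric])
  finally show "theta_tail t \<le> C * exp (- (pi * t))" .
qed

section \<open>The Mellin transform of the theta function\<close>

text \<open>For x < 0 \<open>theta_tail (exp x)\<close> grows like exp(-x/2)/2. The kernel continues
  it from x >= 0 by the symmetry of the functional equation instead, so that the growing part
  (exp(-x/2) - 1)/2 is removed and the decay is doubly exponential on both sides.\<close>

definition theta_kernel :: "real \<Rightarrow> real" where
  "theta_kernel x = (if x \<ge> 0 then theta_tail (exp x) else exp (- x / 2) * theta_tail (exp (- x)))"

lemma theta_tail_exp_measurable [measurable]: "(\<lambda>x. theta_tail (exp x)) \<in> borel_measurable borel"
  unfolding theta_tail_def by measurable

lemma theta_kernel_measurable [measurable]: "theta_kernel \<in> borel_measurable borel"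
proof -
  have [measurable]: "(\<lambda>x. theta_tail (exp (- x))) \<in> borel_measurable borel"
    unfolding theta_tail_def by measurable
  show ?thesis unfolding theta_kernel_def[abs_def] by measurable
qed

lemma theta_kernel_uminus: "theta_kernel (- x) = exp (x / 2) * theta_kernel x"
  by (cases x "0::real" rule: linorder_cases) (auto simp: theta_kernel_def mult_exp_exp mult.assoc[symmetric])

lemma sqrt_exp: "sqrt (exp x) = exp (x / 2)"
  by (rule real_sqrt_unique) (simp_all add: power2_eq_square mult_exp_exp)

lemma theta_tail_exp_eq:
  "theta_tail (exp x) = theta_kernel x + (if x < 0 then (exp (- x / 2) - 1) / 2 else 0)"
proof (cases "x < 0")
  case True
  have "1 + 2 * theta_tail (exp x) = (1 + 2 * theta_tail (exp (- x))) / sqrt (exp x)"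
    using theta_tail_functional_equation[of "exp x"] by (simp add: exp_minus inverse_eq_divide)
  also note sqrt_exp
  also have "(1 + 2 * theta_tail (exp (- x))) / exp (x / 2) = (1 + 2 * theta_tail (exp (- x))) * exp (- x / 2)"
  proof -
    have "exp (- x / 2) = inverse (exp (x / 2))" by (simp flip: exp_minus)
    thus ?thesis by (simp only: divide_inverse[of _ "exp (x / 2)"])
  qed
  finally show ?thesis using True by (simp add: theta_kernel_def field_simps)
qed (simp add: theta_kernel_def)

lemma theta_kernel_bound:
  obtains C where "C > 0" "\<And>x. \<bar>theta_kernel x\<bar> \<le> C * exp (1 / 2 * \<bar>x\<bar> - pi * cosh x)"
proof -
  obtain C where C: "C > 0" "\<And>t. t \<ge> 1 \<Longrightarrow> theta_tail t \<le> C * exp (- (pi * t))"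
    using theta_tail_le by blast
  have le: "\<bar>theta_kernel x\<bar> \<le> C * exp (1 / 2 * \<bar>x\<bar> - pi * cosh x)" if x: "x \<ge> 0" for x
  proof -
    have "\<bar>theta_kernel x\<bar> \<le> C * exp (- (pi * exp x))"
      using x C(2)[of "exp x"] theta_tail_nonneg[of "exp x"] by (simp add: theta_kernel_def)
    also have "\<dots> \<le> C * exp (- (pi * cosh x))"
      using C(1) exp_le_cosh[OF x] by (intro mult_left_mono) auto
    also have "\<dots> \<le> C * exp (1 / 2 * \<bar>x\<bar> - pi * cosh x)"
      using C(1) by (intro mult_left_mono) auto
    finally show ?thesis .
  qed
  have "\<bar>theta_kernel x\<bar> \<le> C * exp (1 / 2 * \<bar>x\<bar> - pi * cosh x)" for x
  proof (cases "x \<ge> 0")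
    case False
    have "theta_kernel x = exp (- x / 2) * theta_kernel (- x)"
      using theta_kernel_uminus[of "- x"] by simp
    moreover have "\<bar>theta_kernel (- x)\<bar> \<le> C * exp (- (pi * cosh x))"
    proof -
      have "\<bar>theta_kernel (- x)\<bar> \<le> C * exp (- (pi * exp (- x)))"
        using False C(2)[of "exp (- x)"] theta_tail_nonneg[of "exp (- x)"] by (simp add: theta_kernel_def)
      also have "\<dots> \<le> C * exp (- (pi * cosh (- x)))"
        using C(1) exp_le_cosh[of "- x"] False by (intro mult_left_mono) auto
      finally show ?thesis by simp
    qed
    ultimately have "\<bar>theta_kernel x\<bar> \<le> exp (- x / 2) * (C * exp (- (pi * cosh x)))"
      by (simp add: abs_mult)
    also have "\<dots> = C * exp (1 / 2 * \<bar>x\<bar> - pi * cosh x)"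
      using False by (simp add: mult_exp_exp algebra_simps)
    finally show ?thesis .
  qed (rule le)
  with C(1) show ?thesis using that by blast
qed

lemma integrable_theta_kernel_exp: "integrable lborel (\<lambda>x. \<bar>theta_kernel x\<bar> * exp (a * x + r * \<bar>x\<bar>))"
proof -
  obtain C where C: "C > 0" "\<And>x. \<bar>theta_kernel x\<bar> \<le> C * exp (1 / 2 * \<bar>x\<bar> - pi * cosh x)"
    using theta_kernel_bound by blast
  show ?thesis
  proof (rule Bochner_Integration.integrable_bound)
    show "integrable lborel (\<lambda>x. C * exp ((1 / 2 + \<bar>a\<bar> + r) * \<bar>x\<bar> - pi * cosh x))"
      by (intro integrable_mult_right integrable_exp_cosh) simp
    show "AE x in lborel. norm (\<bar>theta_kernel x\<bar> * exp (a * x + r * \<bar>x\<bar>)) \<le>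
           norm (C * exp ((1 / 2 + \<bar>a\<bar> + r) * \<bar>x\<bar> - pi * cosh x))"
    proof (rule AE_I2)
      fix x :: real
      have "a * x \<le> \<bar>a\<bar> * \<bar>x\<bar>" by (metis abs_ge_self abs_mult)
      hence "norm (\<bar>theta_kernel x\<bar> * exp (a * x + r * \<bar>x\<bar>)) \<le>
          (C * exp (1 / 2 * \<bar>x\<bar> - pi * cosh x)) * exp (\<bar>a\<bar> * \<bar>x\<bar> + r * \<bar>x\<bar>)"
        using C(2)[of x] C(1) unfolding norm_mult by (intro mult_mono) auto
      also have "\<dots> = norm (C * exp ((1 / 2 + \<bar>a\<bar> + r) * \<bar>x\<bar> - pi * cosh x))"
        using C(1) by (simp add: mult.assoc mult_exp_exp algebra_simps)
      finally show "norm (\<bar>theta_kernel x\<bar> * exp (a * x + r * \<bar>x\<bar>)) \<le>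
           norm (C * exp ((1 / 2 + \<bar>a\<bar> + r) * \<bar>x\<bar> - pi * cosh x))" .
    qed
  qed auto
qed

text \<open>The entire part of the integral of theta_tail(t) t^(w-1) over t > 0, with t = exp x.
  Reflection of x turns the symmetry of the kernel into w -> 1/2 - w, which is the functional
  equation of zeta.\<close>

definition theta_mellin :: "complex \<Rightarrow> complex" where
  "theta_mellin w = (\<integral>x. of_real (theta_kernel x) * exp (w * of_real x) \<partial>lborel)"

lemma integrable_theta_mellin:
  fixes w :: complex
  shows "integrable lborel (\<lambda>x. of_real (theta_kernel x) * exp (w * of_real x))"
  by (rule Bochner_Integration.integrable_bound[OF integrable_theta_kernel_exp[of "Re w" 0]])
     (auto simp: norm_mult)

lemma theta_mellin_holomorphic: "theta_mellin holomorphic_on A"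
proof -
  have "theta_mellin field_differentiable (at w)" for w :: complex
    unfolding theta_mellin_def[abs_def] field_differentiable_def
    by (rule exI, rule has_field_derivative_exp_integral[where g = "\<lambda>x. x" and r = 1])
       (use integrable_theta_kernel_exp[of "Re w" 1] in auto)
  thus ?thesis by (simp add: holomorphic_on_def field_differentiable_at_within)
qed

lemma theta_mellin_analytic: "theta_mellin analytic_on A"
  using theta_mellin_holomorphic[of UNIV] by (meson analytic_on_open analytic_on_subset open_UNIV subset_UNIV)

lemma theta_mellin_reflect: "theta_mellin (1 / 2 - w) = theta_mellin w"
proof -
  have "complex_of_real (theta_kernel (- x)) * exp ((1 / 2 - w) * of_real (- x)) = of_real (theta_kernel x) * exp (w * of_real x)" for x
    unfolding theta_kernel_uminus of_real_mult exp_of_real[symmetric]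
    by (simp add: mult_exp_exp mult.assoc mult.left_commute algebra_simps)
  thus ?thesis
    using lborel_integral_real_affine[of "-1" "\<lambda>x. of_real (theta_kernel x) * exp ((1 / 2 - w) * of_real x)" 0]
    by (simp add: theta_mellin_def)
qed

text \<open>\<open>completed_zeta w\<close> is \<open>\<pi>\<^sup>-\<^sup>w \<Gamma>(w) \<zeta>(2w)\<close>.\<close>

definition completed_zeta :: "complex \<Rightarrow> complex" where
  "completed_zeta w = 1 / 2 * (1 / (w - 1 / 2) - 1 / w) + theta_mellin w"

lemma completed_zeta_reflect: "completed_zeta (1 / 2 - w) = completed_zeta w"
proof -
  have "1 / (1 / 2 - w - 1 / 2) = - (1 / w)" by simp
  moreover have "1 / (1 / 2 - w) = - (1 / (w - 1 / 2))"
    by (metis minus_diff_eq minus_divide_right)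
  ultimately show ?thesis
    unfolding completed_zeta_def theta_mellin_reflect by simp
qed

lemma completed_zeta_analytic:
  assumes "0 \<notin> A" "1 / 2 \<notin> A"
  shows "completed_zeta analytic_on A"
proof -
  have "w - 1 / 2 \<noteq> 0" "w \<noteq> 0" if "w \<in> A" for w
    using that assms by (metis eq_iff_diff_eq_0)+
  thus ?thesis
    unfolding completed_zeta_def[abs_def] by (intro analytic_intros theta_mellin_analytic) auto
qed

lemma completed_zeta_meromorphic: "completed_zeta meromorphic_on A"
  unfolding completed_zeta_def[abs_def]
  by (intro meromorphic_intros analytic_on_imp_meromorphic_on theta_mellin_analytic)

lemma
  assumes a: "Re a > 0"
  shows integrable_exp_negative_halfline: "integrable lborel (\<lambda>x. indicator {..<0::real} x *\<^sub>R exp (a * of_real x))"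
    and integral_exp_negative_halfline: "(\<integral>x. indicator {..<0::real} x *\<^sub>R exp (a * of_real x) \<partial>lborel) = 1 / a"
proof -
  obtain C where C: "C > 0" "\<And>x. x \<le> 0 \<Longrightarrow> exp (Re a * x) \<le> C * inverse (1 + x\<^sup>2)"
    using exp_nonpos_majorant[OF a] by blast
  show int: "integrable lborel (\<lambda>x. indicator {..<0::real} x *\<^sub>R exp (a * of_real x))"
  proof (rule integrable_dominated_inverse_square[where C = C])
    fix x :: real
    have "0 \<le> C * inverse (1 + x\<^sup>2)" using C(1) by simp
    thus "norm (indicator {..<0} x *\<^sub>R exp (a * of_real x)) \<le> C * inverse (1 + x\<^sup>2)"
      using C(2)[of x] by (simp add: indicator_def)
  qed auto
  have nz: "a \<noteq> 0" using a by auto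
  have "(LBINT x=-\<infinity>..0. exp (a * of_real x)) = exp (a * of_real 0) / a - 0"
  proof (rule interval_integral_FTC_integrable)
    show "((\<lambda>x. exp (a * of_real x) / a) has_vector_derivative exp (a * of_real x)) (at x)" for x :: real
      by (rule has_vector_derivative_real_field) (use nz in \<open>auto intro!: derivative_eq_intros\<close>)
    show "set_integrable lborel (einterval (- \<infinity>) 0) (\<lambda>x. exp (a * of_real x))"
      using int by (simp add: set_integrable_def einterval_def lessThan_def zero_ereal_def)
    have "((\<lambda>x. exp (a * of_real x) / a) \<longlongrightarrow> 0) at_bot"
    proof (rule Lim_null_comparison)
      show "\<forall>\<^sub>F x in at_bot. norm (exp (a * of_real x) / a) \<le> exp (Re a * x) / norm a"
        by (simp add: norm_divide)
      show "((\<lambda>x. exp (Re a * x) / norm a) \<longlongrightarrow> 0) at_bot"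
        using a nz by real_asymp
    qed
    thus "(((\<lambda>x. exp (a * of_real x) / a) \<circ> real_of_ereal) \<longlongrightarrow> 0) (at_right (- \<infinity>))"
      unfolding ereal_tendsto_simps .
    show "(((\<lambda>x. exp (a * of_real x) / a) \<circ> real_of_ereal) \<longlongrightarrow> exp (a * of_real 0) / a) (at_left 0)"
      unfolding zero_ereal_def ereal_tendsto_simps
      by (intro tendsto_intros) (use nz in auto)
  qed auto
  thus "(\<integral>x. indicator {..<0::real} x *\<^sub>R exp (a * of_real x) \<partial>lborel) = 1 / a"
    by (simp add: interval_lebesgue_integral_def einterval_def set_lebesgue_integral_def lessThan_def zero_ereal_def)
qed

text \<open>Riemann's argument: each summand is a Gamma integral, and summing under the integral
  sign yields the Mellin integral of \<open>theta_tail (exp x)\<close>.\<close>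

lemma completed_zeta_has_sum:
  assumes w: "Re w > 1 / 2"
  shows "((\<lambda>n. Gamma w * exp (- (w * of_real (ln (pi * (real (Suc n))\<^sup>2))))) has_sum completed_zeta w) UNIV"
proof -
  define f where "f n x = exp (w * of_real x - of_real (pi * (real (Suc n))\<^sup>2 * exp x))" for n x
  have w0: "Re w > 0" using w by simp
  have f_int: "integrable lborel (f n)" for n
    unfolding f_def using w0 by (intro integrable_Gamma_exp) auto
  have f_val: "(\<integral>x. f n x \<partial>lborel) = Gamma w * exp (- (w * of_real (ln (pi * (real (Suc n))\<^sup>2))))" for n
    unfolding f_def using w0 by (intro Gamma_exp_integral_scaled) auto
  have f_norm: "(\<integral>x. norm (f n x) \<partial>lborel) = Gamma (Re w) * pi powr (- Re w) * real (Suc n) powr (- 2 * Re w)" for n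
  proof -
    have "(\<integral>x. norm (f n x) \<partial>lborel) = Gamma (Re w) * (pi * (real (Suc n))\<^sup>2) powr (- Re w)"
      unfolding f_def using w0 by (intro integral_norm_Gamma_exp) auto
    also have "(pi * (real (Suc n))\<^sup>2) powr (- Re w) = pi powr (- Re w) * real (Suc n) powr (- 2 * Re w)"
      by (simp add: powr_def ln_mult ln_realpow mult_exp_exp algebra_simps)
    finally show ?thesis by simp
  qed
  have f_summ: "(\<lambda>n. \<integral>x. norm (f n x) \<partial>lborel) summable_on UNIV"
    unfolding f_norm
  proof (intro summable_on_cmult_right summable_nonneg_imp_summable_on)
    have "summable (\<lambda>n. real n powr (- 2 * Re w))"
      using w by (subst summable_real_powr_iff) auto
    thus "summable (\<lambda>n. real (Suc n) powr (- 2 * Re w))"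
      by (subst summable_Suc_iff)
  qed auto
  have lim: "((\<lambda>n. f n x) has_sum (exp (w * of_real x) * of_real (theta_tail (exp x)))) UNIV" for x
  proof -
    have "((\<lambda>n. exp (w * of_real x) * of_real (exp (- (pi * (real (Suc n))\<^sup>2 * exp x)))) has_sum
             (exp (w * of_real x) * of_real (theta_tail (exp x)))) UNIV"
      by (intro has_sum_cmult_right has_sum_of_real has_sum_theta_tail) simp
    also have "(\<lambda>n. exp (w * of_real x) * of_real (exp (- (pi * (real (Suc n))\<^sup>2 * exp x)))) = (\<lambda>n. f n x)"
      by (simp add: fun_eq_iff f_def exp_diff exp_minus field_simps flip: exp_of_real)
    finally show ?thesis .
  qed
  have "((\<lambda>n. \<integral>x. f n x \<partial>lborel) has_sum (\<integral>x. exp (w * of_real x) * of_real (theta_tail (exp x)) \<partial>lborel)) UNIV"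
    using f_int f_summ lim by (intro has_sum_integral_swap) auto
  also have "(\<integral>x. exp (w * of_real x) * of_real (theta_tail (exp x)) \<partial>lborel) = completed_zeta w"
  proof -
    have a: "Re (w - 1 / 2) > 0" using w by simp
    \<comment> \<open>The part of \<open>theta_tail\<close> missing from \<open>theta_kernel\<close>
      lives on x < 0. Its exponentials integrate to 1/(w - 1/2) and 1/w, the first of them because
      Re w > 1/2.\<close>
    have "exp (w * of_real x) * of_real (theta_tail (exp x)) =
       of_real (theta_kernel x) * exp (w * of_real x) + 1 / 2 * (indicator {..<0} x *\<^sub>R exp ((w - 1 / 2) * of_real x)
         - indicator {..<0} x *\<^sub>R exp (w * of_real x))" for x
    proof -
      have "exp ((w - 1 / 2) * of_real x) = exp (w * of_real x) * of_real (exp (- x / 2))"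
        by (simp add: mult_exp_exp algebra_simps flip: exp_of_real)
      thus ?thesis unfolding theta_tail_exp_eq by (auto simp: indicator_def algebra_simps diff_divide_distrib)
    qed
    hence "(\<integral>x. exp (w * of_real x) * of_real (theta_tail (exp x)) \<partial>lborel) =
      (\<integral>x. of_real (theta_kernel x) * exp (w * of_real x) + 1 / 2 * (indicator {..<0} x *\<^sub>R exp ((w - 1 / 2) * of_real x)
         - indicator {..<0} x *\<^sub>R exp (w * of_real x)) \<partial>lborel)" by simp
    also have "\<dots> = theta_mellin w + 1 / 2 * (1 / (w - 1 / 2) - 1 / w)"
      unfolding theta_mellin_def integral_exp_negative_halfline[OF a, symmetric] integral_exp_negative_halfline[OF w0, symmetric]
      using integrable_theta_mellin[of w] integrable_exp_negative_halfline[OF a] integrable_exp_negative_halfline[OF w0]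
      by (subst Bochner_Integration.integral_add)
         (auto simp del: times_divide_eq_left intro!: Bochner_Integration.integrable_diff integrable_mult_right)
    finally show ?thesis by (simp add: completed_zeta_def)
  qed
  finally show ?thesis unfolding f_val .
qed

section \<open>Continuation of the Riemann zeta function\<close>

text \<open>\<open>rGamma\<close> is entire, so the possible singularities are only those of
  \<open>completed_zeta (s / 2)\<close>, at 0 and 1.\<close>

definition zeta_cont :: "complex \<Rightarrow> complex" where
  "zeta_cont s = exp (s / 2 * of_real (ln pi)) * rGamma (s / 2) * completed_zeta (s / 2)"

lemma zeta_cont_has_sum:
  assumes s: "Re s > 1"
  shows "((\<lambda>n. of_nat (Suc n) powr (- s)) has_sum zeta_cont s) UNIV"
proof -
  have "Gamma (s / 2) \<noteq> 0" using s by (subst Gamma_eq_zero_iff) (auto elim!: nonpos_Ints_cases)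
  hence G: "rGamma (s / 2) * Gamma (s / 2) = 1" by (simp add: rGamma_inverse_Gamma)
  have "((\<lambda>n. exp (s / 2 * of_real (ln pi)) * rGamma (s / 2) *
       (Gamma (s / 2) * exp (- (s / 2 * of_real (ln (pi * (real (Suc n))\<^sup>2)))))) has_sum zeta_cont s) UNIV"
    unfolding zeta_cont_def by (intro has_sum_cmult_right completed_zeta_has_sum) (use s in auto)
  also have "(\<lambda>n. exp (s / 2 * of_real (ln pi)) * rGamma (s / 2) *
       (Gamma (s / 2) * exp (- (s / 2 * of_real (ln (pi * (real (Suc n))\<^sup>2)))))) = (\<lambda>n. of_nat (Suc n) powr (- s))"
  proof
    fix n :: nat
    have "exp (s / 2 * of_real (ln pi)) * rGamma (s / 2) *
       (Gamma (s / 2) * exp (- (s / 2 * of_real (ln (pi * (real (Suc n))\<^sup>2))))) =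
       exp (s / 2 * of_real (ln pi)) * exp (- (s / 2 * of_real (ln (pi * (real (Suc n))\<^sup>2))))"
      using G by (simp add: mult_ac)
    also have "\<dots> = exp (- s * of_real (ln (real (Suc n))))"
      by (simp add: mult_exp_exp ln_mult ln_realpow algebra_simps add_divide_distrib)
    also have "\<dots> = of_nat (Suc n) powr (- s)"
      using Ln_of_real[of "real (Suc n)"] by (simp add: powr_def del: of_nat_Suc)
    finally show "exp (s / 2 * of_real (ln pi)) * rGamma (s / 2) *
       (Gamma (s / 2) * exp (- (s / 2 * of_real (ln (pi * (real (Suc n))\<^sup>2))))) = of_nat (Suc n) powr (- s)" .
  qed
  finally show ?thesis .
qed

lemma zeta_cont_meromorphic: "zeta_cont meromorphic_on UNIV"
proof -
  have "(\<lambda>s. completed_zeta (s / 2)) meromorphic_on UNIV"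
    unfolding completed_zeta_def
    by (intro meromorphic_intros analytic_on_imp_meromorphic_on
          analytic_on_compose[OF _ theta_mellin_analytic, unfolded o_def]) (auto intro!: analytic_intros)
  thus ?thesis
    unfolding zeta_cont_def[abs_def]
    by (intro meromorphic_intros) (auto intro!: analytic_on_imp_meromorphic_on analytic_intros)
qed

lemma zeta_cont_analytic: "s \<noteq> 0 \<Longrightarrow> s \<noteq> 1 \<Longrightarrow> zeta_cont analytic_on {s}"
proof -
  assume s: "s \<noteq> 0" "s \<noteq> 1"
  have "(\<lambda>s. completed_zeta (s / 2)) analytic_on {s}"
    by (rule analytic_on_compose[OF _ completed_zeta_analytic, unfolded o_def])
       (use s in \<open>auto intro!: analytic_intros\<close>)
  thus ?thesis
    unfolding zeta_cont_def[abs_def] by (auto intro!: analytic_intros)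
qed

text \<open>At 0 and 1 the formula for \<open>zeta_cont\<close> divides by zero and gives values of
  no meaning; \<open>remove_sings\<close> puts the limit at 0 and the value 0 at the pole, as a
  nicely meromorphic function must have them.\<close>

lemma riemann_zeta_eq: "riemann_zeta = remove_sings zeta_cont"
  unfolding riemann_zeta_def
proof (rule meromorphic_continuation_eqI)
  show "remove_sings zeta_cont nicely_meromorphic_on UNIV"
    by (intro remove_sings_nicely_meromorphic zeta_cont_meromorphic)
  show "open {s. Re s > 1}" by (rule open_halfspace_Re_gt)
  show "{s. Re s > 1} \<noteq> {}" by (auto intro!: exI[of _ 2])
  fix s :: complex assume "s \<in> {s. Re s > 1}"
  hence s: "Re s > 1" "s \<noteq> 0" "s \<noteq> 1" by auto
  have "((\<lambda>n. of_nat n powr (- s)) has_sum zeta_cont s) (range Suc)"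
    using zeta_cont_has_sum[OF s(1)] by (subst has_sum_reindex) (auto simp: o_def)
  also have "range Suc = {1..}" by (auto simp: image_iff Suc_le_eq gr0_conv_Suc)
  finally show "remove_sings zeta_cont s = (\<Sum>\<^sub>\<infinity>n\<in>{1..}. of_nat n powr (- s))"
    using zeta_cont_analytic[OF s(2,3)] by (simp add: infsumI)
qed

lemma deriv_riemann_zeta_eq: "s \<noteq> 0 \<Longrightarrow> s \<noteq> 1 \<Longrightarrow> deriv riemann_zeta s = deriv zeta_cont s"
  using zeta_cont_analytic[of s] by (simp add: riemann_zeta_eq)

section \<open>Special values: zeta at 2 and -1, and the Laurent constant at 1\<close>

text \<open>\<pi>^(-1) \<Gamma>(1) \<zeta>(2), with \<zeta>(2) = \<pi>^2/6. This is where the 24 in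
  the constant coefficient originates.\<close>

lemma completed_zeta_1: "completed_zeta 1 = of_real (pi / 6)"
proof -
  have "(\<lambda>n. Gamma 1 * exp (- (1 * of_real (ln (pi * (real (Suc n))\<^sup>2))))) sums completed_zeta 1"
    by (intro has_sum_imp_sums completed_zeta_has_sum) auto
  moreover have "(\<lambda>n. complex_of_real (1 / pi * (1 / (real n + 1)\<^sup>2))) sums of_real (1 / pi * (pi\<^sup>2 / 6))"
    using inverse_squares_sums by (intro sums_of_real sums_mult) (simp add: add_ac)
  moreover have "Gamma 1 * exp (- (1 * of_real (ln (pi * (real (Suc n))\<^sup>2)))) = complex_of_real (1 / pi * (1 / (real n + 1)\<^sup>2))" for n
  proof -
    have "complex_of_real (exp (- ln (pi * (real (Suc n))\<^sup>2))) = of_real (1 / pi * (1 / (real n + 1)\<^sup>2))"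
      by (subst of_real_eq_iff, subst exp_minus, subst exp_ln) (auto simp: field_simps)
    thus ?thesis by (simp flip: exp_of_real)
  qed
  ultimately have "completed_zeta 1 = of_real (1 / pi * (pi\<^sup>2 / 6))"
    using sums_unique2 by simp
  thus ?thesis by (simp add: power2_eq_square)
qed

text \<open>The quotient is the integral of x^(-s) over [a, a+1], hence z^(-s) for some z inside; a
  second mean value step compares it with a^(-s). The constant 2 bounds s, and the estimate is
  uniform in s, as the limit s -> 1 requires.\<close>

lemma zeta_term_minus_integral_bound:
  fixes a s :: real
  assumes a: "a > 0" and s: "1 < s" "s \<le> 2" "1 \<le> a"
  shows "\<bar>a powr (- s) - (a powr (1 - s) - (a + 1) powr (1 - s)) / (s - 1)\<bar> \<le> 2 * a powr (- 2)"
proof -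
  have "\<exists>z. z > a \<and> z < a + 1 \<and> (a + 1) powr (1 - s) / (1 - s) - a powr (1 - s) / (1 - s) = (a + 1 - a) * z powr (- s)"
  proof (rule MVT2)
    fix x assume "a \<le> x" "x \<le> a + 1"
    thus "((\<lambda>x. x powr (1 - s) / (1 - s)) has_real_derivative x powr (- s)) (at x)"
      using a s DERIV_cdivide[OF has_real_derivative_powr[of x "1 - s"], of "1 - s"] by simp
  qed auto
  then obtain z where z: "a < z" "z < a + 1" "(a + 1) powr (1 - s) / (1 - s) - a powr (1 - s) / (1 - s) = z powr (- s)"
    by auto
  have eq: "(a powr (1 - s) - (a + 1) powr (1 - s)) / (s - 1) = z powr (- s)"
    unfolding z(3)[symmetric]
    using minus_divide_divide[of "(a + 1) powr (1 - s) - a powr (1 - s)" "1 - s"] by (simp add: diff_divide_distrib)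
  have "\<exists>y. y > a \<and> y < z \<and> z powr (- s) - a powr (- s) = (z - a) * (- s * y powr (- s - 1))"
  proof (rule MVT2)
    fix x assume "a \<le> x" "x \<le> z"
    thus "((\<lambda>x. x powr (- s)) has_real_derivative - s * x powr (- s - 1)) (at x)"
      using a by (auto intro!: derivative_eq_intros)
  qed (use z in auto)
  then obtain y where y: "a < y" "y < z" "z powr (- s) - a powr (- s) = (z - a) * (- s * y powr (- s - 1))"
    by auto
  have "\<bar>a powr (- s) - z powr (- s)\<bar> = (z - a) * (s * y powr (- s - 1))"
    using y z s by (simp add: abs_mult abs_minus_commute[of "a powr (- s)"])
  also have "\<dots> \<le> 1 * (2 * a powr (- 2))"
  proof (intro mult_mono)
    have "y powr (- s - 1) \<le> y powr (- 2)"
      using y a s by (intro powr_mono) auto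
    also have "\<dots> \<le> a powr (- 2)"
      using y a by (intro powr_mono2') auto
    finally show "y powr (- s - 1) \<le> a powr (- 2)" .
  qed (use z y s in auto)
  finally show ?thesis unfolding eq by simp
qed

text \<open>Writing 1/(s-1) as the integral of x^(-s) over x >= 1 turns \<zeta>(s) - 1/(s-1) into a
  series of differences between terms and integrals over unit intervals. Tannery's theorem allows s
  -> 1 termwise, and the limit is the series 1/n - ln((n+1)/n) for Euler's constant. A sequence s =
  1 + 1/(k+1) suffices, since it is only compared with another limit along the same
  sequence.\<close>

lemma zeta_laurent_constant:
  "(\<lambda>k. zeta_cont (of_real (1 + 1 / real (Suc k))) - of_real (real (Suc k))) \<longlonglongrightarrow> euler_mascheroni"
proof -
  define h where "h k = 1 / real (Suc k)" for k
  have h: "h k > 0" "h k \<le> 1" for k by (simp_all add: h_def)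
  have h0: "h \<longlonglongrightarrow> 0" unfolding h_def[abs_def] by real_asymp
  \<comment> \<open>Here \<open>h k\<close> is s - 1, and \<phi> n k is the term of index n + 1
    minus its integral.\<close>
  define \<phi> where "\<phi> n k = real (Suc n) powr (- (1 + h k)) -
     (real (Suc n) powr (- h k) - real (Suc (Suc n)) powr (- h k)) / h k" for n k
  have lim: "(\<lambda>k. \<phi> n k) \<longlonglongrightarrow> inverse (of_nat (n+1)) + ln (of_nat (n+1)) - ln (of_nat (n+2))" for n
  proof -
    define f where "f x = real (Suc n) powr (- x) - real (Suc (Suc n)) powr (- x)" for x :: real
    have "(f has_real_derivative ln (real (Suc (Suc n))) - ln (real (Suc n))) (at 0)"
      unfolding f_def by (auto intro!: derivative_eq_intros)
    hence "((\<lambda>x. (f (0 + x) - f 0) / x) \<longlongrightarrow> ln (real (Suc (Suc n))) - ln (real (Suc n))) (at 0)"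
      unfolding DERIV_def .
    moreover have "filterlim h (at 0) sequentially"
      unfolding filterlim_at using h0 h(1) by (auto simp: less_imp_neq[symmetric])
    ultimately have 1: "(\<lambda>k. (f (0 + h k) - f 0) / h k) \<longlonglongrightarrow> ln (real (Suc (Suc n))) - ln (real (Suc n))"
      by (rule filterlim_compose)
    have 2: "(\<lambda>k. real (Suc n) powr (- (1 + h k))) \<longlonglongrightarrow> real (Suc n) powr (- (1 + 0))"
      by (intro tendsto_intros h0) auto
    have "(\<lambda>k. real (Suc n) powr (- (1 + h k)) - (f (0 + h k) - f 0) / h k) \<longlonglongrightarrow>
       real (Suc n) powr (- (1 + 0)) - (ln (real (Suc (Suc n))) - ln (real (Suc n)))"
      by (intro tendsto_diff 1 2)
    thus ?thesis by (simp add: \<phi>_def[abs_def] f_def powr_minus algebra_simps)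
  qed
  have bound: "norm (\<phi> n k) \<le> 2 * real (Suc n) powr (- 2)" for n k
    using zeta_term_minus_integral_bound[of "real (Suc n)" "1 + h k"] h[of k] by (simp add: \<phi>_def add_ac)
  have summ: "summable (\<lambda>n. 2 * real (Suc n) powr (- 2))"
    by (intro summable_mult) (subst summable_Suc_iff, simp add: summable_real_powr_iff)
  have "(\<lambda>k. \<Sum>n. \<phi> n k) \<longlonglongrightarrow> (\<Sum>n. inverse (of_nat (n+1)) + ln (of_nat (n+1)) - ln (of_nat (n+2)))"
    using tannerys_theorem[OF lim _ summ] bound by (simp add: always_eventually)
  also have "(\<Sum>n. inverse (of_nat (n+1)) + ln (of_nat (n+1)) - ln (of_nat (n+2))) = (euler_mascheroni :: real)"
    by (rule sums_unique[OF euler_mascheroni_sum_real, symmetric])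
  finally have main: "(\<lambda>k. complex_of_real (\<Sum>n. \<phi> n k)) \<longlonglongrightarrow> of_real euler_mascheroni"
    by (rule tendsto_of_real)
  have "complex_of_real (\<Sum>n. \<phi> n k) = zeta_cont (of_real (1 + 1 / real (Suc k))) - of_real (real (Suc k))" for k
  proof -
    have "(\<lambda>n. real (Suc n) powr (- h k)) \<longlonglongrightarrow> 0"
      using h(1)[of k] by real_asymp
    hence "(\<lambda>n. real (Suc n) powr (- h k) - real (Suc (Suc n)) powr (- h k)) sums (real (Suc 0) powr (- h k) - 0)"
      by (rule telescope_sums')
    hence 1: "(\<lambda>n. (real (Suc n) powr (- h k) - real (Suc (Suc n)) powr (- h k)) / h k) sums (1 / h k)"
      using sums_divide[of _ 1 "h k"] by simp
    have "summable (\<lambda>n. \<phi> n k)"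
      by (rule summable_comparison_test'[OF summ, of 0]) (use bound in auto)
    hence "(\<lambda>n. \<phi> n k + (real (Suc n) powr (- h k) - real (Suc (Suc n)) powr (- h k)) / h k) sums ((\<Sum>n. \<phi> n k) + 1 / h k)"
      by (intro sums_add 1 summable_sums)
    hence "(\<lambda>n. complex_of_real (real (Suc n) powr (- (1 + h k)))) sums of_real ((\<Sum>n. \<phi> n k) + 1 / h k)"
      unfolding \<phi>_def by (subst sums_of_real_iff) simp
    moreover have "complex_of_real (real (Suc n) powr (- (1 + h k))) = of_nat (Suc n) powr (- of_real (1 + h k))" for n
      by (subst powr_of_real[symmetric]) (simp_all del: of_nat_Suc)
    moreover have "(\<lambda>n. of_nat (Suc n) powr (- complex_of_real (1 + h k))) sums zeta_cont (of_real (1 + h k))"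
      by (intro has_sum_imp_sums zeta_cont_has_sum) (use h(1)[of k] in auto)
    ultimately have "zeta_cont (of_real (1 + h k)) = of_real ((\<Sum>n. \<phi> n k) + 1 / h k)"
      using sums_unique2 by simp
    thus ?thesis by (simp add: h_def)
  qed
  with main show ?thesis by simp
qed

text \<open>Two evaluations of the constant term of zeta at 1 are compared. One is \<gamma>; the
  other, from \<open>zeta_cont s\<close> = A(s) (1/(s-1) - 1/s + theta_mellin(s/2)) with A(1) = 1,
  is A'(1) - 1 + theta_mellin(1/2), where A'(1) comes from the digamma value at 1/2. Reflection
  moves 1/2 to 0.\<close>

lemma theta_mellin_0: "theta_mellin 0 = of_real (1 + euler_mascheroni / 2 - ln (4 * pi) / 2)"
proof -
  define A where "A s = exp (s / 2 * of_real (ln pi)) * rGamma (s / 2)" for s :: complex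
  define h where "h k = 1 / real (Suc k)" for k
  have h: "h k > 0" for k by (simp add: h_def)
  hence h_nz: "complex_of_real (h k) \<noteq> 0" for k by (metis less_irrefl of_real_eq_0_iff)
  have h0: "(\<lambda>k. complex_of_real (h k)) \<longlonglongrightarrow> 0"
  proof -
    have "h \<longlonglongrightarrow> 0" unfolding h_def[abs_def] by real_asymp
    from tendsto_of_real[OF this] show ?thesis by simp
  qed
  have h_at: "filterlim (\<lambda>k. complex_of_real (h k)) (at 0) sequentially"
    unfolding filterlim_at using h0 h_nz by auto
  have exp_pi: "exp (of_real (ln pi) / 2) = complex_of_real (sqrt pi)"
    by (simp add: powr_half_sqrt[symmetric] powr_def flip: exp_of_real)
  have A1: "A 1 = 1"
    by (simp add: A_def exp_pi rGamma_inverse_Gamma Gamma_one_half_complex)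
  have half: "(1 / 2 :: complex) \<notin> \<int>\<^sub>\<le>\<^sub>0"
    by (auto elim!: nonpos_Ints_cases simp: complex_eq_iff)
  have "(A has_field_derivative of_real (ln pi) / 2 * A 1 - A 1 * Digamma (1 / 2) / 2) (at 1)"
    unfolding A_def[abs_def]
    by (rule derivative_eq_intros refl half | simp)+ (simp add: algebra_simps)
  also have "of_real (ln pi) / 2 * A 1 - A 1 * Digamma (1 / 2) / 2 = of_real ((euler_mascheroni + ln (4 * pi)) / 2)"
  proof -
    have "ln (4 * pi) = ln pi + 2 * ln 2"
      using ln_realpow[of 2 2] by (simp add: ln_mult)
    thus ?thesis by (simp add: A1 Digamma_one_half field_simps)
  qed
  finally have A_der: "(A has_field_derivative of_real ((euler_mascheroni + ln (4 * pi)) / 2)) (at 1)" .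
  have A_lim: "(\<lambda>k. (A (1 + of_real (h k)) - A 1) / of_real (h k)) \<longlonglongrightarrow> of_real ((euler_mascheroni + ln (4 * pi)) / 2)"
    using filterlim_compose[OF A_der[unfolded DERIV_def] h_at] .
  have one: "(\<lambda>k. 1 + complex_of_real (h k)) \<longlonglongrightarrow> 1 + 0"
    by (intro tendsto_intros h0)
  have A_cont: "(\<lambda>k. A (1 + of_real (h k))) \<longlonglongrightarrow> A 1"
    using isCont_tendsto_compose[OF DERIV_isCont[OF A_der]] one by simp
  have "isCont theta_mellin (1 / 2)"
    by (meson UNIV_I continuous_on_eq_continuous_at holomorphic_on_imp_continuous_on open_UNIV theta_mellin_holomorphic)
  hence T_cont: "(\<lambda>k. theta_mellin ((1 + of_real (h k)) / 2)) \<longlonglongrightarrow> theta_mellin (1 / 2)"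
    by (rule isCont_tendsto_compose) (use tendsto_divide[OF one tendsto_const[of 2]] in simp)
  \<comment> \<open>The difference of \<open>zeta_cont\<close> and 1/(s-1) at s = 1 + h k, grouped
    so that every summand has a limit and no pole is left.\<close>
  have "(\<lambda>k. (A (1 + of_real (h k)) - A 1) / of_real (h k) - A (1 + of_real (h k)) / (1 + of_real (h k))
             + A (1 + of_real (h k)) * theta_mellin ((1 + of_real (h k)) / 2)) \<longlonglongrightarrow>
        of_real ((euler_mascheroni + ln (4 * pi)) / 2) - A 1 / (1 + 0) + A 1 * theta_mellin (1 / 2)"
    by (intro tendsto_intros A_lim A_cont one T_cont) auto
  moreover have "(A (1 + of_real (h k)) - A 1) / of_real (h k) - A (1 + of_real (h k)) / (1 + of_real (h k))
             + A (1 + of_real (h k)) * theta_mellin ((1 + of_real (h k)) / 2) =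
        zeta_cont (of_real (1 + 1 / real (Suc k))) - of_real (real (Suc k))" for k
  proof -
    define s where "s = 1 + complex_of_real (h k)"
    have nz: "s \<noteq> 0" "s - 1 \<noteq> 0"
      using h[of k] by (auto simp: s_def complex_eq_iff)
    have "zeta_cont s = A s * (1 / 2 * (1 / (s / 2 - 1 / 2) - 1 / (s / 2)) + theta_mellin (s / 2))"
      by (simp add: zeta_cont_def A_def completed_zeta_def)
    also have "1 / 2 * (1 / (s / 2 - 1 / 2) - 1 / (s / 2)) = 1 / (s - 1) - 1 / s"
      using nz by (simp add: field_simps)
    finally have "zeta_cont s - 1 / (s - 1) = (A s - A 1) / (s - 1) - A s / s + A s * theta_mellin (s / 2)"
      by (simp add: A1 algebra_simps diff_divide_distrib)
    moreover have "1 / (s - 1) = of_real (real (Suc k))" by (simp add: s_def h_def del: of_nat_Suc)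
    moreover have "s = of_real (1 + 1 / real (Suc k))" by (simp add: s_def h_def)
    ultimately show ?thesis by (simp add: s_def)
  qed
  ultimately have "of_real ((euler_mascheroni + ln (4 * pi)) / 2) - 1 + theta_mellin (1 / 2) = of_real euler_mascheroni"
    using LIMSEQ_unique[OF _ zeta_laurent_constant] by (simp add: A1)
  moreover have "T = e - a + 1" if "a - 1 + T = e" for a T e :: complex
    using that by (auto simp: algebra_simps)
  ultimately have "theta_mellin (1 / 2) = of_real euler_mascheroni - of_real ((euler_mascheroni + ln (4 * pi)) / 2) + 1"
    by blast
  also have "\<dots> = of_real (euler_mascheroni - (euler_mascheroni + ln (4 * pi)) / 2 + 1)"
    by simp
  also have "euler_mascheroni - (euler_mascheroni + ln (4 * pi)) / 2 + 1 = 1 + euler_mascheroni / 2 - ln (4 * pi) / 2"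
    by (simp add: field_simps)
  finally have "theta_mellin (1 / 2) = of_real (1 + euler_mascheroni / 2 - ln (4 * pi) / 2)" .
  thus ?thesis using theta_mellin_reflect[of 0] by simp
qed

text \<open>The unknown derivative D at 1 would naturally involve \<zeta>'(2). Reflection moves it
  to -1/2, where the product rule for \<open>zeta_cont\<close> at s = -1 is a linear equation for D
  with \<zeta>'(-1) on the other side. The remaining constants come from \<Gamma>(-1/2) = -2 sqrt
  \<pi> and \<psi>(-1/2) = 2 - \<gamma> - 2 ln 2.\<close>

lemma has_field_derivative_completed_zeta_1:
  "(completed_zeta has_field_derivative
     4 * of_real pi * deriv riemann_zeta (- 1) + of_real (pi / 6 * (ln (4 * pi) - 2 + euler_mascheroni))) (at 1)"
proof -
  define D where "D = deriv completed_zeta 1"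
  have "completed_zeta analytic_on {1}" by (rule completed_zeta_analytic) auto
  hence D: "(completed_zeta has_field_derivative D) (at 1)"
    unfolding D_def by (simp add: DERIV_deriv_iff_field_differentiable analytic_on_imp_differentiable_at)
  have "((\<lambda>w. completed_zeta (1 / 2 - w)) has_field_derivative D * (- 1)) (at (- 1 / 2))"
  proof (rule DERIV_chain2[of completed_zeta D "\<lambda>w. 1 / 2 - w"])
    show "(completed_zeta has_field_derivative D) (at (1 / 2 - - 1 / 2))" using D by simp
  qed (auto intro!: derivative_eq_intros)
  hence D': "(completed_zeta has_field_derivative - D) (at (- 1 / 2))"
    by (simp add: completed_zeta_reflect)
  have Z: "completed_zeta (- 1 / 2) = of_real (pi / 6)"
    using completed_zeta_reflect[of 1] completed_zeta_1 by simp
  have exp_pi: "exp (- of_real (ln pi) / 2) = complex_of_real (1 / sqrt pi)"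
  proof -
    have "exp (- ln pi / 2) = 1 / sqrt pi"
      using powr_half_sqrt[of pi] by (simp add: powr_def exp_minus inverse_eq_divide)
    hence "complex_of_real (exp (- ln pi / 2)) = of_real (1 / sqrt pi)" by simp
    thus ?thesis by (simp flip: exp_of_real)
  qed
  have nint: "(- 1 / 2 :: complex) \<notin> \<int>\<^sub>\<le>\<^sub>0"
  proof
    assume "(- 1 / 2 :: complex) \<in> \<int>\<^sub>\<le>\<^sub>0"
    then obtain n :: int where "(- 1 / 2 :: complex) = of_int n" by (auto elim!: nonpos_Ints_cases)
    hence "complex_of_int (- 1) = of_int (2 * n)" by (simp add: field_simps)
    hence "- 1 = 2 * n" by (simp only: of_int_eq_iff)
    thus False by presburger
  qed
  have r: "rGamma (- 1 / 2) = complex_of_real (- 1 / (2 * sqrt pi))"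
  proof -
    have "rGamma (1 / 2 :: complex) = of_real (1 / sqrt pi)"
      by (simp add: rGamma_inverse_Gamma Gamma_one_half_complex inverse_eq_divide)
    moreover have "- 1 / 2 * rGamma (1 / 2 :: complex) = rGamma (- 1 / 2)"
      using rGamma_plus1[of "- 1 / 2 :: complex"] by simp
    ultimately have "rGamma (- 1 / 2) = - 1 / 2 * complex_of_real (1 / sqrt pi)"
      by simp
    also have "\<dots> = of_real (- 1 / (2 * sqrt pi))" by simp
    finally show ?thesis .
  qed
  have psi: "Digamma (- 1 / 2) = complex_of_real (2 - euler_mascheroni - 2 * ln 2)"
    using Digamma_plus1[of "- 1 / 2 :: complex"] by (simp add: Digamma_one_half algebra_simps)
  have half: "((\<lambda>s::complex. s / 2) has_field_derivative 1 / 2) (at (- 1))"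
    by (auto intro!: derivative_eq_intros)
  have e: "((\<lambda>s. exp (s / 2 * of_real (ln pi))) has_field_derivative
      exp (- of_real (ln pi) / 2) * (of_real (ln pi) / 2)) (at (- 1))"
    by (auto intro!: derivative_eq_intros)
  have g: "((\<lambda>s. rGamma (s / 2)) has_field_derivative (- rGamma (- 1 / 2) * Digamma (- 1 / 2)) * (1 / 2)) (at (- 1 :: complex))"
    by (rule DERIV_chain2[OF has_field_derivative_rGamma_no_nonpos_int[OF nint] half])
  have z: "((\<lambda>s. completed_zeta (s / 2)) has_field_derivative (- D) * (1 / 2)) (at (- 1))"
    by (rule DERIV_chain2[OF D' half])
  have "(zeta_cont has_field_derivative
      (exp (- of_real (ln pi) / 2) * (of_real (ln pi) / 2)) * rGamma (- 1 / 2) * completed_zeta (- 1 / 2)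
      + exp (- of_real (ln pi) / 2) * (- rGamma (- 1 / 2) * Digamma (- 1 / 2) / 2) * completed_zeta (- 1 / 2)
      + exp (- of_real (ln pi) / 2) * rGamma (- 1 / 2) * (- D / 2)) (at (- 1))"
    unfolding zeta_cont_def[abs_def]
    by (rule DERIV_cong[OF DERIV_mult[OF DERIV_mult[OF e g] z]]) (simp add: algebra_simps)
  hence "deriv riemann_zeta (- 1) =
      (exp (- of_real (ln pi) / 2) * (of_real (ln pi) / 2)) * rGamma (- 1 / 2) * completed_zeta (- 1 / 2)
      + exp (- of_real (ln pi) / 2) * (- rGamma (- 1 / 2) * Digamma (- 1 / 2) / 2) * completed_zeta (- 1 / 2)
      + exp (- of_real (ln pi) / 2) * rGamma (- 1 / 2) * (- D / 2)"
    using deriv_riemann_zeta_eq[of "- 1"] by (simp add: DERIV_imp_deriv)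
  \<comment> \<open>All three products share the factor \<pi>^(-1/2) / \<Gamma>(-1/2) = -1/(2
    \<pi>), so multiplication by 4 \<pi> isolates D.\<close>
  also have "\<dots> = of_real (1 / sqrt pi * (- 1 / (2 * sqrt pi))) *
       (of_real (ln pi) / 2 * of_real (pi / 6) - Digamma (- 1 / 2) / 2 * of_real (pi / 6) - D / 2)"
    unfolding exp_pi r Z by (simp add: algebra_simps)
  also have "1 / sqrt pi * (- 1 / (2 * sqrt pi)) = - 1 / (2 * pi)"
    by simp
  finally have "deriv riemann_zeta (- 1) = of_real (- 1 / (2 * pi)) *
       (of_real (ln pi) / 2 * of_real (pi / 6) - Digamma (- 1 / 2) / 2 * of_real (pi / 6) - D / 2)" .
  moreover have "4 * of_real pi * (of_real (- 1 / (2 * pi)) * X) = - 2 * X" for X :: complex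
    by simp
  moreover have "- 2 * (L / 2 * P - \<psi> / 2 * P - D / 2) = D - P * (L - \<psi>)" for L P \<psi> D :: complex
    by (simp add: algebra_simps)
  ultimately have "4 * of_real pi * deriv riemann_zeta (- 1) = D - of_real (pi / 6) * (of_real (ln pi) - Digamma (- 1 / 2))"
    by metis
  moreover have "ln (4 * pi) = ln pi + 2 * ln 2"
    using ln_realpow[of 2 2] by (simp add: ln_mult)
  ultimately have "D = 4 * of_real pi * deriv riemann_zeta (- 1) + of_real (pi / 6 * (ln (4 * pi) - 2 + euler_mascheroni))"
    unfolding psi by (simp add: algebra_simps)
  thus ?thesis using D by simp
qed

subsection \<open>Fourier expansion of the Eisenstein series\<close>

lemma powr_of_int_eq_exp: "k > 0 \<Longrightarrow> of_int k powr \<nu> = exp (\<nu> * complex_of_real (ln (real_of_int k)))"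
  using Ln_of_real[of "real_of_int k"] by (simp add: powr_def)

lemma has_sum_nonzero_int_even:
  fixes f :: "int \<Rightarrow> complex"
  assumes "((\<lambda>n. f (int (Suc n))) has_sum S) UNIV" and even: "\<And>m. f (- m) = f m"
  shows "(f has_sum S) {1..}" "(f has_sum 2 * S) (UNIV - {0})"
proof -
  have ranges: "range (\<lambda>n. int (Suc n)) = {1..}" "range (\<lambda>n. - int (Suc n)) = {..-1}"
  proof -
    have "m \<in> range (\<lambda>n. int (Suc n))" if "m \<ge> 1" for m
      by (rule range_eqI[of _ _ "nat (m - 1)"]) (use that in auto)
    thus "range (\<lambda>n. int (Suc n)) = {1..}" by auto
    have "m \<in> range (\<lambda>n. - int (Suc n))" if "m \<le> -1" for m
      by (rule range_eqI[of _ _ "nat (- m - 1)"]) (use that in auto)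
    thus "range (\<lambda>n. - int (Suc n)) = {..-1}" by auto
  qed
  show 1: "(f has_sum S) {1..}"
    unfolding ranges[symmetric] by (subst has_sum_reindex) (use assms in \<open>auto simp: inj_on_def o_def\<close>)
  have 2: "(f has_sum S) {..-1}"
    unfolding ranges[symmetric]
    by (subst has_sum_reindex) (use assms(1) in \<open>auto simp: inj_on_def o_def even simp del: of_nat_Suc\<close>)
  have "(f has_sum (S + S)) ({1..} \<union> {..-1})"
    by (intro has_sum_Un_disjoint 1 2) auto
  moreover have "{1..} \<union> {..-1} = UNIV - {0::int}" by auto
  ultimately show "(f has_sum 2 * S) (UNIV - {0})" by simp
qed

section \<open>Absolute convergence of the lattice sum\<close>

text \<open>The product on the left separates c from d, so the double series is dominated by a
  product of two single series of exponent Re s > 1.\<close>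

lemma norm_lattice_point_ge:
  assumes v: "v > 0"
  obtains k where "k > 0"
    "\<And>c d :: int. (c, d) \<noteq> (0, 0) \<Longrightarrow> k * ((1 + \<bar>of_int c\<bar>) * (1 + \<bar>of_int d\<bar>)) \<le> (norm (of_int c * Complex u v + of_int d))\<^sup>2"
proof
  define \<tau> where "\<tau> = Complex u v"
  \<comment> \<open>The imaginary part gives |c| <= N/v, and then the triangle inequality gives |d|
    <= N + |tau| N/v; \<open>r\<close> collects the coefficients, so both are at most r N.\<close>
  define r where "r = 1 + 1 / v + norm \<tau> / v"
  have r: "r > 0" using v by (auto simp: r_def intro!: add_pos_nonneg)
  show "1 / (4 * r\<^sup>2) > 0" using r by simp
  fix c d :: int assume cd: "(c, d) \<noteq> (0, 0)"
  define N where "N = norm (of_int c * \<tau> + of_int d)"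
  define M where "M = max \<bar>real_of_int c\<bar> \<bar>real_of_int d\<bar>"
  have "\<bar>Im (of_int c * \<tau> + of_int d)\<bar> \<le> N" unfolding N_def by (rule abs_Im_le_cmod)
  hence c: "\<bar>real_of_int c\<bar> \<le> N / v"
    using v by (simp add: \<tau>_def abs_mult field_simps)
  have "norm (of_int d :: complex) = norm ((of_int c * \<tau> + of_int d) - of_int c * \<tau>)" by simp
  also have "\<dots> \<le> N + norm (of_int c * \<tau>)" unfolding N_def by (rule norm_triangle_ineq4)
  also have "\<dots> = N + \<bar>real_of_int c\<bar> * norm \<tau>" by (simp add: norm_mult)
  also have "\<dots> \<le> N + N / v * norm \<tau>" using c by (intro add_left_mono mult_right_mono) auto
  finally have d: "\<bar>real_of_int d\<bar> \<le> N + N / v * norm \<tau>" by simp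
  have "N \<ge> 0" by (simp add: N_def)
  hence nn: "0 \<le> N / v" "0 \<le> N / v * norm \<tau>" using v by auto
  have rN: "r * N = N + N / v + N / v * norm \<tau>" by (simp add: r_def algebra_simps)
  have M_le: "M \<le> r * N" unfolding M_def rN using c d nn \<open>N \<ge> 0\<close> by linarith
  have M1: "M \<ge> 1"
  proof -
    have "\<bar>c\<bar> \<ge> 1 \<or> \<bar>d\<bar> \<ge> 1" using cd by auto
    hence "\<bar>real_of_int c\<bar> \<ge> 1 \<or> \<bar>real_of_int d\<bar> \<ge> 1" by linarith
    thus ?thesis by (auto simp: M_def)
  qed
  have "(1 + \<bar>real_of_int c\<bar>) * (1 + \<bar>real_of_int d\<bar>) \<le> (2 * M) * (2 * M)"
    using M1 by (intro mult_mono) (auto simp: M_def)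
  also have "\<dots> \<le> (2 * (r * N)) * (2 * (r * N))"
    using M1 M_le by (intro mult_mono) auto
  also have "\<dots> = 4 * r\<^sup>2 * N\<^sup>2" by (simp add: power2_eq_square)
  finally have "(1 + \<bar>real_of_int c\<bar>) * (1 + \<bar>real_of_int d\<bar>) \<le> 4 * r\<^sup>2 * N\<^sup>2" .
  thus "1 / (4 * r\<^sup>2) * ((1 + \<bar>of_int c\<bar>) * (1 + \<bar>of_int d\<bar>)) \<le> (norm (of_int c * Complex u v + of_int d))\<^sup>2"
    using r by (simp add: N_def \<tau>_def field_simps)
qed

lemma norm_lattice_point_sq:
  "(norm (of_int c * Complex u v + of_int d))\<^sup>2 = (of_int c * u + of_int d)\<^sup>2 + (of_int c)\<^sup>2 * v\<^sup>2"
  by (simp add: cmod_power2 power_mult_distrib)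

lemma norm_lattice_point_pos:
  assumes "v > 0" "(c, d) \<noteq> (0, 0)"
  shows "(norm (of_int c * Complex u v + of_int d))\<^sup>2 > 0"
proof -
  have "of_int c * Complex u v + of_int d \<noteq> 0"
    using assms by (auto simp: complex_eq_iff)
  thus ?thesis by simp
qed

text \<open>\<pi>^(-s) \<Gamma>(s) v^s / |c tau + d|^(2s), written in the form of the scaled Gamma
  integral with a = \<pi> |c tau + d|^2 / v.\<close>

definition lattice_term :: "real \<Rightarrow> real \<Rightarrow> complex \<Rightarrow> int \<Rightarrow> int \<Rightarrow> complex" where
  "lattice_term u v s c d =
     Gamma s * exp (- (s * of_real (ln (pi * (norm (of_int c * Complex u v + of_int d))\<^sup>2 / v))))"

lemma lattice_term_uminus: "lattice_term u v s (- c) (- d) = lattice_term u v s c d"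
proof -
  have "norm (of_int (- c) * Complex u v + of_int (- d)) = norm (- (of_int c * Complex u v + of_int d))"
    by (simp add: algebra_simps)
  thus ?thesis unfolding lattice_term_def by (simp only: norm_minus_cancel)
qed

lemma lattice_term_eq:
  assumes v: "v > 0" and cd: "(c, d) \<noteq> (0, 0)"
  shows "of_real pi powr (- s) * Gamma s * (of_real (Im (Complex u v)) powr s /
       of_real (cmod (of_int c * Complex u v + of_int d)) powr (2 * s)) = lattice_term u v s c d"
proof -
  define N where "N = norm (of_int c * Complex u v + of_int d)"
  have N: "N > 0" using norm_lattice_point_pos[OF v cd, of u] by (simp add: N_def)
  have powr: "complex_of_real x powr z = exp (z * of_real (ln x))" if "x > 0" for x z
    using that by (simp add: powr_def Ln_of_real)
  have "ln (pi * N\<^sup>2 / v) = ln pi + 2 * ln N - ln v"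
    using N v by (simp add: ln_mult ln_div ln_realpow)
  thus ?thesis
    using N v unfolding lattice_term_def N_def[symmetric]
    by (simp add: powr mult_exp_exp flip: exp_diff) (simp add: algebra_simps exp_add[symmetric] exp_diff[symmetric])
qed

lemma lattice_term_abs_summable:
  assumes v: "v > 0" and s: "Re s > 1"
  shows "(\<lambda>p. norm (case p of (c, d) \<Rightarrow> lattice_term u v s c d)) summable_on (UNIV - {(0, 0)})"
proof -
  obtain k where k: "k > 0"
    "\<And>c d :: int. (c, d) \<noteq> (0, 0) \<Longrightarrow> k * ((1 + \<bar>of_int c\<bar>) * (1 + \<bar>of_int d\<bar>)) \<le> (norm (of_int c * Complex u v + of_int d))\<^sup>2"
    using norm_lattice_point_ge[OF v] by blast
  define g where "g m = (1 + \<bar>real_of_int m\<bar>) powr (- Re s)" for m :: int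
  have "summable (\<lambda>n. real n powr (- Re s))"
    using s by (subst summable_real_powr_iff) auto
  hence "summable (\<lambda>n. real (Suc n) powr (- Re s))"
    by (subst summable_Suc_iff)
  hence "(\<lambda>n. real (Suc n) powr (- Re s)) summable_on UNIV"
    by (intro summable_nonneg_imp_summable_on) auto
  from summable_on_int_even[OF this, of UNIV] have g: "g summable_on UNIV"
    by (simp add: g_def[abs_def])
  have "(\<lambda>(c, d). g c * g d) summable_on UNIV \<times> UNIV"
  proof (rule summable_on_SigmaI)
    show "((\<lambda>d. case (c, d) of (c, d) \<Rightarrow> g c * g d) has_sum g c * infsum g UNIV) UNIV" for c
      using has_sum_cmult_right[OF has_sum_infsum[OF g], of "g c"] by simp
    show "(\<lambda>c. g c * infsum g UNIV) summable_on UNIV"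
      by (intro summable_on_cmult_left g)
  qed (auto simp: g_def)
  hence gg: "(\<lambda>(c, d). g c * g d) summable_on UNIV" by simp
  define C where "C = norm (Gamma s) * (pi * k / v) powr (- Re s)"
  have "(\<lambda>p. C * (case p of (c, d) \<Rightarrow> g c * g d)) summable_on UNIV - {(0, 0)}"
    by (intro summable_on_cmult_right summable_on_subset[OF gg]) auto
  thus ?thesis
  proof (rule summable_on_comparison_test)
    fix p :: "int \<times> int" assume p: "p \<in> UNIV - {(0, 0)}"
    obtain c d where cd: "p = (c, d)" "(c, d) \<noteq> (0, 0)" using p by (cases p) auto
    define N where "N = (norm (of_int c * Complex u v + of_int d))\<^sup>2"
    have N: "N > 0" unfolding N_def by (rule norm_lattice_point_pos[OF v cd(2)])
    have "norm (lattice_term u v s c d) = norm (Gamma s) * (pi * N / v) powr (- Re s)"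
      using N v by (simp add: lattice_term_def norm_mult N_def[symmetric] powr_def)
    also have "(pi * N / v) powr (- Re s) \<le> (pi * (k * ((1 + \<bar>of_int c\<bar>) * (1 + \<bar>of_int d\<bar>))) / v) powr (- Re s)"
      using k(1) k(2)[OF cd(2)] s v unfolding N_def
      by (intro powr_mono2' divide_right_mono mult_left_mono divide_pos_pos mult_pos_pos) (auto intro!: add_pos_nonneg)
    also have "pi * (k * ((1 + \<bar>of_int c\<bar>) * (1 + \<bar>of_int d\<bar>))) / v = (pi * k / v) * ((1 + \<bar>real_of_int c\<bar>) * (1 + \<bar>real_of_int d\<bar>))"
      by simp
    also have "\<dots> powr (- Re s) = (pi * k / v) powr (- Re s) * (g c * g d)"
      unfolding g_def using k(1) v by (simp only: powr_mult)
    finally show "norm (case p of (c, d) \<Rightarrow> lattice_term u v s c d) \<le> C * (case p of (c, d) \<Rightarrow> g c * g d)"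
      using cd by (simp add: C_def mult.assoc mult_left_mono)
  qed auto
qed

section \<open>Size and rearrangement of the non-constant Fourier terms\<close>

text \<open>The argument v is complex and its root is \<open>csqrt\<close>, so that the coefficient
  is holomorphic on Re v > 0 and can be differentiated in v by complex methods.\<close>

definition eis_coeff :: "complex \<Rightarrow> complex \<Rightarrow> int \<Rightarrow> complex" where
  "eis_coeff s v n = sigma_star (s - 1 / 2) n * (csqrt v * bessel_B (s - 1 / 2) (of_real (2 * pi * \<bar>of_int n\<bar>) * v))"

lemma finite_pos_divisors: "n \<noteq> 0 \<Longrightarrow> finite {d::int. d dvd n \<and> d > 0}"
  by (rule finite_subset[OF _ finite_divisors_int[of n]]) auto

lemma card_pos_divisors_le: "n \<noteq> 0 \<Longrightarrow> real (card {d::int. d dvd n \<and> d > 0}) \<le> 1 + \<bar>real_of_int n\<bar>"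
proof -
  assume n: "n \<noteq> 0"
  have "{d::int. d dvd n \<and> d > 0} \<subseteq> {1..\<bar>n\<bar>}"
    using n by (auto dest: dvd_imp_le_int)
  hence "card {d::int. d dvd n \<and> d > 0} \<le> card {1..\<bar>n\<bar>}" by (intro card_mono) auto
  thus ?thesis by simp
qed

text \<open>Crude on purpose: |n|^\<nu> costs K powers and d^(-2\<nu>) at most 2K more. Any
  polynomial growth is harmless against the exponential decay of the Bessel factor.\<close>

lemma sigma_star_term_bound:
  assumes n: "n \<noteq> 0" and \<nu>: "\<bar>Re \<nu>\<bar> \<le> real K" and d: "d dvd n" "d > 0"
  shows "norm (of_int \<bar>n\<bar> powr \<nu> * of_int d powr (- 2 * \<nu>)) \<le> (1 + \<bar>real_of_int n\<bar>) ^ (3 * K)"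
proof -
  have norm_le: "norm (of_int k powr z) \<le> (1 + \<bar>real_of_int n\<bar>) ^ j"
    if k: "k > 0" "k \<le> \<bar>n\<bar>" and z: "Re z \<le> real j" for k :: int and z :: complex and j
  proof -
    have "norm (of_int k powr z) = real_of_int k powr Re z"
      using k by (simp only: powr_of_int_eq_exp norm_exp_eq_Re) (simp add: powr_def)
    also have "\<dots> \<le> real_of_int k powr real j" using k z by (intro powr_mono) auto
    also have "\<dots> = real_of_int k ^ j" using k by (simp add: powr_realpow)
    also have "\<dots> \<le> (1 + \<bar>real_of_int n\<bar>) ^ j" using k by (intro power_mono) auto
    finally show ?thesis .
  qed
  have "d \<le> \<bar>n\<bar>" using d n by (simp add: zdvd_imp_le)
  hence "norm (of_int \<bar>n\<bar> powr \<nu>) * norm (of_int d powr (- 2 * \<nu>)) \<le> (1 + \<bar>real_of_int n\<bar>) ^ K * (1 + \<bar>real_of_int n\<bar>) ^ (2 * K)"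
    using n d \<nu> by (intro mult_mono norm_le) auto
  also have "\<dots> = (1 + \<bar>real_of_int n\<bar>) ^ (3 * K)" by (simp flip: power_add)
  finally show ?thesis by (simp add: norm_mult)
qed

lemma sum_norm_sigma_star_le:
  assumes n: "n \<noteq> 0" and \<nu>: "\<bar>Re \<nu>\<bar> \<le> real K"
  shows "(\<Sum>d | d dvd n \<and> d > 0. norm (of_int \<bar>n\<bar> powr \<nu> * of_int d powr (- 2 * \<nu>))) \<le> (1 + \<bar>real_of_int n\<bar>) ^ (3 * K + 1)"
proof -
  have "(\<Sum>d | d dvd n \<and> d > 0. norm (of_int \<bar>n\<bar> powr \<nu> * of_int d powr (- 2 * \<nu>))) \<le>
        real (card {d. d dvd n \<and> d > 0}) * (1 + \<bar>real_of_int n\<bar>) ^ (3 * K)"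
    by (rule sum_bounded_above) (use sigma_star_term_bound[OF n \<nu>] in auto)
  also have "\<dots> \<le> (1 + \<bar>real_of_int n\<bar>) * (1 + \<bar>real_of_int n\<bar>) ^ (3 * K)"
    using card_pos_divisors_le[OF n] by (intro mult_right_mono) auto
  finally show ?thesis by simp
qed

lemma sigma_star_bound:
  assumes n: "n \<noteq> 0" and \<nu>: "\<bar>Re \<nu>\<bar> \<le> real K"
  shows "norm (sigma_star \<nu> n) \<le> (1 + \<bar>real_of_int n\<bar>) ^ (3 * K + 1)"
  unfolding sigma_star_def sum_distrib_left
  by (rule order_trans[OF norm_sum sum_norm_sigma_star_le[OF assms]])

text \<open>One summable majorant for a whole region of s, v and u. The Bessel factor decays like
  exp(- pi a |n|), while |Im u| <= a/4 lets the exponential grow at most like exp(pi a |n| / 2);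
  half of the decay survives. The explicit power of 1 + |n| is kept on the left so that it can pay
  both for divisor sums and for the extra factor n after differentiation.\<close>

lemma eis_coeff_bound:
  fixes K :: nat and a b :: real
  assumes a: "a > 0"
  obtains M where "M summable_on (UNIV - {0})"
    "\<And>n s v u. n \<noteq> 0 \<Longrightarrow> \<bar>Re s - 1 / 2\<bar> \<le> real K \<Longrightarrow> Re v \<ge> a \<Longrightarrow> norm v \<le> b \<Longrightarrow> \<bar>Im u\<bar> \<le> a / 4 \<Longrightarrow>
       (1 + \<bar>real_of_int n\<bar>) ^ (3 * K + 1) * (sqrt (norm v) * norm (bessel_B (s - 1 / 2) (of_real (2 * pi * \<bar>of_int n\<bar>) * v)) *
          norm (unit_exp (of_int n * u))) \<le> M n"
proof
  define J where "J = (\<integral>x. exp (real K * \<bar>x\<bar> - (2 * pi * a) / 2 * cosh x) \<partial>lborel)"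
  have J: "J \<ge> 0" unfolding J_def by (intro Bochner_Integration.integral_nonneg) auto
  define M where "M n = (sqrt b * J) * ((1 + real_of_int \<bar>n\<bar>) ^ (3 * K + 1) * exp (- (pi * a / 2 * real_of_int \<bar>n\<bar>)))" for n :: int
  show "M summable_on (UNIV - {0})"
    unfolding M_def by (intro summable_on_cmult_right summable_on_int_polynomial_exp) (use a in auto)
  fix n :: int and s v u :: complex
  assume n: "n \<noteq> 0" and s: "\<bar>Re s - 1 / 2\<bar> \<le> real K" and v: "Re v \<ge> a" "norm v \<le> b" and u: "\<bar>Im u\<bar> \<le> a / 4"
  have n1: "1 \<le> \<bar>real_of_int n\<bar>" using n by linarith
  have na: "\<bar>real_of_int n\<bar> * a \<le> \<bar>real_of_int n\<bar> * Re v"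
    by (rule mult_left_mono[OF v(1)]) simp
  have na': "a \<le> \<bar>real_of_int n\<bar> * Re v"
    using mult_mono[OF n1 v(1)] a by simp
  have "norm (bessel_B (s - 1 / 2) (of_real (2 * pi * \<bar>of_int n\<bar>) * v)) \<le>
      J * exp (- (Re (of_real (2 * pi * \<bar>of_int n\<bar>) * v) / 2))"
    unfolding J_def
  proof (rule norm_bessel_B_le)
    have "2 * pi * a \<le> 2 * pi * (\<bar>real_of_int n\<bar> * Re v)" using na' by (intro mult_left_mono) auto
    thus "2 * pi * a \<le> Re (of_real (2 * pi * \<bar>of_int n\<bar>) * v)" by (simp add: mult.assoc)
  qed (use a s in auto)
  also have "\<dots> \<le> J * exp (- (pi * a * \<bar>real_of_int n\<bar>))"
  proof -
    have le: "pi * (\<bar>real_of_int n\<bar> * a) \<le> pi * (\<bar>real_of_int n\<bar> * Re v)" by (rule mult_left_mono[OF na]) simp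
    have eq: "Re (of_real (2 * pi * \<bar>of_int n\<bar>) * v) / 2 = pi * (\<bar>real_of_int n\<bar> * Re v)"
      "pi * a * \<bar>real_of_int n\<bar> = pi * (\<bar>real_of_int n\<bar> * a)" by simp_all
    show ?thesis
      unfolding eq by (rule mult_left_mono[OF iffD2[OF exp_le_cancel_iff le_imp_neg_le[OF le]] J])
  qed
  finally have B: "norm (bessel_B (s - 1 / 2) (of_real (2 * pi * \<bar>of_int n\<bar>) * v)) \<le> J * exp (- (pi * a * \<bar>real_of_int n\<bar>))" .
  have "norm (unit_exp (of_int n * u)) \<le> exp (pi * a / 2 * \<bar>real_of_int n\<bar>)"
  proof -
    have "- (real_of_int n * Im u) \<le> \<bar>real_of_int n\<bar> * \<bar>Im u\<bar>" by (metis abs_ge_minus_self abs_mult)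
    also have "\<dots> \<le> \<bar>real_of_int n\<bar> * (a / 4)" using u by (intro mult_left_mono) auto
    finally have "2 * pi * - (real_of_int n * Im u) \<le> 2 * pi * (\<bar>real_of_int n\<bar> * (a / 4))"
      by (intro mult_left_mono) auto
    thus ?thesis by (simp add: norm_unit_exp mult_ac)
  qed
  with B have "norm (bessel_B (s - 1 / 2) (of_real (2 * pi * \<bar>of_int n\<bar>) * v)) * norm (unit_exp (of_int n * u)) \<le>
      (J * exp (- (pi * a * \<bar>real_of_int n\<bar>))) * exp (pi * a / 2 * \<bar>real_of_int n\<bar>)"
    using J by (intro mult_mono) auto
  also have "\<dots> = J * exp (- (pi * a / 2 * \<bar>real_of_int n\<bar>))"
    by (simp add: mult.assoc mult_exp_exp)
  finally have BE: "norm (bessel_B (s - 1 / 2) (of_real (2 * pi * \<bar>of_int n\<bar>) * v)) * norm (unit_exp (of_int n * u)) \<le>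
      J * exp (- (pi * a / 2 * \<bar>real_of_int n\<bar>))" .
  have b: "b \<ge> 0" using v(2) norm_ge_zero[of v] by linarith
  have "sqrt (norm v) * (norm (bessel_B (s - 1 / 2) (of_real (2 * pi * \<bar>of_int n\<bar>) * v)) * norm (unit_exp (of_int n * u))) \<le>
      sqrt b * (J * exp (- (pi * a / 2 * \<bar>real_of_int n\<bar>)))"
    by (rule mult_mono[OF real_sqrt_le_mono[OF v(2)] BE]) (use b in auto)
  hence "(1 + \<bar>real_of_int n\<bar>) ^ (3 * K + 1) * (sqrt (norm v) * (norm (bessel_B (s - 1 / 2) (of_real (2 * pi * \<bar>of_int n\<bar>) * v)) * norm (unit_exp (of_int n * u)))) \<le>
    (1 + \<bar>real_of_int n\<bar>) ^ (3 * K + 1) * (sqrt b * (J * exp (- (pi * a / 2 * \<bar>real_of_int n\<bar>))))"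
    by (intro mult_left_mono) auto
  thus "(1 + \<bar>real_of_int n\<bar>) ^ (3 * K + 1) * (sqrt (norm v) * norm (bessel_B (s - 1 / 2) (of_real (2 * pi * \<bar>of_int n\<bar>) * v)) *
          norm (unit_exp (of_int n * u))) \<le> M n"
    by (simp add: M_def mult_ac)
qed

lemma norm_eis_coeff_le:
  assumes "n \<noteq> 0" "\<bar>Re s - 1 / 2\<bar> \<le> real K"
  shows "norm (eis_coeff s v n * w) \<le> (1 + \<bar>real_of_int n\<bar>) ^ (3 * K + 1) *
     (sqrt (norm v) * norm (bessel_B (s - 1 / 2) (of_real (2 * pi * \<bar>of_int n\<bar>) * v)) * norm w)"
proof -
  have "norm (sigma_star (s - 1 / 2) n) \<le> (1 + \<bar>real_of_int n\<bar>) ^ (3 * K + 1)"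
    using assms by (intro sigma_star_bound) auto
  hence "norm (sigma_star (s - 1 / 2) n) * (sqrt (norm v) * norm (bessel_B (s - 1 / 2) (of_real (2 * pi * \<bar>of_int n\<bar>) * v)) * norm w)
     \<le> (1 + \<bar>real_of_int n\<bar>) ^ (3 * K + 1) *
     (sqrt (norm v) * norm (bessel_B (s - 1 / 2) (of_real (2 * pi * \<bar>of_int n\<bar>) * v)) * norm w)"
    by (intro mult_right_mono) auto
  thus ?thesis by (simp add: eis_coeff_def norm_mult mult_ac)
qed

text \<open>The summand of the Fourier expansion before collecting the pairs \<open>(c, m)\<close> with product \<open>n\<close>.\<close>

definition pair_term :: "complex \<Rightarrow> real \<Rightarrow> real \<Rightarrow> int \<Rightarrow> int \<Rightarrow> complex" where
  "pair_term s u v c m = exp ((s - 1 / 2) * of_real (ln (\<bar>of_int m\<bar> / of_int c))) *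
     (of_real (sqrt v) * bessel_B (s - 1 / 2) (of_real (2 * pi * \<bar>of_int (c * m)\<bar> * v))) * unit_exp (of_int (c * m) * of_real u)"

text \<open>For n = c m one has |m|/c = |n|/c^2, so the power of |m|/c equals |n|^\<nu> c^(-2\<nu>),
  and the sum over the divisors c of n is \<open>sigma_star\<close>. Absolute summability over all
  pairs permits both orders of summation.\<close>

lemma
  assumes v: "v > 0"
  shows pair_term_abs_summable: "(\<lambda>p. norm (case p of (c, m) \<Rightarrow> pair_term s u v c m)) summable_on ({1..} \<times> (UNIV - {0}))"
    and pair_term_has_sum: "((\<lambda>(c, m). pair_term s u v c m) has_sum
           (\<Sum>\<^sub>\<infinity>n\<in>UNIV - {0}. eis_coeff s (of_real v) n * unit_exp (of_int n * of_real u))) ({1..} \<times> (UNIV - {0}))"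
proof -
  define \<nu> where "\<nu> = s - 1 / 2"
  define D where "D n = {d::int. d dvd n \<and> d > 0}" for n
  define W where "W n = of_real (sqrt v) * bessel_B \<nu> (of_real (2 * pi * \<bar>of_int n\<bar> * v)) * unit_exp (of_int n * of_real u)" for n :: int
  define g where "g p = (case p of (n, c) \<Rightarrow> of_int \<bar>n\<bar> powr \<nu> * of_int c powr (- 2 * \<nu>) * W n)" for p :: "int \<times> int"
  define P where "P = Sigma (UNIV - {0}) D"
  obtain K where K: "\<bar>Re s - 1 / 2\<bar> \<le> real K" using real_arch_simple by blast
  obtain M where M: "M summable_on (UNIV - {0})"
    "\<And>n s' v' u'. n \<noteq> 0 \<Longrightarrow> \<bar>Re s' - 1 / 2\<bar> \<le> real K \<Longrightarrow> Re v' \<ge> v \<Longrightarrow> norm v' \<le> v \<Longrightarrow> \<bar>Im u'\<bar> \<le> v / 4 \<Longrightarrow>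
       (1 + \<bar>real_of_int n\<bar>) ^ (3 * K + 1) * (sqrt (norm v') * norm (bessel_B (s' - 1 / 2) (of_real (2 * pi * \<bar>of_int n\<bar>) * v')) *
          norm (unit_exp (of_int n * u'))) \<le> M n"
    using eis_coeff_bound[OF v, of K v] by blast
  have M': "(1 + \<bar>real_of_int n\<bar>) ^ (3 * K + 1) * norm (W n) \<le> M n" if "n \<noteq> 0" for n
    using M(2)[OF that K, of "of_real v" "of_real u"] v
    by (simp add: W_def \<nu>_def norm_mult mult_ac)
  have D_fin: "finite (D n)" if "n \<noteq> 0" for n unfolding D_def by (rule finite_pos_divisors[OF that])
  have g_sum_norm: "(\<Sum>c\<in>D n. norm (g (n, c))) \<le> M n" if n: "n \<noteq> 0" for n
  proof -
    have "(\<Sum>c\<in>D n. norm (g (n, c))) = (\<Sum>c\<in>D n. norm (of_int \<bar>n\<bar> powr \<nu> * of_int c powr (- 2 * \<nu>))) * norm (W n)"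
      by (simp add: g_def norm_mult sum_distrib_right)
    also have "\<dots> \<le> (1 + \<bar>real_of_int n\<bar>) ^ (3 * K + 1) * norm (W n)"
      unfolding D_def using n K by (intro mult_right_mono sum_norm_sigma_star_le) (auto simp: \<nu>_def)
    finally show ?thesis using M'[OF n] by linarith
  qed
  have g_abs: "(\<lambda>p. norm (g p)) summable_on P"
    unfolding P_def
  proof (subst Infinite_Sum.abs_summable_on_Sigma_iff, intro conjI ballI)
    fix n :: int assume "n \<in> UNIV - {0}"
    thus "(\<lambda>c. norm (g (n, c))) summable_on D n" using D_fin by (intro summable_on_finite) auto
  next
    show "(\<lambda>n. norm (\<Sum>\<^sub>\<infinity>c\<in>D n. norm (g (n, c)))) summable_on UNIV - {0}"
    proof (rule summable_on_comparison_test[OF M(1)])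
      fix n :: int assume n: "n \<in> UNIV - {0}"
      hence "(\<Sum>\<^sub>\<infinity>c\<in>D n. norm (g (n, c))) = (\<Sum>c\<in>D n. norm (g (n, c)))" using D_fin by (intro infsum_finite) auto
      thus "norm (\<Sum>\<^sub>\<infinity>c\<in>D n. norm (g (n, c))) \<le> M n"
        using g_sum_norm[of n] n by (simp add: sum_nonneg)
    qed auto
  qed
  have g_pair: "g (c * m, c) = pair_term s u v c m" if c: "c \<ge> 1" and m: "m \<noteq> 0" for c m
  proof -
    have "ln (\<bar>real_of_int m\<bar> / of_int c) = ln (real_of_int \<bar>c * m\<bar>) - 2 * ln (real_of_int c)"
      using c m by (simp add: abs_mult ln_mult ln_div)
    hence "complex_of_real (ln (\<bar>real_of_int m\<bar> / of_int c)) =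
        of_real (ln (real_of_int \<bar>c * m\<bar>)) - 2 * of_real (ln (real_of_int c))"
      by (simp only: of_real_diff of_real_mult of_real_numeral)
    hence "exp (\<nu> * of_real (ln (\<bar>real_of_int m\<bar> / of_int c))) = of_int \<bar>c * m\<bar> powr \<nu> * of_int c powr (- 2 * \<nu>)"
      using c m by (simp only: powr_of_int_eq_exp) (simp add: powr_of_int_eq_exp mult_exp_exp right_diff_distrib mult_ac)
    thus ?thesis by (simp add: g_def W_def pair_term_def \<nu>_def mult_ac)
  qed
  \<comment> \<open>Pairs (c, m) with c >= 1 and m nonzero correspond to a nonzero n together with a
    positive divisor c of n.\<close>
  have bij: "bij_betw (\<lambda>(c, m). (c * m, c)) ({1..} \<times> (UNIV - {0})) P"
    by (rule bij_betwI[where g = "\<lambda>(n, c). (c, n div c)"]) (auto simp: P_def D_def dvd_div_eq_0_iff)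
  have eq: "g ((\<lambda>(c, m). (c * m, c)) p) = (\<lambda>(c, m). pair_term s u v c m) p" if "p \<in> {1..} \<times> (UNIV - {0})" for p
    using that g_pair by auto
  have "(\<lambda>p. norm (g ((\<lambda>(c, m). (c * m, c)) p))) summable_on ({1..} \<times> (UNIV - {0}))"
    using g_abs by (subst summable_on_reindex_bij_betw[OF bij])
  also have "?this \<longleftrightarrow> (\<lambda>p. norm (case p of (c, m) \<Rightarrow> pair_term s u v c m)) summable_on ({1..} \<times> (UNIV - {0}))"
    by (intro summable_on_cong arg_cong[where f = norm] eq)
  finally show "(\<lambda>p. norm (case p of (c, m) \<Rightarrow> pair_term s u v c m)) summable_on ({1..} \<times> (UNIV - {0}))" .
  have "(g has_sum (\<Sum>\<^sub>\<infinity>p\<in>P. g p)) P"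
    by (rule has_sum_infsum[OF abs_summable_summable[OF g_abs]])
  hence hs: "((\<lambda>p. g ((\<lambda>(c, m). (c * m, c)) p)) has_sum (\<Sum>\<^sub>\<infinity>p\<in>P. g p)) ({1..} \<times> (UNIV - {0}))"
    by (subst has_sum_reindex_bij_betw[OF bij])
  have "(\<Sum>\<^sub>\<infinity>p\<in>P. g p) = (\<Sum>\<^sub>\<infinity>n\<in>UNIV - {0}. \<Sum>\<^sub>\<infinity>c\<in>D n. g (n, c))"
    unfolding P_def using abs_summable_summable[OF g_abs] by (subst infsum_Sigma_banach) (auto simp: P_def)
  also have "\<dots> = (\<Sum>\<^sub>\<infinity>n\<in>UNIV - {0}. eis_coeff s (of_real v) n * unit_exp (of_int n * of_real u))"
  proof (rule infsum_cong)
    fix n :: int assume n: "n \<in> UNIV - {0}"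
    hence "(\<Sum>\<^sub>\<infinity>c\<in>D n. g (n, c)) = (\<Sum>c\<in>D n. g (n, c))" using D_fin by (intro infsum_finite) auto
    also have "\<dots> = sigma_star \<nu> n * W n"
      by (simp add: g_def sigma_star_def D_def sum_distrib_left sum_distrib_right)
    also have "\<dots> = eis_coeff s (of_real v) n * unit_exp (of_int n * of_real u)"
      using v by (simp add: eis_coeff_def W_def \<nu>_def mult_ac)
    finally show "(\<Sum>\<^sub>\<infinity>c\<in>D n. g (n, c)) = eis_coeff s (of_real v) n * unit_exp (of_int n * of_real u)" .
  qed
  finally have "(\<Sum>\<^sub>\<infinity>p\<in>P. g p) = (\<Sum>\<^sub>\<infinity>n\<in>UNIV - {0}. eis_coeff s (of_real v) n * unit_exp (of_int n * of_real u))" .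
  with hs show "((\<lambda>(c, m). pair_term s u v c m) has_sum
           (\<Sum>\<^sub>\<infinity>n\<in>UNIV - {0}. eis_coeff s (of_real v) n * unit_exp (of_int n * of_real u))) ({1..} \<times> (UNIV - {0}))"
    by (subst (asm) has_sum_cong[OF eq]) auto
qed

section \<open>Poisson summation along the rows of the lattice\<close>

text \<open>Translation by ln(m/c) balances c^2 exp x against m^2 exp(-x); both become c m
  exp(\<plusminus> y), whose sum is 2 c m cosh y.\<close>

lemma
  fixes c m v :: real
  assumes c: "c > 0" and m: "m > 0" and v: "v > 0"
  shows integrable_bessel_scaled:
      "integrable lborel (\<lambda>x. exp (\<nu> * of_real x - of_real (pi * v * (c\<^sup>2 * exp x + m\<^sup>2 * exp (- x)))))"
    and integral_bessel_scaled:
      "(\<integral>x. exp (\<nu> * of_real x - of_real (pi * v * (c\<^sup>2 * exp x + m\<^sup>2 * exp (- x)))) \<partial>lborel) =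
         exp (\<nu> * of_real (ln (m / c))) * bessel_B \<nu> (of_real (2 * pi * (c * m) * v))"
proof -
  define f where "f x = exp (\<nu> * of_real x - of_real (pi * v * (c\<^sup>2 * exp x + m\<^sup>2 * exp (- x))))" for x
  have eq: "f (ln (m / c) + 1 * y) = exp (\<nu> * of_real (ln (m / c))) *
      exp (\<nu> * of_real y - of_real (2 * pi * (c * m) * v) * of_real (cosh y))" for y
  proof -
    have "c\<^sup>2 * exp (ln (m / c) + 1 * y) + m\<^sup>2 * exp (- (ln (m / c) + 1 * y)) = 2 * (c * m) * cosh y"
      using c m by (simp add: exp_add exp_diff exp_minus cosh_field_def field_simps power2_eq_square)
    hence "f (ln (m / c) + 1 * y) = exp (\<nu> * of_real (ln (m / c) + 1 * y) - of_real (pi * v * (2 * (c * m) * cosh y)))"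
      unfolding f_def by (simp only:)
    also have "\<nu> * of_real (ln (m / c) + 1 * y) - of_real (pi * v * (2 * (c * m) * cosh y)) =
        \<nu> * of_real (ln (m / c)) + (\<nu> * of_real y - of_real (2 * pi * (c * m) * v) * of_real (cosh y))"
      by (simp add: algebra_simps)
    finally show ?thesis by (simp only: exp_add)
  qed
  have int: "integrable lborel (\<lambda>y. exp (\<nu> * of_real y - of_real (2 * pi * (c * m) * v) * of_real (cosh y)))"
    using assms by (intro integrable_bessel_B) auto
  have "integrable lborel (\<lambda>y. f (ln (m / c) + 1 * y))"
    unfolding eq by (intro integrable_mult_right int)
  thus "integrable lborel (\<lambda>x. exp (\<nu> * of_real x - of_real (pi * v * (c\<^sup>2 * exp x + m\<^sup>2 * exp (- x)))))"
    unfolding f_def[symmetric] by (subst (asm) lborel_integrable_real_affine_iff) auto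
  have "(\<integral>x. f x \<partial>lborel) = (\<integral>y. f (ln (m / c) + 1 * y) \<partial>lborel)"
    using lborel_integral_real_affine[of 1 f "ln (m / c)"] by simp
  also have "\<dots> = exp (\<nu> * of_real (ln (m / c))) * bessel_B \<nu> (of_real (2 * pi * (c * m) * v))"
    unfolding eq bessel_B_def by (rule Bochner_Integration.integral_mult_right_zero)
  finally show "(\<integral>x. exp (\<nu> * of_real x - of_real (pi * v * (c\<^sup>2 * exp x + m\<^sup>2 * exp (- x)))) \<partial>lborel) =
         exp (\<nu> * of_real (ln (m / c))) * bessel_B \<nu> (of_real (2 * pi * (c * m) * v))"
    unfolding f_def .
qed

text \<open>Both expansions integrate the same function \<Theta>: as a sum over d its terms are
  Gamma integrals giving the lattice terms, and after the theta transformation with t = exp x / v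
  and shift c u it is a sum over m, with a Gamma integral for m = 0 and Bessel integrals for the
  other m.\<close>

lemma lattice_row_has_sum:
  assumes v: "v > 0" and s: "Re s > 1" and c: "c \<ge> 1"
  shows "((\<lambda>d. lattice_term u v s c d) has_sum
            (of_real (sqrt v) * (Gamma (s - 1 / 2) * exp (- ((s - 1 / 2) * of_real (ln (pi * v * (of_int c)\<^sup>2)))))
               + (\<Sum>\<^sub>\<infinity>m\<in>UNIV - {0}. pair_term s u v c m))) UNIV"
    and "(\<lambda>m. pair_term s u v c m) summable_on (UNIV - {0})"
proof -
  define C where "C = real_of_int c"
  have C: "C > 0" using c by (simp add: C_def)
  define a where "a d = pi * ((C * u + of_int d)\<^sup>2 + C\<^sup>2 * v\<^sup>2) / v" for d :: int
  have a: "a d > 0" for d unfolding a_def using C v by (intro divide_pos_pos mult_pos_pos add_nonneg_pos) auto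
  have a_eq: "a d = pi * (norm (of_int c * Complex u v + of_int d))\<^sup>2 / v" for d
    unfolding norm_lattice_point_sq a_def C_def ..
  define T where "T d x = exp (s * of_real x - of_real (a d * exp x))" for d x
  define ph where "ph m = unit_exp (of_int m * of_real (C * u)) * of_real (sqrt v)" for m :: int
  \<comment> \<open>The exponent \<open>z\<close> is a parameter because it is taken to be s for the
    values and Re s for the norms.\<close>
  define V where "V z m x = exp ((z - 1 / 2) * of_real x - of_real (pi * v * (C\<^sup>2 * exp x + (of_int m)\<^sup>2 * exp (- x))))"
    for z :: complex and m :: int and x :: real
  define U where "U m x = ph m * V s m x" for m x
  define pre where "pre x = exp (s * of_real x - of_real (pi * C\<^sup>2 * v * exp x))" for x
  define \<Theta> where "\<Theta> x = pre x * (\<Sum>\<^sub>\<infinity>d::int. exp (- (of_real (pi * (exp x / v)) * (of_real (C * u) + of_int d)\<^sup>2)))" for x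
  have T_has: "((\<lambda>d. T d x) has_sum \<Theta> x) UNIV" for x
  proof -
    have "((\<lambda>d. pre x * exp (- (of_real (pi * (exp x / v)) * (of_real (C * u) + of_int d)\<^sup>2))) has_sum \<Theta> x) UNIV"
      unfolding \<Theta>_def using v by (intro has_sum_cmult_right theta_has_sum) auto
    also have "(\<lambda>d. pre x * exp (- (of_real (pi * (exp x / v)) * (of_real (C * u) + of_int d)\<^sup>2))) = (\<lambda>d. T d x)"
    proof
      fix d :: int
      \<comment> \<open>|c tau + d|^2 = (c u + d)^2 + c^2 v^2 separates a Gaussian in d from a
        factor that is independent of d.\<close>
      have "a d * exp x = pi * C\<^sup>2 * v * exp x + pi * (exp x / v) * (C * u + of_int d)\<^sup>2"
        using v by (simp add: a_def field_simps power2_eq_square)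
      hence "T d x = exp (s * of_real x - of_real (pi * C\<^sup>2 * v * exp x) + - of_real (pi * (exp x / v) * (C * u + of_int d)\<^sup>2))"
        unfolding T_def by (simp only: of_real_add diff_add_eq_diff_diff_swap) (simp add: algebra_simps)
      also have "\<dots> = pre x * exp (- of_real (pi * (exp x / v) * (C * u + of_int d)\<^sup>2))"
        unfolding pre_def by (rule exp_add)
      finally show "pre x * exp (- (of_real (pi * (exp x / v)) * (of_real (C * u) + of_int d)\<^sup>2)) = T d x"
        by simp
    qed
    finally show ?thesis .
  qed
  have U_has: "((\<lambda>m. U m x) has_sum \<Theta> x) UNIV" for x
  proof -
    define t where "t = exp x / v"
    have t: "t > 0" using v by (simp add: t_def)
    have "((\<lambda>m::int. pre x * (of_real (exp (- (pi * (of_int m)\<^sup>2 / t)) / sqrt t) * unit_exp (of_int m * of_real (C * u)))) has_sum \<Theta> x) UNIV"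
      unfolding \<Theta>_def t_def[symmetric] by (intro has_sum_cmult_right theta_transformation[OF t])
    also have "(\<lambda>m::int. pre x * (of_real (exp (- (pi * (of_int m)\<^sup>2 / t)) / sqrt t) * unit_exp (of_int m * of_real (C * u)))) = (\<lambda>m. U m x)"
    proof
      fix m :: int
      \<comment> \<open>The factor 1/sqrt t lowers the exponent from s to s - 1/2, which is how the
        order of the Bessel function arises.\<close>
      have "1 / sqrt t = sqrt v * exp (- x / 2)"
        using v by (simp add: t_def sqrt_exp real_sqrt_divide exp_minus field_simps)
      moreover have "pi * (of_int m)\<^sup>2 / t = pi * v * ((of_int m)\<^sup>2 * exp (- x))"
        by (simp add: t_def exp_minus field_simps)
      ultimately have "exp (- (pi * (of_int m)\<^sup>2 / t)) * (1 / sqrt t) =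
          exp (- (pi * v * ((of_int m)\<^sup>2 * exp (- x)))) * (sqrt v * exp (- x / 2))"
        by (simp only:)
      hence "exp (- (pi * (of_int m)\<^sup>2 / t)) / sqrt t = sqrt v * exp (- x / 2 - pi * v * ((of_int m)\<^sup>2 * exp (- x)))"
        unfolding times_divide_eq_right mult_1_right by (simp only: diff_conv_add_uminus exp_add mult_ac)
      hence "complex_of_real (exp (- (pi * (of_int m)\<^sup>2 / t)) / sqrt t) = of_real (sqrt v) * exp (of_real (- x / 2 - pi * v * ((of_int m)\<^sup>2 * exp (- x))))"
        by (simp only: of_real_mult exp_of_real)
      moreover have "V s m x = pre x * exp (of_real (- x / 2 - pi * v * ((of_int m)\<^sup>2 * exp (- x))))"
        unfolding V_def pre_def mult_exp_exp by (rule arg_cong[where f = exp]) (simp add: algebra_simps)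
      ultimately show "pre x * (of_real (exp (- (pi * (of_int m)\<^sup>2 / t)) / sqrt t) * unit_exp (of_int m * of_real (C * u))) = U m x"
        by (simp add: U_def ph_def mult_ac)
    qed
    finally show ?thesis .
  qed
  have T_int: "integrable lborel (T d)" for d
    unfolding T_def using s a by (intro integrable_Gamma_exp) auto
  have T_val: "(\<integral>x. T d x \<partial>lborel) = lattice_term u v s c d" for d
    unfolding T_def lattice_term_def a_eq[symmetric] using s a by (intro Gamma_exp_integral_scaled) auto
  have T_summ: "(\<lambda>d. \<integral>x. norm (T d x) \<partial>lborel) summable_on UNIV"
  proof -
    \<comment> \<open>Up to the constant \<Gamma>(Re s)/|\<Gamma>(s)| the integrated norms are the
      norms of the lattice terms, so summability is inherited from the lattice sum.\<close>
    have G: "Gamma s \<noteq> 0" using s by (subst Gamma_eq_zero_iff) (auto elim!: nonpos_Ints_cases)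
    have "(\<lambda>p. norm (case p of (c, d) \<Rightarrow> lattice_term u v s c d)) summable_on range (\<lambda>d. (c, d))"
      by (rule summable_on_subset[OF lattice_term_abs_summable[OF v s]]) (use c in auto)
    hence "(\<lambda>d. norm (lattice_term u v s c d)) summable_on UNIV"
      by (subst (asm) summable_on_reindex) (auto simp: inj_on_def o_def)
    hence "(\<lambda>d. Gamma (Re s) / norm (Gamma s) * norm (lattice_term u v s c d)) summable_on UNIV"
      by (rule summable_on_cmult_right)
    moreover have "Gamma (Re s) / norm (Gamma s) * norm (lattice_term u v s c d) = (\<integral>x. norm (T d x) \<partial>lborel)" for d
      unfolding T_def using s a[of d] G
      by (subst integral_norm_Gamma_exp) (auto simp: lattice_term_def a_eq[symmetric] norm_mult powr_def)
    ultimately show ?thesis by simp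
  qed
  have V_int: "integrable lborel (V z m)" if "Re z > 1 / 2" for z m
  proof (cases "m = 0")
    case True
    have "integrable lborel (\<lambda>x. exp ((z - 1 / 2) * of_real x - of_real ((pi * v * C\<^sup>2) * exp x)))"
      using that v C by (intro integrable_Gamma_exp) auto
    thus ?thesis using True unfolding V_def by (simp add: mult_ac)
  next
    case False
    hence "integrable lborel (\<lambda>x. exp ((z - 1 / 2) * of_real x - of_real (pi * v * (C\<^sup>2 * exp x + \<bar>of_int m\<bar>\<^sup>2 * exp (- x)))))"
      using v C by (intro integrable_bessel_scaled) auto
    thus ?thesis unfolding V_def by simp
  qed
  have V_val: "(\<integral>x. V z m x \<partial>lborel) = exp ((z - 1 / 2) * of_real (ln (\<bar>of_int m\<bar> / of_int c))) *
       bessel_B (z - 1 / 2) (of_real (2 * pi * \<bar>of_int (c * m)\<bar> * v))" if "m \<noteq> 0" for z m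
  proof -
    have "(\<integral>x. exp ((z - 1 / 2) * of_real x - of_real (pi * v * (C\<^sup>2 * exp x + \<bar>of_int m\<bar>\<^sup>2 * exp (- x)))) \<partial>lborel) =
       exp ((z - 1 / 2) * of_real (ln (\<bar>of_int m\<bar> / C))) * bessel_B (z - 1 / 2) (of_real (2 * pi * (C * \<bar>of_int m\<bar>) * v))"
      using v C that by (intro integral_bessel_scaled) auto
    thus ?thesis unfolding V_def using C by (simp add: C_def abs_mult)
  qed
  have ph: "norm (ph m) = sqrt v" "unit_exp (of_int (c * m) * of_real u) * of_real (sqrt v) = ph m" for m
    using v by (simp_all add: ph_def norm_mult norm_unit_exp C_def mult_ac)
  have U_int: "integrable lborel (U m)" for m
    unfolding U_def using V_int[of s m] s by (intro integrable_mult_right) auto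
  have U_val: "(\<integral>x. U m x \<partial>lborel) = pair_term s u v c m" if "m \<noteq> 0" for m
    unfolding U_def Bochner_Integration.integral_mult_right_zero V_val[OF that] pair_term_def ph(2)[symmetric]
    by (simp only: mult_ac)
  have U_0: "(\<integral>x. U 0 x \<partial>lborel) = of_real (sqrt v) * (Gamma (s - 1 / 2) * exp (- ((s - 1 / 2) * of_real (ln (pi * v * (of_int c)\<^sup>2)))))"
  proof -
    have "(\<integral>x. exp ((s - 1 / 2) * of_real x - of_real ((pi * v * C\<^sup>2) * exp x)) \<partial>lborel) =
        Gamma (s - 1 / 2) * exp (- ((s - 1 / 2) * of_real (ln (pi * v * C\<^sup>2))))"
      using s v C by (intro Gamma_exp_integral_scaled) auto
    hence "(\<integral>x. V s 0 x \<partial>lborel) = Gamma (s - 1 / 2) * exp (- ((s - 1 / 2) * of_real (ln (pi * v * C\<^sup>2))))"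
      unfolding V_def by (simp add: mult_ac)
    moreover have "ph 0 = of_real (sqrt v)" by (simp add: ph_def unit_exp_def)
    ultimately show ?thesis unfolding U_def Bochner_Integration.integral_mult_right_zero C_def by simp
  qed
  have pair_abs: "(\<lambda>m. norm (pair_term z u v c m)) summable_on (UNIV - {0})" for z
  proof -
    have "(\<lambda>p. norm (case p of (c, m) \<Rightarrow> pair_term z u v c m)) summable_on (\<lambda>m. (c, m)) ` (UNIV - {0})"
      by (rule summable_on_subset[OF pair_term_abs_summable[OF v]]) (use c in auto)
    thus ?thesis by (subst (asm) summable_on_reindex) (auto simp: inj_on_def o_def)
  qed
  \<comment> \<open>Replacing s by Re s removes the oscillation: the integrated norm is itself a
    Fourier term, at the point Re s, whose absolute summability is known.\<close>
  have U_norm: "(\<integral>x. norm (U m x) \<partial>lborel) = norm (pair_term (of_real (Re s)) u v c m)" if m: "m \<noteq> 0" for m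
  proof -
    have "complex_of_real (\<integral>x. norm (V s m x) \<partial>lborel) = (\<integral>x. V (of_real (Re s)) m x \<partial>lborel)"
      unfolding integral_complex_of_real[symmetric]
      by (intro Bochner_Integration.integral_cong) (simp_all add: V_def flip: exp_of_real)
    hence "norm (complex_of_real (\<integral>x. norm (V s m x) \<partial>lborel)) = norm (\<integral>x. V (of_real (Re s)) m x \<partial>lborel)"
      by (rule arg_cong)
    moreover have "(\<integral>x. norm (V s m x) \<partial>lborel) \<ge> 0" by (intro Bochner_Integration.integral_nonneg) auto
    ultimately have "(\<integral>x. norm (V s m x) \<partial>lborel) = norm (\<integral>x. V (of_real (Re s)) m x \<partial>lborel)"
      by simp
    hence "(\<integral>x. norm (U m x) \<partial>lborel) = sqrt v * norm (\<integral>x. V (of_real (Re s)) m x \<partial>lborel)"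
      by (simp add: U_def norm_mult ph)
    also have "\<dots> = norm (pair_term (of_real (Re s)) u v c m)"
      using v unfolding V_val[OF m] pair_term_def norm_mult norm_unit_exp by simp
    finally show ?thesis .
  qed
  have "(\<lambda>m. \<integral>x. norm (U m x) \<partial>lborel) summable_on (UNIV - {0})"
    by (rule summable_on_cong[THEN iffD1, OF _ pair_abs[of "of_real (Re s)"]]) (simp add: U_norm)
  hence "(\<lambda>m. \<integral>x. norm (U m x) \<partial>lborel) summable_on insert 0 (UNIV - {0})"
    by (simp only: summable_on_insert_iff)
  hence U_summ: "(\<lambda>m. \<integral>x. norm (U m x) \<partial>lborel) summable_on UNIV" by simp
  have "((\<lambda>m. \<integral>x. U m x \<partial>lborel) has_sum (\<integral>x. \<Theta> x \<partial>lborel)) UNIV"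
    using U_int U_summ U_has by (intro has_sum_integral_swap) auto
  moreover have pair_summ: "(\<lambda>m. pair_term s u v c m) summable_on (UNIV - {0})"
    by (rule abs_summable_summable[OF pair_abs])
  have "((\<lambda>m. \<integral>x. U m x \<partial>lborel) has_sum (\<Sum>\<^sub>\<infinity>m\<in>UNIV - {0}. pair_term s u v c m)) (UNIV - {0})"
    by (rule has_sum_cong[THEN iffD1, OF _ has_sum_infsum[OF pair_summ]]) (simp add: U_val)
  hence "((\<lambda>m. \<integral>x. U m x \<partial>lborel) has_sum ((\<integral>x. U 0 x \<partial>lborel) + (\<Sum>\<^sub>\<infinity>m\<in>UNIV - {0}. pair_term s u v c m))) (insert 0 (UNIV - {0}))"
    by (intro has_sum_insert) auto
  hence "((\<lambda>m. \<integral>x. U m x \<partial>lborel) has_sum ((\<integral>x. U 0 x \<partial>lborel) + (\<Sum>\<^sub>\<infinity>m\<in>UNIV - {0}. pair_term s u v c m))) UNIV"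
    by simp
  ultimately have "(\<integral>x. \<Theta> x \<partial>lborel) = (\<integral>x. U 0 x \<partial>lborel) + (\<Sum>\<^sub>\<infinity>m\<in>UNIV - {0}. pair_term s u v c m)"
    by (rule has_sum_unique)
  moreover have "((\<lambda>d. \<integral>x. T d x \<partial>lborel) has_sum (\<integral>x. \<Theta> x \<partial>lborel)) UNIV"
    using T_int T_summ T_has by (intro has_sum_integral_swap) auto
  ultimately show "((\<lambda>d. lattice_term u v s c d) has_sum
            (of_real (sqrt v) * (Gamma (s - 1 / 2) * exp (- ((s - 1 / 2) * of_real (ln (pi * v * (of_int c)\<^sup>2)))))
               + (\<Sum>\<^sub>\<infinity>m\<in>UNIV - {0}. pair_term s u v c m))) UNIV"
    unfolding T_val U_0 by simp
  show "(\<lambda>m. pair_term s u v c m) summable_on (UNIV - {0})" by (rule pair_summ)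
qed

text \<open>The rows \<open>c = 0\<close> give \<open>v\<^sup>s\<close>, the terms \<open>m = 0\<close> of the Poisson-transformed rows \<open>c \<noteq> 0\<close>
  give \<open>v\<^sup>1\<^sup>-\<^sup>s\<close>, and the terms \<open>m \<noteq> 0\<close> give the non-constant coefficients.\<close>

theorem eisenstein_E_fourier:
  assumes v: "v > 0" and s: "Re s > 1"
  shows "of_real pi powr (- s) * Gamma s * eisenstein_E (Complex u v) s =
     exp (s * of_real (ln v)) * completed_zeta s + exp ((1 - s) * of_real (ln v)) * completed_zeta (1 - s)
     + (\<Sum>\<^sub>\<infinity>n\<in>UNIV - {0}. eis_coeff s (of_real v) n * unit_exp (of_int n * of_real u))"
proof -
  define L where "L p = (case p of (c, d) \<Rightarrow> lattice_term u v s c d)" for p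
  define N where "N = (\<Sum>\<^sub>\<infinity>n\<in>UNIV - {0}. eis_coeff s (of_real v) n * unit_exp (of_int n * of_real u))"
  define X0 where "X0 = exp (s * of_real (ln v)) * completed_zeta s"
  define X1 where "X1 = exp ((1 - s) * of_real (ln v)) * completed_zeta (1 - s)"
  define m0 where "m0 c = of_real (sqrt v) * (Gamma (s - 1 / 2) * exp (- ((s - 1 / 2) * of_real (ln (pi * v * (of_int c)\<^sup>2)))))" for c :: int
  define p where "p c = (\<Sum>\<^sub>\<infinity>m\<in>UNIV - {0}. pair_term s u v c m)" for c
  have L_summ: "L summable_on A" if "A \<subseteq> UNIV - {(0, 0)}" for A
    using summable_on_subset[OF abs_summable_summable[OF lattice_term_abs_summable[OF v s, of u]] that]
    by (simp add: L_def[abs_def])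
  have c0: "(L has_sum 2 * X0) ((\<lambda>d. (0, d)) ` (UNIV - {0}))"
  proof (subst has_sum_reindex)
    have "((\<lambda>d. L (0, d)) has_sum 2 * X0) (UNIV - {0})"
    proof (rule has_sum_nonzero_int_even(2))
      show "L (0, - d) = L (0, d)" for d
        using lattice_term_uminus[of u v s 0 d] by (simp add: L_def)
      have "((\<lambda>n. exp (s * of_real (ln v)) * (Gamma s * exp (- (s * of_real (ln (pi * (real (Suc n))\<^sup>2)))))) has_sum X0) UNIV"
        unfolding X0_def using s by (intro has_sum_cmult_right completed_zeta_has_sum) auto
      also have "(\<lambda>n. exp (s * of_real (ln v)) * (Gamma s * exp (- (s * of_real (ln (pi * (real (Suc n))\<^sup>2)))))) = (\<lambda>n. L (0, int (Suc n)))"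
      proof
        fix n :: nat
        have "ln (pi * (real (Suc n))\<^sup>2 / v) = ln (pi * (real (Suc n))\<^sup>2) - ln v"
          using v by (subst ln_div) auto
        hence "L (0, int (Suc n)) = Gamma s * exp (- (s * of_real (ln (pi * (real (Suc n))\<^sup>2) - ln v)))"
          by (simp add: L_def lattice_term_def del: of_nat_Suc of_real_diff)
        also have "- (s * complex_of_real (ln (pi * (real (Suc n))\<^sup>2) - ln v)) = s * of_real (ln v) + - (s * of_real (ln (pi * (real (Suc n))\<^sup>2)))"
          by (simp add: right_diff_distrib)
        finally show "exp (s * of_real (ln v)) * (Gamma s * exp (- (s * of_real (ln (pi * (real (Suc n))\<^sup>2))))) = L (0, int (Suc n))"
          by (simp only: exp_add mult_ac)
      qed
      finally show "((\<lambda>n. L (0, int (Suc n))) has_sum X0) UNIV" .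
    qed
    thus "((L \<circ> (\<lambda>d. (0, d))) has_sum 2 * X0) (UNIV - {0})" by (simp add: o_def)
  qed (auto simp: inj_on_def)
  have "(L has_sum infsum L ({1..} \<times> UNIV)) ({1..} \<times> UNIV)"
    by (intro has_sum_infsum L_summ) auto
  hence "((\<lambda>c. m0 c + p c) has_sum infsum L ({1..} \<times> UNIV)) {1..}"
    by (rule has_sum_SigmaD) (use lattice_row_has_sum(1)[OF v s] in \<open>auto simp: L_def m0_def p_def\<close>)
  moreover have "((\<lambda>c. m0 c + p c) has_sum (X1 + N)) {1..}"
  proof (rule has_sum_add)
    show "(m0 has_sum X1) {1..}"
    proof (rule has_sum_nonzero_int_even(1))
      show "m0 (- c) = m0 c" for c by (simp add: m0_def)
      have "((\<lambda>n. exp ((1 - s) * of_real (ln v)) * (Gamma (s - 1 / 2) * exp (- ((s - 1 / 2) * of_real (ln (pi * (real (Suc n))\<^sup>2)))))) has_sum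
             (exp ((1 - s) * of_real (ln v)) * completed_zeta (s - 1 / 2))) UNIV"
        using s by (intro has_sum_cmult_right completed_zeta_has_sum) auto
      also have "(\<lambda>n. exp ((1 - s) * of_real (ln v)) * (Gamma (s - 1 / 2) * exp (- ((s - 1 / 2) * of_real (ln (pi * (real (Suc n))\<^sup>2)))))) =
          (\<lambda>n. m0 (int (Suc n)))"
      proof
        fix n :: nat
        have sq: "complex_of_real (sqrt v) = exp (1 / 2 * of_real (ln v))"
        proof -
          have "exp (1 / 2 * ln v) = sqrt v"
            using v powr_half_sqrt[of v] by (simp add: powr_def)
          hence "complex_of_real (sqrt v) = of_real (exp (1 / 2 * ln v))" by simp
          thus ?thesis by (simp flip: exp_of_real)
        qed
        have "ln (pi * v * (real (Suc n))\<^sup>2) = ln (pi * (real (Suc n))\<^sup>2) + ln v"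
        proof -
          have "pi * v * (real (Suc n))\<^sup>2 = (pi * (real (Suc n))\<^sup>2) * v" by simp
          thus ?thesis using v by (simp only:) (subst ln_mult, auto)
        qed
        hence "m0 (int (Suc n)) = exp (1 / 2 * of_real (ln v)) * (Gamma (s - 1 / 2) *
             exp (- ((s - 1 / 2) * (of_real (ln (pi * (real (Suc n))\<^sup>2)) + of_real (ln v)))))"
          unfolding m0_def sq by simp
        also have "\<dots> = Gamma (s - 1 / 2) * exp (1 / 2 * of_real (ln v) - (s - 1 / 2) * (of_real (ln (pi * (real (Suc n))\<^sup>2)) + of_real (ln v)))"
          by (simp only: exp_diff exp_minus divide_inverse mult_ac)
        \<comment> \<open>Collecting the powers of v: sqrt v * v^(-(s - 1/2)) = v^(1 - s).\<close>
        also have "1 / 2 * of_real (ln v) - (s - 1 / 2) * (of_real (ln (pi * (real (Suc n))\<^sup>2)) + of_real (ln v)) =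
            (1 - s) * of_real (ln v) - (s - 1 / 2) * of_real (ln (pi * (real (Suc n))\<^sup>2))"
          by (simp only: algebra_simps) simp
        also have "Gamma (s - 1 / 2) * exp \<dots> = exp ((1 - s) * of_real (ln v)) * (Gamma (s - 1 / 2) * exp (- ((s - 1 / 2) * of_real (ln (pi * (real (Suc n))\<^sup>2)))))"
          by (simp only: exp_diff exp_minus divide_inverse mult_ac)
        finally show "exp ((1 - s) * of_real (ln v)) * (Gamma (s - 1 / 2) * exp (- ((s - 1 / 2) * of_real (ln (pi * (real (Suc n))\<^sup>2))))) = m0 (int (Suc n))" ..
      qed
      \<comment> \<open>The functional equation puts the second constant term into the form
        symmetric under s -> 1 - s.\<close>
      also have "completed_zeta (s - 1 / 2) = completed_zeta (1 - s)"
        using completed_zeta_reflect[of "s - 1 / 2"] by (simp add: algebra_simps)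
      finally show "((\<lambda>n. m0 (int (Suc n))) has_sum X1) UNIV" unfolding X1_def .
    qed
    show "(p has_sum N) {1..}"
      by (rule has_sum_SigmaD[OF pair_term_has_sum[OF v, of s u, folded N_def]])
         (use lattice_row_has_sum(2)[OF v s] in \<open>auto simp: p_def\<close>)
  qed
  ultimately have pos_val: "infsum L ({1..} \<times> UNIV) = X1 + N" by (rule has_sum_unique)
  have pos: "(L has_sum (X1 + N)) ({1..} \<times> UNIV)"
    unfolding pos_val[symmetric] by (intro has_sum_infsum L_summ) auto
  \<comment> \<open>The rows c < 0 repeat the rows c > 0 under (c, d) -> (-c, -d); the factor 1/2 in
    \<open>eisenstein_E\<close> undoes the doubling.\<close>
  have neg: "(L has_sum (X1 + N)) ({..-1} \<times> UNIV)"
  proof -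
    have "bij_betw (\<lambda>(c, d). (- c, - d)) ({1..} \<times> UNIV) ({..-1::int} \<times> (UNIV :: int set))"
      by (rule bij_betwI[where g = "\<lambda>(c, d). (- c, - d)"]) auto
    from has_sum_reindex_bij_betw[OF this, of L "X1 + N"]
    have "(L has_sum (X1 + N)) ({..-1} \<times> UNIV) \<longleftrightarrow> ((\<lambda>p. L (case p of (c, d) \<Rightarrow> (- c, - d))) has_sum (X1 + N)) ({1..} \<times> UNIV)"
      by simp
    also have "(\<lambda>p. L (case p of (c, d) \<Rightarrow> (- c, - d))) = L"
      by (auto simp: fun_eq_iff L_def lattice_term_uminus)
    finally show ?thesis using pos by simp
  qed
  have "(L has_sum (2 * X0 + ((X1 + N) + (X1 + N)))) ((\<lambda>d. (0, d)) ` (UNIV - {0}) \<union> ({1..} \<times> UNIV \<union> {..-1} \<times> UNIV))"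
    by (intro has_sum_Un_disjoint c0 pos neg) auto
  also have "(\<lambda>d. (0, d)) ` (UNIV - {0}) \<union> ({1..} \<times> UNIV \<union> {..-1} \<times> UNIV) = UNIV - {(0 :: int, 0 :: int)}"
    by (auto simp: image_def)
  finally have total: "infsum L (UNIV - {(0, 0)}) = 2 * X0 + ((X1 + N) + (X1 + N))" by (rule infsumI)
  have "of_real pi powr (- s) * Gamma s * eisenstein_E (Complex u v) s =
     1 / 2 * (\<Sum>\<^sub>\<infinity>p\<in>UNIV - {(0, 0)}. of_real pi powr (- s) * Gamma s * (case p of (c, d) \<Rightarrow>
       of_real (Im (Complex u v)) powr s / of_real (cmod (of_int c * Complex u v + of_int d)) powr (2 * s)))"
    unfolding eisenstein_E_def infsum_cmult_right' by simp
  also have "(\<Sum>\<^sub>\<infinity>p\<in>UNIV - {(0, 0)}. of_real pi powr (- s) * Gamma s * (case p of (c, d) \<Rightarrow>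
       of_real (Im (Complex u v)) powr s / of_real (cmod (of_int c * Complex u v + of_int d)) powr (2 * s))) = infsum L (UNIV - {(0, 0)})"
  proof (rule infsum_cong)
    fix p :: "int \<times> int" assume "p \<in> UNIV - {(0, 0)}"
    moreover obtain c d where "p = (c, d)" by (cases p)
    ultimately show "of_real pi powr (- s) * Gamma s * (case p of (c, d) \<Rightarrow>
       of_real (Im (Complex u v)) powr s / of_real (cmod (of_int c * Complex u v + of_int d)) powr (2 * s)) = L p"
      using lattice_term_eq[OF v, of c d s u] by (simp add: L_def)
  qed
  also note total
  also have "1 / 2 * (2 * X0 + ((X1 + N) + (X1 + N))) = X0 + X1 + N"
    by (simp add: field_simps)
  finally show ?thesis unfolding X0_def X1_def N_def .
qed

subsection \<open>The series of weight 2 near s = 1\<close>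

lemma sigma_star_holomorphic [holomorphic_intros]:
  "f holomorphic_on A \<Longrightarrow> (\<lambda>s. sigma_star (f s) n) holomorphic_on A"
  unfolding sigma_star_def by (intro holomorphic_intros)

lemma bessel_B_holomorphic_order:
  assumes "f holomorphic_on A" "Re y > 0"
  shows "(\<lambda>s. bessel_B (f s) y) holomorphic_on A"
proof -
  have "(\<lambda>\<nu>. bessel_B \<nu> y) holomorphic_on UNIV"
    unfolding holomorphic_on_def field_differentiable_def
    using has_field_derivative_bessel_order[OF assms(2)] by auto
  from holomorphic_on_compose_gen[OF assms(1) this] show ?thesis by (simp add: o_def)
qed

lemma bessel_B_holomorphic_arg:
  assumes "f holomorphic_on A" "\<And>z. z \<in> A \<Longrightarrow> Re (f z) > 0"
  shows "(\<lambda>z. bessel_B \<nu> (f z)) holomorphic_on A"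
proof -
  have "(\<lambda>y. bessel_B \<nu> y) holomorphic_on {y. Re y > 0}"
    unfolding holomorphic_on_def field_differentiable_def
    using has_field_derivative_bessel_B_arg has_field_derivative_at_within by blast
  from holomorphic_on_compose_gen[OF assms(1) this] assms(2) show ?thesis by (auto simp: o_def)
qed

section \<open>The non-constant part as a function of u, v and s\<close>

definition eis_series :: "complex \<Rightarrow> complex \<Rightarrow> complex \<Rightarrow> complex" where
  "eis_series u v s = (\<Sum>\<^sub>\<infinity>n\<in>UNIV - {0}. eis_coeff s v n * unit_exp (of_int n * u))"

lemma eis_term_bound:
  fixes K :: nat and a b :: real
  assumes a: "a > 0"
  obtains M where "M summable_on (UNIV - {0})"
    "\<And>n s v u. n \<noteq> 0 \<Longrightarrow> \<bar>Re s - 1 / 2\<bar> \<le> real K \<Longrightarrow> Re v \<ge> a \<Longrightarrow> norm v \<le> b \<Longrightarrow> \<bar>Im u\<bar> \<le> a / 4 \<Longrightarrow>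
       norm (eis_coeff s v n * unit_exp (of_int n * u)) \<le> M n"
proof -
  obtain M where M: "M summable_on (UNIV - {0})"
    "\<And>n s v u. n \<noteq> 0 \<Longrightarrow> \<bar>Re s - 1 / 2\<bar> \<le> real K \<Longrightarrow> Re v \<ge> a \<Longrightarrow> norm v \<le> b \<Longrightarrow> \<bar>Im u\<bar> \<le> a / 4 \<Longrightarrow>
       (1 + \<bar>real_of_int n\<bar>) ^ (3 * K + 1) * (sqrt (norm v) * norm (bessel_B (s - 1 / 2) (of_real (2 * pi * \<bar>of_int n\<bar>) * v)) *
          norm (unit_exp (of_int n * u))) \<le> M n"
    using eis_coeff_bound[OF a, of K b] by blast
  show ?thesis
    by (rule that[OF M(1)]) (meson M(2) norm_eis_coeff_le order_trans)
qed

lemma eis_series_has_sum: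
  assumes v: "Re v > 0" and u: "\<bar>Im u\<bar> \<le> Re v / 4"
  shows "((\<lambda>n. eis_coeff s v n * unit_exp (of_int n * u)) has_sum eis_series u v s) (UNIV - {0})"
proof -
  obtain K where K: "\<bar>Re s - 1 / 2\<bar> \<le> real K" using real_arch_simple by blast
  obtain M where M: "M summable_on (UNIV - {0})"
    "\<And>n s' v' u'. n \<noteq> 0 \<Longrightarrow> \<bar>Re s' - 1 / 2\<bar> \<le> real K \<Longrightarrow> Re v' \<ge> Re v \<Longrightarrow> norm v' \<le> norm v \<Longrightarrow> \<bar>Im u'\<bar> \<le> Re v / 4 \<Longrightarrow>
       norm (eis_coeff s' v' n * unit_exp (of_int n * u')) \<le> M n"
    using eis_term_bound[OF v, of K "norm v"] by blast
  show ?thesis unfolding eis_series_def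
    by (rule has_sum_infsum, rule summable_on_norm_comparison[OF M(1)]) (use M(2) K u in auto)
qed

lemma eis_term_holomorphic:
  shows "Re v > 0 \<Longrightarrow> n \<noteq> 0 \<Longrightarrow> (\<lambda>s. eis_coeff s v n * w) holomorphic_on A"
    and "(\<And>v. v \<in> A \<Longrightarrow> Re v > 0) \<Longrightarrow> n \<noteq> 0 \<Longrightarrow> (\<lambda>v. eis_coeff s v n * w) holomorphic_on A"
proof -
  show "(\<lambda>s. eis_coeff s v n * w) holomorphic_on A" if "Re v > 0" "n \<noteq> 0"
    unfolding eis_coeff_def using that
    by (intro holomorphic_intros bessel_B_holomorphic_order) auto
  show "(\<lambda>v. eis_coeff s v n * w) holomorphic_on A" if *: "\<And>v. v \<in> A \<Longrightarrow> Re v > 0" "n \<noteq> 0"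
  proof -
    have "v \<notin> \<real>\<^sub>\<le>\<^sub>0" if "v \<in> A" for v
      using *(1)[OF that] by (auto simp: complex_nonpos_Reals_iff)
    thus ?thesis
      unfolding eis_coeff_def using *
      by (intro holomorphic_intros bessel_B_holomorphic_arg) auto
  qed
qed

text \<open>Holomorphy is local, so it suffices to have a majorant on each disc about 0; there Re s
  is bounded and one exponent \<open>K\<close> serves.\<close>

lemma eis_series_holomorphic:
  assumes v: "Re v > 0" and u: "\<bar>Im u\<bar> \<le> Re v / 4"
  shows "(\<lambda>s. eis_series u v s) holomorphic_on A"
proof -
  have "(\<lambda>s. eis_series u v s) analytic_on {s0}" for s0
  proof -
    obtain K :: nat where K: "norm s0 + 2 \<le> real K" using real_arch_simple by blast
    obtain M where M: "M summable_on (UNIV - {0})"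
      "\<And>n s' v' u'. n \<noteq> 0 \<Longrightarrow> \<bar>Re s' - 1 / 2\<bar> \<le> real K \<Longrightarrow> Re v' \<ge> Re v \<Longrightarrow> norm v' \<le> norm v \<Longrightarrow> \<bar>Im u'\<bar> \<le> Re v / 4 \<Longrightarrow>
         norm (eis_coeff s' v' n * unit_exp (of_int n * u')) \<le> M n"
      using eis_term_bound[OF v, of K "norm v"] by blast
    have "(\<lambda>s. eis_series u v s) holomorphic_on ball 0 (norm s0 + 1)"
    proof (rule holomorphic_on_has_sum[where M = M and A = "UNIV - {0}"])
      fix n :: int and s :: complex assume "n \<in> UNIV - {0}" "s \<in> ball 0 (norm s0 + 1)"
      moreover have "\<bar>Re s - 1 / 2\<bar> \<le> norm s + 1 / 2" using abs_Re_le_cmod[of s] by linarith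
      ultimately show "norm (eis_coeff s v n * unit_exp (of_int n * u)) \<le> M n"
        using K u by (intro M(2)) auto
    qed (use M(1) v u eis_series_has_sum eis_term_holomorphic(1) in auto)
    thus ?thesis by (auto simp: analytic_at intro!: exI[of _ "ball 0 (norm s0 + 1)"])
  qed
  thus ?thesis using analytic_imp_holomorphic analytic_on_analytic_at analytic_on_subset by blast
qed

text \<open>The disc of radius v/2 about v lies in Re z >= v/2, |z| <= 2 v, where a single majorant
  applies.\<close>

lemma eis_series_deriv_v:
  assumes v: "v > 0"
  shows "((\<lambda>v. eis_series (of_real u) v s) has_field_derivative deriv (\<lambda>v. eis_series (of_real u) v s) (of_real v)) (at (of_real v))"
    and "((\<lambda>n. deriv (\<lambda>v. eis_coeff s v n * unit_exp (of_int n * of_real u)) (of_real v)) has_sum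
           deriv (\<lambda>v. eis_series (of_real u) v s) (of_real v)) (UNIV - {0})"
proof -
  define B where "B = ball (complex_of_real v) (v / 2)"
  obtain K where K: "\<bar>Re s - 1 / 2\<bar> \<le> real K" using real_arch_simple by blast
  have v2: "v / 2 > 0" using v by simp
  obtain M where M: "M summable_on (UNIV - {0})"
    "\<And>n s' v' u'. n \<noteq> 0 \<Longrightarrow> \<bar>Re s' - 1 / 2\<bar> \<le> real K \<Longrightarrow> Re v' \<ge> v / 2 \<Longrightarrow> norm v' \<le> 2 * v \<Longrightarrow> \<bar>Im u'\<bar> \<le> v / 2 / 4 \<Longrightarrow>
       norm (eis_coeff s' v' n * unit_exp (of_int n * u')) \<le> M n"
    using eis_term_bound[OF v2, of K "2 * v"] by blast
  have B: "Re z \<ge> v / 2" "norm z \<le> 2 * v" if "z \<in> B" for z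
  proof -
    have d: "norm (of_real v - z) < v / 2" using that by (simp add: B_def dist_norm)
    have "\<bar>Re (of_real v - z)\<bar> < v / 2" using abs_Re_le_cmod d by (rule le_less_trans)
    hence "\<bar>v - Re z\<bar> < v / 2" by simp
    thus "Re z \<ge> v / 2" by linarith
    have "norm z \<le> norm (of_real v - z) + norm (complex_of_real v)"
      by (metis norm_minus_commute norm_triangle_sub add.commute)
    thus "norm z \<le> 2 * v" using d v by simp
  qed
  have mem: "of_real v \<in> B" using v by (simp add: B_def)
  have open_B: "open B" by (simp add: B_def)
  have hol: "(\<lambda>v. eis_coeff s v n * unit_exp (of_int n * of_real u)) holomorphic_on B" if "n \<in> UNIV - {0}" for n
    using that B(1) v by (intro eis_term_holomorphic(2)) force+
  have bnd: "norm (eis_coeff s z n * unit_exp (of_int n * of_real u)) \<le> M n" if "n \<in> UNIV - {0}" "z \<in> B" for n z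
    using that B[of z] K v by (intro M(2)) auto
  have sums: "((\<lambda>n. eis_coeff s z n * unit_exp (of_int n * of_real u)) has_sum eis_series (of_real u) z s) (UNIV - {0})" if "z \<in> B" for z
    using B(1)[OF that] v by (intro eis_series_has_sum) auto
  have "(\<lambda>v. eis_series (of_real u) v s) holomorphic_on B"
    by (rule holomorphic_on_has_sum[OF open_B hol bnd M(1) sums])
  thus "((\<lambda>v. eis_series (of_real u) v s) has_field_derivative deriv (\<lambda>v. eis_series (of_real u) v s) (of_real v)) (at (of_real v))"
    using open_B mem by (rule holomorphic_derivI)
  show "((\<lambda>n. deriv (\<lambda>v. eis_coeff s v n * unit_exp (of_int n * of_real u)) (of_real v)) has_sum
           deriv (\<lambda>v. eis_series (of_real u) v s) (of_real v)) (UNIV - {0})"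
    by (rule has_sum_deriv[OF open_B hol bnd M(1) sums mem])
qed

text \<open>The radius v/4 keeps the disc about u inside the strip where the Bessel decay dominates
  the exponential.\<close>

lemma eis_series_deriv_u:
  assumes v: "v > 0"
  shows "((\<lambda>u. eis_series u (of_real v) s) has_field_derivative deriv (\<lambda>u. eis_series u (of_real v) s) (of_real u)) (at (of_real u))"
    and "((\<lambda>n. deriv (\<lambda>u. eis_coeff s (of_real v) n * unit_exp (of_int n * u)) (of_real u)) has_sum
           deriv (\<lambda>u. eis_series u (of_real v) s) (of_real u)) (UNIV - {0})"
proof -
  define B where "B = ball (complex_of_real u) (v / 4)"
  obtain K where K: "\<bar>Re s - 1 / 2\<bar> \<le> real K" using real_arch_simple by blast
  obtain M where M: "M summable_on (UNIV - {0})"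
    "\<And>n s' v' u'. n \<noteq> 0 \<Longrightarrow> \<bar>Re s' - 1 / 2\<bar> \<le> real K \<Longrightarrow> Re v' \<ge> v \<Longrightarrow> norm v' \<le> v \<Longrightarrow> \<bar>Im u'\<bar> \<le> v / 4 \<Longrightarrow>
       norm (eis_coeff s' v' n * unit_exp (of_int n * u')) \<le> M n"
    using eis_term_bound[OF v, of K v] by blast
  have B: "\<bar>Im z\<bar> \<le> v / 4" if "z \<in> B" for z
  proof -
    have d: "norm (of_real u - z) < v / 4" using that by (simp add: B_def dist_norm)
    have "\<bar>Im (of_real u - z)\<bar> < v / 4" using abs_Im_le_cmod d by (rule le_less_trans)
    thus ?thesis by simp
  qed
  have mem: "of_real u \<in> B" using v by (simp add: B_def)
  have open_B: "open B" by (simp add: B_def)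
  have hol: "(\<lambda>u. eis_coeff s (of_real v) n * unit_exp (of_int n * u)) holomorphic_on B" for n
    by (intro holomorphic_intros)
  have bnd: "norm (eis_coeff s (of_real v) n * unit_exp (of_int n * z)) \<le> M n" if "n \<in> UNIV - {0}" "z \<in> B" for n z
    using that B[of z] K v by (intro M(2)) auto
  have sums: "((\<lambda>n. eis_coeff s (of_real v) n * unit_exp (of_int n * z)) has_sum eis_series z (of_real v) s) (UNIV - {0})" if "z \<in> B" for z
    using B[OF that] v by (intro eis_series_has_sum) auto
  have "(\<lambda>u. eis_series u (of_real v) s) holomorphic_on B"
    by (rule holomorphic_on_has_sum[OF open_B hol bnd M(1) sums])
  thus "((\<lambda>u. eis_series u (of_real v) s) has_field_derivative deriv (\<lambda>u. eis_series u (of_real v) s) (of_real u)) (at (of_real u))"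
    using open_B mem by (rule holomorphic_derivI)
  show "((\<lambda>n. deriv (\<lambda>u. eis_coeff s (of_real v) n * unit_exp (of_int n * u)) (of_real u)) has_sum
           deriv (\<lambda>u. eis_series u (of_real v) s) (of_real u)) (UNIV - {0})"
    by (rule has_sum_deriv[OF open_B hol bnd M(1) sums mem])
qed

section \<open>Continuation of E* and its expansion near s = 1\<close>

definition eis_const :: "real \<Rightarrow> complex \<Rightarrow> complex" where
  "eis_const v s = exp (s * of_real (ln v)) * completed_zeta s + exp ((1 - s) * of_real (ln v)) * completed_zeta (1 - s)"

lemma eis_series_analytic: "v > 0 \<Longrightarrow> (\<lambda>s. eis_series (of_real u) (of_real v) s) analytic_on A"
  using eis_series_holomorphic[of "of_real v" "of_real u" UNIV]
  by (simp add: analytic_on_open analytic_on_subset[of _ UNIV])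

lemma eis_const_analytic:
  assumes "s \<noteq> 0" "s \<noteq> 1 / 2" "s \<noteq> 1"
  shows "eis_const v analytic_on {s}"
proof -
  have "completed_zeta analytic_on {s}" using assms by (intro completed_zeta_analytic) blast+
  moreover have "(\<lambda>s. completed_zeta (1 - s)) analytic_on {s}"
  proof (rule analytic_on_compose[OF _ completed_zeta_analytic, unfolded o_def])
    have "1 - s \<noteq> 1 / 2" using assms(2) by (simp add: algebra_simps eq_diff_eq)
    thus "1 / 2 \<notin> (\<lambda>s. 1 - s) ` {s}" by auto
    show "0 \<notin> (\<lambda>s. 1 - s) ` {s}" using assms(3) by auto
  qed (auto intro!: analytic_intros)
  ultimately show ?thesis
    unfolding eis_const_def[abs_def] by (intro analytic_intros)
qed

lemma abs_Re_near_1: "s \<in> ball 1 r \<Longrightarrow> \<bar>Re s - 1\<bar> < r"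
  using abs_Re_le_cmod[of "s - 1"] by (simp add: dist_norm norm_minus_commute)

text \<open>The Fourier expansion holds for Re s > 1, and its right-hand side is meromorphic in the
  plane and analytic off 0, 1/2 and 1; \<open>remove_sings\<close> selects the representative that
  the uniqueness of the continuation speaks of.\<close>

lemma eisenstein_E_star_eq:
  assumes v: "v > 0"
  shows "eisenstein_E_star (Complex u v) = remove_sings (\<lambda>s. eis_const v s + eis_series (of_real u) (of_real v) s)"
  unfolding eisenstein_E_star_def
proof (rule meromorphic_continuation_eqI)
  define G where "G s = eis_const v s + eis_series (of_real u) (of_real v) s" for s
  have reflect: "(\<lambda>s. completed_zeta (1 - s)) meromorphic_on UNIV"
    unfolding completed_zeta_def
    by (intro meromorphic_intros analytic_on_imp_meromorphic_on
          analytic_on_compose[OF _ theta_mellin_analytic, unfolded o_def]) (auto intro!: analytic_intros)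
  have "G meromorphic_on UNIV"
    unfolding G_def[abs_def] eis_const_def
    by (intro meromorphic_intros reflect completed_zeta_meromorphic analytic_on_imp_meromorphic_on[OF eis_series_analytic[OF v]])
       (auto intro!: analytic_on_imp_meromorphic_on analytic_intros)
  thus "remove_sings (\<lambda>s. eis_const v s + eis_series (of_real u) (of_real v) s) nicely_meromorphic_on UNIV"
    unfolding G_def by (rule remove_sings_nicely_meromorphic)
  show "open {s. Re s > 1}" by (rule open_halfspace_Re_gt)
  show "{s. Re s > 1} \<noteq> {}" by (auto intro!: exI[of _ 2])
  fix s :: complex assume "s \<in> {s. Re s > 1}"
  hence s: "Re s > 1" by simp
  have "s \<noteq> 0" "s \<noteq> 1 / 2" "s \<noteq> 1" using s by (auto simp: complex_eq_iff)
  hence "G analytic_on {s}"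
    unfolding G_def[abs_def] by (intro analytic_intros eis_const_analytic eis_series_analytic[OF v])
  hence "remove_sings G s = G s" by simp
  also have "\<dots> = of_real pi powr (- s) * Gamma s * eisenstein_E (Complex u v) s"
    using eisenstein_E_fourier[OF v s, of u] by (simp add: G_def eis_const_def eis_series_def)
  finally show "remove_sings (\<lambda>s. eis_const v s + eis_series (of_real u) (of_real v) s) s = 
      of_real pi powr (- s) * Gamma s * eisenstein_E (Complex u v) s"
    unfolding G_def .
qed

text \<open>The radius 1/2 is chosen to exclude 0 and 1/2, so that within the disc only s = 1 is
  exceptional.\<close>

lemma eisenstein_E_star_eq_near_1:
  assumes v: "v > 0" and s: "s \<in> ball 1 (1 / 2) - {1}"
  shows "eisenstein_E_star (Complex u v) s = eis_const v s + eis_series (of_real u) (of_real v) s"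
proof -
  have "s \<noteq> 0" "s \<noteq> 1 / 2" "s \<noteq> 1" using s abs_Re_near_1[of s "1 / 2"] by (auto simp: complex_eq_iff)
  hence "(\<lambda>s. eis_const v s + eis_series (of_real u) (of_real v) s) analytic_on {s}"
    by (intro analytic_intros eis_const_analytic eis_series_analytic[OF v])
  thus ?thesis unfolding eisenstein_E_star_eq[OF v] by simp
qed

section \<open>The Fourier expansion of the weight 2 series\<close>

text \<open>The n-th term of E_2(tau,s): the u-derivative contributes the factor n/2, the
  v-derivative contributes |n|/2 with the order lowered by one, and a multiple of s - 1. At s = 1
  the orders are 1/2 and -1/2, so the first two terms add up for n > 0 and cancel for n < 0.\<close>

definition eis2_term :: "real \<Rightarrow> real \<Rightarrow> complex \<Rightarrow> int \<Rightarrow> complex" where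
  "eis2_term u v s n = sigma_star (s - 1 / 2) n * (of_real (sqrt v) * unit_exp (of_int n * of_real u)) *
     (of_int n / 2 * bessel_B (s - 1 / 2) (of_real (2 * pi * \<bar>of_int n\<bar> * v))
      + of_int \<bar>n\<bar> / 2 * bessel_B (s - 3 / 2) (of_real (2 * pi * \<bar>of_int n\<bar> * v))
      + (s - 1) / of_real (4 * pi * v) * bessel_B (s - 1 / 2) (of_real (2 * pi * \<bar>of_int n\<bar> * v)))"

text \<open>The root contributes 1/(2v) and the Bessel function -(s - 1/2)/v; together they give the
  factor -(s - 1)/v, which vanishes at s = 1.\<close>

lemma has_field_derivative_eis_coeff:
  assumes v: "v > 0" and n: "n \<noteq> 0"
  shows "((\<lambda>v. eis_coeff s v n) has_field_derivative
     sigma_star (s - 1 / 2) n * (of_real (sqrt v) *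
       (- of_real (2 * pi * \<bar>of_int n\<bar>) * bessel_B (s - 3 / 2) (of_real (2 * pi * \<bar>of_int n\<bar> * v))
        - (s - 1) / of_real v * bessel_B (s - 1 / 2) (of_real (2 * pi * \<bar>of_int n\<bar> * v))))) (at (of_real v))"
proof -
  define k where "k = complex_of_real (2 * pi * \<bar>of_int n\<bar>)"
  define y where "y = 2 * pi * \<bar>of_int n\<bar> * v"
  have y: "y > 0" "k * of_real v = of_real y" "k \<noteq> 0" using v n by (simp_all add: y_def k_def)
  define r where "r = complex_of_real (sqrt v)"
  have r: "r \<noteq> 0" "r * r = of_real v" using v by (simp_all add: r_def flip: of_real_mult)
  have sq: "(csqrt has_field_derivative inverse (2 * r)) (at (of_real v))"
    using has_field_derivative_csqrt[of "of_real v"] v by (simp add: r_def)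
  have kd: "((\<lambda>v. k * v) has_field_derivative k) (at (of_real v))"
    by (auto intro!: derivative_eq_intros)
  have B: "((\<lambda>v. bessel_B (s - 1 / 2) (k * v)) has_field_derivative
      (- bessel_B (s - 1 / 2 - 1) (of_real y) - (s - 1 / 2) / of_real y * bessel_B (s - 1 / 2) (of_real y)) * k) (at (of_real v))"
    by (rule DERIV_chain2[OF _ kd]) (use has_field_derivative_bessel_B_arg[of "of_real y" "s - 1 / 2"] y in simp)
  have csq: "csqrt (of_real v) = r" using v by (simp add: r_def)
  have "((\<lambda>v. csqrt v * bessel_B (s - 1 / 2) (k * v)) has_field_derivative
      r * (- k * bessel_B (s - 3 / 2) (of_real y) - (s - 1) / of_real v * bessel_B (s - 1 / 2) (of_real y))) (at (of_real v))"
  proof (rule DERIV_cong[OF DERIV_mult[OF sq B]])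
    have "k / of_real y = 1 / of_real v" using y(3) v unfolding y(2)[symmetric] by simp
    hence e1: "(s - 1 / 2) / of_real y * b * k = (s - 1 / 2) / of_real v * b" for b
      by (metis (no_types, opaque_lifting) mult.commute mult.left_commute mult_1_right times_divide_eq_right times_divide_eq_left)
    have e2: "inverse (2 * r) = r / (2 * of_real v)" unfolding r(2)[symmetric] using r(1) by (simp add: field_simps)
    have e3: "s - 1 / 2 - 1 = s - 3 / 2" by simp
    have vv: "of_real v \<noteq> (0::complex)" using v by simp
    show "inverse (2 * r) * bessel_B (s - 1 / 2) (k * of_real v) +
      (- bessel_B (s - 1 / 2 - 1) (of_real y) - (s - 1 / 2) / of_real y * bessel_B (s - 1 / 2) (of_real y)) * k * csqrt (of_real v) =
      r * (- k * bessel_B (s - 3 / 2) (of_real y) - (s - 1) / of_real v * bessel_B (s - 1 / 2) (of_real y))"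
      unfolding left_diff_distrib e1 e2 e3 csq y(2) using vv by (simp add: field_simps)
  qed
  from DERIV_cmult[OF this, of "sigma_star (s - 1 / 2) n"] show ?thesis
    by (simp add: eis_coeff_def[abs_def] k_def y_def r_def)
qed

lemma eis2_term_eq:
  assumes v: "v > 0" and n: "n \<noteq> 0"
  shows "- (1 / (4 * of_real pi)) * (\<i> * deriv (\<lambda>u. eis_coeff s (of_real v) n * unit_exp (of_int n * u)) (of_real u)
           + deriv (\<lambda>v. eis_coeff s v n * unit_exp (of_int n * of_real u)) (of_real v)) = eis2_term u v s n"
proof -
  define e where "e = unit_exp (of_int n * of_real u)"
  define b where "b = bessel_B (s - 1 / 2) (of_real (2 * pi * \<bar>of_int n\<bar> * v))"
  define b' where "b' = bessel_B (s - 3 / 2) (of_real (2 * pi * \<bar>of_int n\<bar> * v))"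
  define r where "r = complex_of_real (sqrt v)"
  define S where "S = sigma_star (s - 1 / 2) n"
  have "((\<lambda>u. eis_coeff s (of_real v) n * unit_exp (of_int n * u)) has_field_derivative
     eis_coeff s (of_real v) n * (2 * of_real pi * \<i> * of_int n * e)) (at (of_real u))"
    unfolding e_def by (auto intro!: derivative_eq_intros)
  hence du: "deriv (\<lambda>u. eis_coeff s (of_real v) n * unit_exp (of_int n * u)) (of_real u) =
     eis_coeff s (of_real v) n * (2 * of_real pi * \<i> * of_int n * e)" by (rule DERIV_imp_deriv)
  have coeff: "eis_coeff s (of_real v) n = S * (r * b)"
    using v by (simp add: eis_coeff_def S_def r_def b_def)
  have dv: "deriv (\<lambda>v. eis_coeff s v n * unit_exp (of_int n * of_real u)) (of_real v) =
     S * (r * (- of_real (2 * pi * \<bar>of_int n\<bar>) * b' - (s - 1) / of_real v * b)) * e"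
    unfolding e_def S_def r_def b_def b'_def
    by (rule DERIV_imp_deriv, rule DERIV_cmult_right, rule has_field_derivative_eis_coeff[OF v n])
  have v': "of_real v \<noteq> (0::complex)" "of_real pi \<noteq> (0::complex)" using v by auto
  have "- (1 / (4 * of_real pi)) * (\<i> * (S * (r * b) * (2 * of_real pi * \<i> * of_int n * e)) +
      S * (r * (- of_real (2 * pi * \<bar>of_int n\<bar>) * b' - (s - 1) / of_real v * b)) * e) =
      S * (r * e) * (of_int n / 2 * b + of_int \<bar>n\<bar> / 2 * b' + (s - 1) / of_real (4 * pi * v) * b)"
  proof -
    have i: "\<i> * (S * (r * b) * (2 * of_real pi * \<i> * of_int n * e)) = - (2 * of_real pi * of_int n * (S * r * b * e))"
      by (simp add: algebra_simps)
    have a: "complex_of_real (2 * pi * \<bar>of_int n\<bar>) = 2 * of_real pi * of_int \<bar>n\<bar>"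
      by (simp flip: of_int_abs)
    show ?thesis unfolding i a using v' by (simp add: field_simps)
  qed
  hence "- (1 / (4 * of_real pi)) * (\<i> * (eis_coeff s (of_real v) n * (2 * of_real pi * \<i> * of_int n * e)) +
      S * (r * (- of_real (2 * pi * \<bar>of_int n\<bar>) * b' - (s - 1) / of_real v * b)) * e) = eis2_term u v s n"
    unfolding coeff eis2_term_def S_def r_def e_def b_def b'_def .
  thus ?thesis unfolding du dv .
qed

text \<open>Order s - 3/2 is the order belonging to s - 1, so the majorant for the undifferentiated
  terms with K = 2 covers both Bessel functions. On the disc the divisor sum costs four powers of 1
  + |n| and the derivative one more, within the seven that are available.\<close>

lemma eis2_term_bound:
  assumes v: "v > 0"
  obtains M where "M summable_on (UNIV - {0})"
    "\<And>n s. n \<noteq> 0 \<Longrightarrow> s \<in> ball 1 (1 / 2) \<Longrightarrow> norm (eis2_term u v s n) \<le> M n"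
proof -
  obtain M where M: "M summable_on (UNIV - {0})"
    "\<And>n s' v' u'. n \<noteq> 0 \<Longrightarrow> \<bar>Re s' - 1 / 2\<bar> \<le> real 2 \<Longrightarrow> Re v' \<ge> v \<Longrightarrow> norm v' \<le> v \<Longrightarrow> \<bar>Im u'\<bar> \<le> v / 4 \<Longrightarrow>
       (1 + \<bar>real_of_int n\<bar>) ^ (3 * 2 + 1) * (sqrt (norm v') * norm (bessel_B (s' - 1 / 2) (of_real (2 * pi * \<bar>of_int n\<bar>) * v')) *
          norm (unit_exp (of_int n * u'))) \<le> M n"
    using eis_coeff_bound[OF v, of 2 v] by blast
  define C where "C = 2 + 1 / (4 * pi * v)"
  have C: "C > 0" "C \<ge> 1" "1 / (4 * pi * v) \<ge> 0" using v by (auto simp: C_def intro!: add_pos_nonneg)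
  show ?thesis
  proof (rule that)
    show "(\<lambda>n. 2 * C * M n) summable_on (UNIV - {0})"
      by (intro summable_on_cmult_right M(1))
    fix n :: int and s :: complex assume n: "n \<noteq> 0" and s: "s \<in> ball 1 (1 / 2)"
    define x where "x = 1 + \<bar>real_of_int n\<bar>"
    define b where "b = norm (bessel_B (s - 1 / 2) (of_real (2 * pi * \<bar>of_int n\<bar> * v)))"
    define b' where "b' = norm (bessel_B (s - 3 / 2) (of_real (2 * pi * \<bar>of_int n\<bar> * v)))"
    have s1: "norm (s - 1) \<le> 1" using s by (simp add: dist_norm norm_minus_commute)
    have Re_s: "\<bar>Re s - 1 / 2\<bar> \<le> 2" "\<bar>Re s - 1 - 1 / 2\<bar> \<le> 2" "\<bar>Re s - 1 / 2\<bar> \<le> 1"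
      using abs_Re_near_1[OF s] by linarith+
    have x1: "x \<ge> 1" by (simp add: x_def)
    have Mb: "x ^ 7 * (sqrt v * b) \<le> M n"
      using M(2)[OF n, of s "of_real v" "of_real u"] Re_s v by (simp add: x_def b_def norm_unit_exp mult_ac)
    have Mb': "x ^ 7 * (sqrt v * b') \<le> M n"
      using M(2)[OF n, of "s - 1" "of_real v" "of_real u"] Re_s v by (simp add: diff_diff_eq x_def b'_def norm_unit_exp mult_ac)
    have sig: "norm (sigma_star (s - 1 / 2) n) \<le> x ^ (3 * 1 + 1)"
      unfolding x_def using Re_s n by (intro sigma_star_bound) auto
    have inner: "norm (of_int n / 2 * bessel_B (s - 1 / 2) (of_real (2 * pi * \<bar>of_int n\<bar> * v))
      + of_int \<bar>n\<bar> / 2 * bessel_B (s - 3 / 2) (of_real (2 * pi * \<bar>of_int n\<bar> * v))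
      + (s - 1) / of_real (4 * pi * v) * bessel_B (s - 1 / 2) (of_real (2 * pi * \<bar>of_int n\<bar> * v))) \<le> x * b + x * b' + 1 / (4 * pi * v) * b"
    proof (intro order_trans[OF norm_triangle_ineq] add_mono)
      show "norm (of_int n / 2 * bessel_B (s - 1 / 2) (of_real (2 * pi * \<bar>of_int n\<bar> * v))) \<le> x * b"
        unfolding norm_mult b_def[symmetric] by (intro mult_right_mono) (auto simp: x_def norm_divide b_def)
      show "norm (of_int \<bar>n\<bar> / 2 * bessel_B (s - 3 / 2) (of_real (2 * pi * \<bar>of_int n\<bar> * v))) \<le> x * b'"
        unfolding norm_mult b'_def[symmetric] by (intro mult_right_mono) (auto simp: x_def norm_divide b'_def)
      have "norm ((s - 1) / of_real (4 * pi * v)) \<le> 1 / (4 * pi * v)"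
        using s1 v by (simp add: norm_divide norm_mult divide_right_mono)
      thus "norm ((s - 1) / of_real (4 * pi * v) * bessel_B (s - 1 / 2) (of_real (2 * pi * \<bar>of_int n\<bar> * v))) \<le> 1 / (4 * pi * v) * b"
        unfolding norm_mult b_def[symmetric] by (intro mult_right_mono) (auto simp: b_def)
    qed
    also have "\<dots> \<le> x * (C * (b + b'))"
    proof -
      have bb: "b \<ge> 0" "b' \<ge> 0" by (simp_all add: b_def b'_def)
      have "1 / (4 * pi * v) * b \<le> x * (1 / (4 * pi * v) * b)"
        using x1 C(3) bb mult_right_mono[OF x1, of "1 / (4 * pi * v) * b"] by simp
      hence "x * b + x * b' + 1 / (4 * pi * v) * b \<le> x * (b + b' + 1 / (4 * pi * v) * b)"
        by (simp add: algebra_simps)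
      also have "\<dots> \<le> x * (C * (b + b'))"
      proof (rule mult_left_mono)
        have "0 \<le> 1 / (4 * pi * v) * b'" using C(3) bb by (intro mult_nonneg_nonneg)
        thus "b + b' + 1 / (4 * pi * v) * b \<le> C * (b + b')"
          unfolding C_def distrib_right distrib_left using bb by linarith
      qed (use x1 in auto)
      finally show ?thesis .
    qed
    finally have inner': "norm (of_int n / 2 * bessel_B (s - 1 / 2) (of_real (2 * pi * \<bar>of_int n\<bar> * v))
      + of_int \<bar>n\<bar> / 2 * bessel_B (s - 3 / 2) (of_real (2 * pi * \<bar>of_int n\<bar> * v))
      + (s - 1) / of_real (4 * pi * v) * bessel_B (s - 1 / 2) (of_real (2 * pi * \<bar>of_int n\<bar> * v))) \<le> x * (C * (b + b'))" .
    have "norm (eis2_term u v s n) \<le> (x ^ (3 * 1 + 1) * sqrt v) * (x * (C * (b + b')))"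
      unfolding eis2_term_def norm_mult[of _ "_ + _ + _"]
      by (rule mult_mono[OF _ inner']) (use sig v x1 in \<open>auto simp: norm_mult norm_unit_exp intro!: mult_right_mono\<close>)
    also have "\<dots> = C * (x ^ 5 * (sqrt v * (b + b')))"
      by (simp add: power_numeral_reduce mult_ac)
    also have "\<dots> \<le> C * (x ^ 7 * (sqrt v * (b + b')))"
      using C x1 v by (intro mult_left_mono mult_right_mono power_increasing) (auto simp: b_def b'_def)
    also have "\<dots> = C * (x ^ 7 * (sqrt v * b) + x ^ 7 * (sqrt v * b'))"
      by (simp add: algebra_simps)
    also have "\<dots> \<le> C * (M n + M n)"
      using C Mb Mb' by (intro mult_left_mono add_mono) auto
    finally show "norm (eis2_term u v s n) \<le> 2 * C * M n" by simp
  qed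
qed

lemma eis2_term_holomorphic:
  assumes "v > 0" "n \<noteq> 0"
  shows "(\<lambda>s. eis2_term u v s n) holomorphic_on A"
  unfolding eis2_term_def using assms
  by (intro holomorphic_intros bessel_B_holomorphic_order) auto

text \<open>\<open>zeta_residue_part w\<close> is \<open>w * completed_zeta w\<close> with the singularity at \<open>0\<close> removed.\<close>

definition zeta_residue_part :: "complex \<Rightarrow> complex" where
  "zeta_residue_part w = 1 / 2 * (w / (w - 1 / 2) - 1) + w * theta_mellin w"

text \<open>-1/(4 pi) times the v-derivative of the constant term. Writing the product (1 - s) *
  \<open>completed_zeta (1 - s)\<close> through \<open>zeta_residue_part\<close> cancels the pole,
  so the expression is meaningful at s = 1 itself.\<close>

definition eis2_const :: "real \<Rightarrow> complex \<Rightarrow> complex" where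
  "eis2_const v s = - (1 / of_real (4 * pi * v)) *
     (s * exp (s * of_real (ln v)) * completed_zeta s + exp ((1 - s) * of_real (ln v)) * zeta_residue_part (1 - s))"

definition eis2_sum :: "real \<Rightarrow> real \<Rightarrow> complex \<Rightarrow> complex" where
  "eis2_sum u v s = (\<Sum>\<^sub>\<infinity>n\<in>UNIV - {0}. eis2_term u v s n)"

lemma
  assumes v: "v > 0"
  shows eis2_sum_has_sum: "s \<in> ball 1 (1 / 2) \<Longrightarrow> ((\<lambda>n. eis2_term u v s n) has_sum eis2_sum u v s) (UNIV - {0})"
    and eis2_sum_holomorphic: "(\<lambda>s. eis2_sum u v s) holomorphic_on ball 1 (1 / 2)"
    and eis2_sum_deriv: "((\<lambda>n. deriv (\<lambda>s. eis2_term u v s n) 1) has_sum deriv (\<lambda>s. eis2_sum u v s) 1) (UNIV - {0})"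
proof -
  obtain M where M: "M summable_on (UNIV - {0})"
    "\<And>n s. n \<noteq> 0 \<Longrightarrow> s \<in> ball 1 (1 / 2) \<Longrightarrow> norm (eis2_term u v s n) \<le> M n"
    using eis2_term_bound[OF v] by blast
  have bnd: "norm (eis2_term u v s n) \<le> M n" if "n \<in> UNIV - {0}" "s \<in> ball 1 (1 / 2)" for n s
    using M(2) that by auto
  have hol: "(\<lambda>s. eis2_term u v s n) holomorphic_on ball 1 (1 / 2)" if "n \<in> UNIV - {0}" for n
    using v that by (intro eis2_term_holomorphic) auto
  show sums: "((\<lambda>n. eis2_term u v s n) has_sum eis2_sum u v s) (UNIV - {0})" if "s \<in> ball 1 (1 / 2)" for s
    unfolding eis2_sum_def
    by (rule has_sum_infsum, rule summable_on_norm_comparison[OF M(1)]) (use bnd that in auto)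
  show "(\<lambda>s. eis2_sum u v s) holomorphic_on ball 1 (1 / 2)"
    by (rule holomorphic_on_has_sum[OF open_ball hol bnd M(1) sums])
  show "((\<lambda>n. deriv (\<lambda>s. eis2_term u v s n) 1) has_sum deriv (\<lambda>s. eis2_sum u v s) 1) (UNIV - {0})"
    by (rule has_sum_deriv[OF open_ball hol bnd M(1) sums]) auto
qed

text \<open>For fixed s on the punctured disc the expansion holds for all real u and all v > 0, so
  it may be differentiated in both directions.\<close>

lemma wirtinger_deriv_E_star:
  assumes v: "v > 0" and s: "s \<in> ball 1 (1 / 2) - {1}"
  shows "1 / (2 * of_real pi * \<i>) * wirtinger_deriv (\<lambda>t. eisenstein_E_star t s) (Complex u v) =
           eis2_const v s + eis2_sum u v s"
proof -
  define Du where "Du = deriv (\<lambda>u. eis_series u (of_real v) s) (of_real u)"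
  define Dv where "Dv = deriv (\<lambda>v. eis_series (of_real u) v s) (of_real v)"
  \<comment> \<open>The expansion with v replaced by a complex z, by means of \<open>Ln\<close>; the
    real v-derivative is then read off from a complex one.\<close>
  define H where "H z = exp (s * Ln z) * completed_zeta s + exp ((1 - s) * Ln z) * completed_zeta (1 - s) + eis_series (of_real u) z s" for z
  define Dc where "Dc = exp (s * of_real (ln v)) * (s / of_real v) * completed_zeta s +
       exp ((1 - s) * of_real (ln v)) * ((1 - s) / of_real v) * completed_zeta (1 - s)"
  have "((\<lambda>x. eis_const v s + eis_series (of_real x) (of_real v) s) has_vector_derivative 0 + Du) (at u)"
    unfolding Du_def
    by (intro has_vector_derivative_add has_vector_derivative_const has_vector_derivative_real_field eis_series_deriv_u(1)[OF v])
  hence u_der: "vector_derivative (\<lambda>x. eisenstein_E_star (Complex x v) s) (at u) = Du"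
    unfolding eisenstein_E_star_eq_near_1[OF v s] by (simp add: vector_derivative_at)
  have Ln_v: "Ln (of_real v) = complex_of_real (ln v)" using v by (simp add: Ln_of_real)
  have "((\<lambda>z. exp (s * Ln z) * completed_zeta s + exp ((1 - s) * Ln z) * completed_zeta (1 - s)) has_field_derivative Dc) (at (of_real v))"
    unfolding Dc_def using v
    by (auto intro!: derivative_eq_intros simp: Ln_v complex_nonpos_Reals_iff field_simps)
  hence "(H has_field_derivative Dc + Dv) (at (of_real v))"
    unfolding H_def[abs_def] Dv_def by (intro DERIV_add eis_series_deriv_v(1)[OF v])
  hence "((\<lambda>x. H (of_real x)) has_vector_derivative Dc + Dv) (at v)"
    by (rule has_vector_derivative_real_field)
  hence "((\<lambda>x. eisenstein_E_star (Complex u x) s) has_vector_derivative Dc + Dv) (at v)"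
  proof (rule has_vector_derivative_transform_within_open[where S = "{0<..}"])
    fix x :: real assume "x \<in> {0<..}"
    thus "H (of_real x) = eisenstein_E_star (Complex u x) s"
      using eisenstein_E_star_eq_near_1[OF _ s, of x u] by (simp add: H_def eis_const_def Ln_of_real)
  qed (use v in auto)
  hence v_der: "vector_derivative (\<lambda>x. eisenstein_E_star (Complex u x) s) (at v) = Dc + Dv"
    by (rule vector_derivative_at)
  have s': "s \<in> ball 1 (1 / 2)" "s \<noteq> 1" using s by auto
  have "((\<lambda>n. - (1 / (4 * of_real pi)) * (\<i> * deriv (\<lambda>u. eis_coeff s (of_real v) n * unit_exp (of_int n * u)) (of_real u)
           + deriv (\<lambda>v. eis_coeff s v n * unit_exp (of_int n * of_real u)) (of_real v))) has_sum
          (- (1 / (4 * of_real pi)) * (\<i> * Du + Dv))) (UNIV - {0})"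
    unfolding Du_def Dv_def
    by (intro has_sum_cmult_right has_sum_add eis_series_deriv_u(2)[OF v] eis_series_deriv_v(2)[OF v])
  also have "?this \<longleftrightarrow> ((\<lambda>n. eis2_term u v s n) has_sum (- (1 / (4 * of_real pi)) * (\<i> * Du + Dv))) (UNIV - {0})"
    by (rule has_sum_cong, rule eis2_term_eq[OF v]) auto
  finally have series: "- (1 / (4 * of_real pi)) * (\<i> * Du + Dv) = eis2_sum u v s"
    using eis2_sum_has_sum[OF v s'(1)] by (rule has_sum_unique)
  \<comment> \<open>The cancelled form agrees with the product because s differs from 1
    here.\<close>
  have Z: "(1 - s) * completed_zeta (1 - s) = zeta_residue_part (1 - s)"
  proof -
    have "w * (1 / 2 * (1 / a - 1 / w) + T) = 1 / 2 * (w / a - 1) + w * T" if "w \<noteq> 0" for w a T :: complex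
      using that by (simp add: algebra_simps diff_divide_distrib)
    thus ?thesis unfolding completed_zeta_def zeta_residue_part_def using s'(2) by simp
  qed
  have const: "- (1 / (4 * of_real pi)) * Dc = eis2_const v s"
    unfolding eis2_const_def Z[symmetric] Dc_def using v by (simp add: field_simps)
  have "1 / (2 * of_real pi * \<i>) * wirtinger_deriv (\<lambda>t. eisenstein_E_star t s) (Complex u v) =
      1 / (2 * of_real pi * \<i>) * ((Du - \<i> * (Dc + Dv)) / 2)"
    unfolding wirtinger_deriv_def by (simp add: u_der v_der)
  also have "\<dots> = - (1 / (4 * of_real pi)) * Dc + - (1 / (4 * of_real pi)) * (\<i> * Du + Dv)"
    by (simp add: field_simps)
  finally show ?thesis unfolding series const .
qed

lemma zeta_residue_part_analytic:
  assumes "1 / 2 \<notin> A"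
  shows "zeta_residue_part analytic_on A"
proof -
  have "w - 1 / 2 \<noteq> 0" if "w \<in> A" for w
    using that assms by (metis eq_iff_diff_eq_0)
  thus ?thesis
    unfolding zeta_residue_part_def[abs_def] by (intro analytic_intros theta_mellin_analytic)
qed

lemma eis2_const_analytic:
  assumes v: "v > 0" and s: "s \<in> ball 1 (1 / 2)"
  shows "eis2_const v analytic_on {s}"
proof -
  note Re = abs_Re_near_1[OF s]
  have "0 \<notin> {s}" "1 / 2 \<notin> {s}" using Re by (auto simp: complex_eq_iff)
  hence 1: "completed_zeta analytic_on {s}" by (rule completed_zeta_analytic)
  have 2: "(\<lambda>s. zeta_residue_part (1 - s)) analytic_on {s}"
  proof (rule analytic_on_compose[OF _ zeta_residue_part_analytic, unfolded o_def])
    have "1 - s \<noteq> 1 / 2" using Re by (auto simp: complex_eq_iff)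
    thus "1 / 2 \<notin> (\<lambda>s. 1 - s) ` {s}" by auto
  qed (auto intro!: analytic_intros)
  show ?thesis unfolding eis2_const_def[abs_def] by (intro analytic_intros 1 2)
qed

text \<open>The identity is known off s = 1 and its right-hand side is analytic on the whole disc,
  so the singularity that \<open>remove_sings\<close> fills at 1 is removable, with the value of the
  right-hand side.\<close>

lemma eisenstein_E2_eq:
  assumes v: "v > 0" and s: "s \<in> ball 1 (1 / 2)"
  shows "eisenstein_E2 (Complex u v) s = eis2_const v s + eis2_sum u v s"
proof -
  define W where "W s = eis2_const v s + eis2_sum u v s" for s
  have "eis2_sum u v analytic_on {s}"
    using eis2_sum_holomorphic[OF v, of u] s by (auto simp: analytic_at intro: exI[of _ "ball 1 (1 / 2)"])
  hence W: "W analytic_on {s}"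
    unfolding W_def[abs_def] by (intro analytic_intros eis2_const_analytic[OF v s])
  have "eventually (\<lambda>w. w \<in> ball 1 (1 / 2) - {s}) (at s)"
    using s by (intro eventually_at_in_open) auto
  moreover have "eventually (\<lambda>w. w \<noteq> 1) (at s)"
  proof (cases "s = 1")
    case True thus ?thesis by (simp add: eventually_at_filter)
  next
    case False thus ?thesis by (intro tendsto_imp_eventually_ne[OF tendsto_ident_at]) auto
  qed
  ultimately have "eventually (\<lambda>w. 1 / (2 * of_real pi * \<i>) * wirtinger_deriv (\<lambda>t. eisenstein_E_star t w) (Complex u v) = W w) (at s)"
    by eventually_elim (simp only: W_def wirtinger_deriv_E_star[OF v] Diff_iff singleton_iff simp_thms)
  hence "eisenstein_E2 (Complex u v) s = remove_sings W s"
    unfolding eisenstein_E2_def by (rule remove_sings_cong) auto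
  thus ?thesis using W by (simp add: W_def)
qed

lemma
  assumes v: "v > 0"
  shows eisenstein_E2_analytic: "eisenstein_E2 (Complex u v) analytic_on {1}"
    and eisenstein_E2_deriv: "deriv (eisenstein_E2 (Complex u v)) 1 = deriv (eis2_const v) 1 + deriv (eis2_sum u v) 1"
proof -
  have 1: "eis2_sum u v analytic_on {1}"
    using eis2_sum_holomorphic[OF v, of u] by (auto simp: analytic_at intro: exI[of _ "ball 1 (1 / 2)"])
  have 2: "eis2_const v analytic_on {1}" by (rule eis2_const_analytic[OF v]) simp
  have ev: "eventually (\<lambda>s. eisenstein_E2 (Complex u v) s = eis2_const v s + eis2_sum u v s) (nhds 1)"
    by (rule eventually_mono[OF eventually_nhds_in_open[of "ball 1 (1 / 2)"]]) (auto intro: eisenstein_E2_eq[OF v])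
  show "eisenstein_E2 (Complex u v) analytic_on {1}"
    using analytic_at_cong[OF ev refl] 1 2 by (auto intro: analytic_intros)
  have "deriv (eisenstein_E2 (Complex u v)) 1 = deriv (\<lambda>s. eis2_const v s + eis2_sum u v s) 1"
    by (rule deriv_cong_ev[OF ev refl])
  also have "\<dots> = deriv (eis2_const v) 1 + deriv (eis2_sum u v) 1"
    using 1 2 by (intro deriv_add) (auto simp: analytic_on_imp_differentiable_at)
  finally show "deriv (eisenstein_E2 (Complex u v)) 1 = deriv (eis2_const v) 1 + deriv (eis2_sum u v) 1" .
qed

section \<open>Coefficients and their derivatives at s = 1\<close>

text \<open>With \<open>completed_zeta 1\<close> = \<pi>/6 and \<open>zeta_residue_part 0\<close> =
  -1/2 the bracket is \<pi> v/6 - 1/2; the second summand is the trace of the cancelled pole and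
  yields the non-holomorphic 1/(8 \<pi> v).\<close>

lemma eis2_const_1:
  assumes v: "v > 0"
  shows "eis2_const v 1 = coeff_a v 0"
proof -
  have "exp (complex_of_real (ln v)) = of_real v" unfolding exp_of_real using v by simp
  thus ?thesis using v
    by (simp add: eis2_const_def coeff_a_def completed_zeta_1 zeta_residue_part_def field_simps)
qed

text \<open>The part with 1/24 stems from the derivative of \<open>completed_zeta\<close> at 1,
  hence \<zeta>'(-1). The part with 1/v stems from the derivative of
  \<open>zeta_residue_part\<close> at 0, which is \<open>theta_mellin 0\<close> - 1, hence \<gamma>
  and log(4 \<pi>); the factor v^(1-s) completes the logarithm.\<close>

lemma deriv_eis2_const_1:
  assumes v: "v > 0"
  shows "deriv (eis2_const v) 1 = coeff_a' v 0"
proof -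
  define Z' where "Z' = 4 * of_real pi * deriv riemann_zeta (- 1) + of_real (pi / 6 * (ln (4 * pi) - 2 + euler_mascheroni))"
  have exp_v: "exp (complex_of_real (ln v)) = of_real v" unfolding exp_of_real using v by simp
  have T: "(theta_mellin has_field_derivative deriv theta_mellin 0) (at 0)"
    using holomorphic_derivI[OF theta_mellin_holomorphic[of UNIV]] by simp
  have P: "(zeta_residue_part has_field_derivative (- 1 + theta_mellin 0)) (at 0)"
    unfolding zeta_residue_part_def[abs_def]
    by (auto intro!: derivative_eq_intros T)
  have P': "((\<lambda>s. zeta_residue_part (1 - s)) has_field_derivative (- 1 + theta_mellin 0) * (- 1)) (at 1)"
  proof (rule DERIV_chain2[of zeta_residue_part _ "\<lambda>s. 1 - s"])
    show "(zeta_residue_part has_field_derivative - 1 + theta_mellin 0) (at (1 - 1))" using P by simp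
  qed (auto intro!: derivative_eq_intros)
  have Z: "(completed_zeta has_field_derivative Z') (at 1)"
    unfolding Z'_def by (rule has_field_derivative_completed_zeta_1)
  have E1: "((\<lambda>s::complex. s * exp (s * of_real (ln v))) has_field_derivative of_real v + of_real (ln v) * of_real v) (at 1)"
    by (auto intro!: derivative_eq_intros simp: exp_v)
  have E2: "((\<lambda>s::complex. exp ((1 - s) * of_real (ln v))) has_field_derivative - of_real (ln v)) (at 1)"
    by (auto intro!: derivative_eq_intros)
  have P0: "zeta_residue_part 0 = - 1 / 2" by (simp add: zeta_residue_part_def)
  have "deriv (eis2_const v) 1 = - (1 / of_real (4 * pi * v)) *
     (((of_real v + of_real (ln v) * of_real v) * of_real (pi / 6) + Z' * of_real v)
       + (- of_real (ln v) * (- 1 / 2) + (- 1 + theta_mellin 0) * (- 1)))"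
    unfolding eis2_const_def[abs_def]
    by (rule DERIV_imp_deriv, rule DERIV_cong[OF DERIV_cmult[OF DERIV_add[OF DERIV_mult[OF E1 Z] DERIV_mult[OF E2 P']]]])
       (simp add: exp_v completed_zeta_1 P0)
  also have "\<dots> = coeff_a' v 0"
  proof -
    have "ln (4 * pi * v) = ln (4 * pi) + ln v" using v by (subst ln_mult) auto
    thus ?thesis
      using v unfolding theta_mellin_0 Z'_def coeff_a'_def by (simp add: field_simps)
  qed
  finally show ?thesis .
qed

text \<open>At \<nu> = 1/2 the divisor sum is that of 1/d; multiplied by |n| it becomes the sum of
  |n|/d, and d -> |n|/d permutes the divisors.\<close>

lemma sigma_star_half:
  assumes n: "n \<noteq> 0"
  shows "of_real (sqrt \<bar>of_int n\<bar>) * sigma_star (1 / 2) n = of_int (sigma \<bar>n\<bar>)"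
proof -
  have powr_half: "of_int \<bar>n\<bar> powr (1 / 2) = complex_of_real (sqrt \<bar>of_int n\<bar>)"
  proof -
    have "exp (1 / 2 * ln (real_of_int \<bar>n\<bar>)) = sqrt (real_of_int \<bar>n\<bar>)"
      using n powr_half_sqrt[of "real_of_int \<bar>n\<bar>"] by (simp add: powr_def)
    hence "complex_of_real (exp (1 / 2 * ln (real_of_int \<bar>n\<bar>))) = of_real (sqrt (real_of_int \<bar>n\<bar>))" by (rule arg_cong)
    thus ?thesis using n powr_of_int_eq_exp[of "\<bar>n\<bar>" "1 / 2"] by (simp flip: exp_of_real)
  qed
  have "of_real (sqrt \<bar>of_int n\<bar>) * sigma_star (1 / 2) n =
      (of_real (sqrt \<bar>of_int n\<bar>) * of_real (sqrt \<bar>of_int n\<bar>)) * (\<Sum>d | d dvd n \<and> d > 0. of_int d powr (- 1))"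
    unfolding sigma_star_def powr_half by simp
  also have "complex_of_real (sqrt \<bar>of_int n\<bar>) * of_real (sqrt \<bar>of_int n\<bar>) = of_int \<bar>n\<bar>"
    by (metis abs_ge_zero of_int_abs of_real_mult of_real_of_int_eq real_sqrt_mult_self abs_of_nonneg)
  also have "of_int \<bar>n\<bar> * (\<Sum>d | d dvd n \<and> d > 0. complex_of_int d powr (- 1)) = (\<Sum>d | d dvd n \<and> d > 0. of_int (\<bar>n\<bar> div d))"
    unfolding sum_distrib_left
  proof (rule sum.cong)
    fix d assume "d \<in> {d. d dvd n \<and> d > 0}"
    hence d: "d dvd \<bar>n\<bar>" "d > 0" by auto
    have "complex_of_int d powr (- 1) = 1 / of_int d" using d by (simp add: powr_minus inverse_eq_divide)
    moreover have "complex_of_int (\<bar>n\<bar> div d) = of_int \<bar>n\<bar> / of_int d"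
      using d by (elim dvdE) (simp del: of_int_abs)
    ultimately show "of_int \<bar>n\<bar> * complex_of_int d powr (- 1) = of_int (\<bar>n\<bar> div d)" by simp
  qed simp
  finally have eq: "of_real (sqrt \<bar>of_int n\<bar>) * sigma_star (1 / 2) n = (\<Sum>d | d dvd n \<and> d > 0. complex_of_int (\<bar>n\<bar> div d))" .
  have compl: "\<bar>n\<bar> div d dvd \<bar>n\<bar> \<and> \<bar>n\<bar> div d > 0 \<and> \<bar>n\<bar> div (\<bar>n\<bar> div d) = d" if "d dvd n" "d > 0" for d
  proof -
    have "d dvd \<bar>n\<bar>" using that(1) by simp
    then obtain k where k: "\<bar>n\<bar> = d * k" by (elim dvdE)
    have "d * k > 0" unfolding k[symmetric] using n by simp
    hence "k > 0" using that(2) by (simp add: zero_less_mult_iff)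
    thus ?thesis using that(2) by (simp add: k)
  qed
  have "(\<Sum>d | d dvd n \<and> d > 0. complex_of_int (\<bar>n\<bar> div d)) = (\<Sum>d | d dvd \<bar>n\<bar> \<and> d > 0. of_int d)"
    by (rule sum.reindex_bij_witness[where i = "\<lambda>d. \<bar>n\<bar> div d" and j = "\<lambda>d. \<bar>n\<bar> div d"])
       (use compl in auto)
  also have "\<dots> = of_int (sigma \<bar>n\<bar>)" by (simp add: sigma_def)
  finally show ?thesis unfolding eq .
qed

text \<open>Ensures that the denominator of the logarithmic derivative
  \<open>sigma_log_deriv\<close> is nonzero, so that the division can be undone.\<close>

lemma sigma_pos:
  assumes "n \<noteq> 0"
  shows "sigma n > 0"
  unfolding sigma_def
proof (rule sum_pos)
  show "finite {d. d dvd n \<and> d > 0}" using assms by (rule finite_pos_divisors)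
  show "{d. d dvd n \<and> d > 0} \<noteq> {}" by (auto intro!: exI[of _ 1])
qed auto

text \<open>The powers of v cancel and 1/sqrt|n| remains, exactly what separates
  \<open>sigma_star (1 / 2)\<close> from the integer divisor sum.\<close>

lemma
  fixes n :: int and v :: real
  assumes v: "v > 0" and n: "n \<noteq> 0"
  defines "y \<equiv> 2 * pi * \<bar>of_int n\<bar> * v" and "c \<equiv> complex_of_real (sqrt \<bar>of_int n\<bar>)"
  shows sqrt_bessel_B_half: "of_real (sqrt v) * bessel_B (1 / 2) (of_real y) = of_real (exp (- y)) / c"
    and sqrt_bessel_M_half: "of_real (sqrt v) * bessel_M (1 / 2) (of_real y) = - of_real (exp y * Ei (- 2 * y)) / c"
proof -
  have y: "y > 0" using v n by (simp add: y_def)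
  have "sqrt v * sqrt (2 * pi / y) = sqrt (1 / \<bar>of_int n\<bar>)"
    using v by (simp add: y_def flip: real_sqrt_mult)
  hence eq: "complex_of_real (sqrt v) * of_real (sqrt (2 * pi / y)) = 1 / c"
    unfolding c_def of_real_mult[symmetric] by (simp add: real_sqrt_divide)
  have "of_real (sqrt v) * bessel_B (1 / 2) (of_real y) = of_real (exp (- y)) * (of_real (sqrt v) * of_real (sqrt (2 * pi / y)))"
    unfolding bessel_B_half[OF y] by simp
  thus "of_real (sqrt v) * bessel_B (1 / 2) (of_real y) = of_real (exp (- y)) / c"
    unfolding eq by simp
  have "of_real (sqrt v) * bessel_M (1 / 2) (of_real y) = - (of_real (exp y * Ei (- 2 * y)) * (of_real (sqrt v) * of_real (sqrt (2 * pi / y))))"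
    unfolding bessel_M_half[OF y] by simp
  thus "of_real (sqrt v) * bessel_M (1 / 2) (of_real y) = - of_real (exp y * Ei (- 2 * y)) / c"
    unfolding eq by simp
qed

lemma unit_exp_powi:
  "exp (2 * of_real pi * \<i> * Complex u v) powi n = unit_exp (of_int n * of_real u) * of_real (exp (- (2 * pi * of_int n * v)))"
proof -
  have "Complex u v = of_real u + \<i> * of_real v" by (simp add: complex_eq_iff)
  hence "exp (2 * of_real pi * \<i> * Complex u v) powi n =
      exp (of_int n * (2 * of_real pi * \<i> * (of_real u + \<i> * of_real v)))"
    by (simp add: exp_power_int)
  also have "of_int n * (2 * of_real pi * \<i> * (of_real u + \<i> * of_real v)) =
      2 * of_real pi * \<i> * (of_int n * of_real u) + of_real (- (2 * pi * of_int n * v))"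
    by (simp add: algebra_simps)
  finally show ?thesis by (simp only: unit_exp_def exp_add exp_of_real)
qed

lemma eis2_term_1:
  assumes v: "v > 0" and n: "n \<noteq> 0"
  shows "eis2_term u v 1 n = coeff_a v n * exp (2 * of_real pi * \<i> * Complex u v) powi n"
proof -
  define y where "y = 2 * pi * \<bar>of_int n\<bar> * v"
  define c where "c = complex_of_real (sqrt \<bar>of_int n\<bar>)"
  define S where "S = sigma_star (1 / 2) n"
  define e where "e = unit_exp (of_int n * of_real u)"
  define b where "b = bessel_B (1 / 2) (of_real y)"
  have c: "c \<noteq> 0" "c * c = of_real \<bar>of_int n\<bar>" using n by (simp_all add: c_def flip: of_real_mult)
  have cS: "c * S = of_int (sigma \<bar>n\<bar>)" unfolding c_def S_def by (rule sigma_star_half[OF n])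
  have rb: "of_real (sqrt v) * b = of_real (exp (- y)) / c"
    unfolding b_def y_def c_def by (rule sqrt_bessel_B_half[OF v n])
  have half: "1 - 1 / 2 = (1 / 2 :: complex)" "1 - 3 / 2 = - (1 / 2 :: complex)" by simp_all
  have "eis2_term u v 1 n = S * (of_real (sqrt v) * e) * (of_int n / 2 * b + of_int \<bar>n\<bar> / 2 * b)"
    unfolding eis2_term_def half bessel_B_uminus y_def[symmetric] S_def[symmetric] e_def[symmetric] b_def[symmetric] by simp
  also have "\<dots> = coeff_a v n * exp (2 * of_real pi * \<i> * Complex u v) powi n"
  proof (cases "n > 0")
    case True
    have "S * (of_real (sqrt v) * e) * (of_int n / 2 * b + of_int \<bar>n\<bar> / 2 * b) = S * e * of_int n * (of_real (sqrt v) * b)"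
      using True by (simp add: field_simps)
    \<comment> \<open>n = c^2 is split: one factor c turns S into the divisor sum, the other cancels
      the 1/c of the Bessel value.\<close>
    also have "\<dots> = S * e * (c * c) * (of_real (sqrt v) * b)" using True c by simp
    also have "\<dots> = (c * S) * (e * of_real (exp (- y)))"
      unfolding rb using c(1) by (simp add: field_simps)
    finally show ?thesis
      unfolding unit_exp_powi cS e_def using True by (simp add: coeff_a_def y_def)
  qed (use n in \<open>auto simp: coeff_a_def\<close>)
  finally show ?thesis .
qed

text \<open>By oddness the order derivatives at 1/2 and -1/2 are m and -m. For n > 0 they cancel,
  leaving the derivative of \<open>sigma_star\<close> and the term from (s - 1)/(4 \<pi> v). For n <
  0 the bracket \<open>X 1\<close> vanishes, which removes the derivative of
  \<open>sigma_star\<close>, while the order derivatives add up to n m and bring in Ei.\<close>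

lemma deriv_eis2_term_1:
  assumes v: "v > 0" and n: "n \<noteq> 0"
  shows "deriv (\<lambda>s. eis2_term u v s n) 1 = coeff_a' v n * exp (2 * of_real pi * \<i> * Complex u v) powi n"
proof -
  define y where "y = 2 * pi * \<bar>of_int n\<bar> * v"
  define c where "c = complex_of_real (sqrt \<bar>of_int n\<bar>)"
  define S where "S = sigma_star (1 / 2) n"
  define S' where "S' = deriv (\<lambda>\<nu>. sigma_star \<nu> n) (1 / 2)"
  define e where "e = unit_exp (of_int n * of_real u)"
  define r where "r = complex_of_real (sqrt v)"
  define b where "b = bessel_B (1 / 2) (of_real y)"
  define m where "m = bessel_M (1 / 2) (of_real y)"
  have y: "Re (of_real y) > 0" using v n by (simp add: y_def)
  have c: "c \<noteq> 0" "c * c = of_real \<bar>of_int n\<bar>" using n by (simp_all add: c_def flip: of_real_mult)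
  have cS: "c * S = of_int (sigma \<bar>n\<bar>)" unfolding c_def S_def by (rule sigma_star_half[OF n])
  have S_nz: "S \<noteq> 0" using cS sigma_pos[of "\<bar>n\<bar>"] n by auto
  have rb: "r * b = of_real (exp (- y)) / c"
    unfolding b_def y_def c_def r_def by (rule sqrt_bessel_B_half[OF v n])
  have rm: "r * m = - of_real (exp y * Ei (- 2 * y)) / c"
    unfolding m_def y_def c_def r_def by (rule sqrt_bessel_M_half[OF v n])
  have half: "1 - 1 / 2 = (1 / 2 :: complex)" "1 - 3 / 2 = - (1 / 2 :: complex)" by simp_all
  have shift: "((\<lambda>s::complex. s - a) has_field_derivative 1) (at 1)" for a
    by (auto intro!: derivative_eq_intros)
  have "((\<lambda>\<nu>. sigma_star \<nu> n) has_field_derivative S') (at (1 - 1 / 2))"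
    unfolding S'_def half by (rule holomorphic_derivI[of _ UNIV]) (auto intro!: holomorphic_intros)
  from DERIV_chain2[OF this shift] have dS: "((\<lambda>s. sigma_star (s - 1 / 2) n) has_field_derivative S') (at 1)" by simp
  have dB: "((\<lambda>s. bessel_B (s - 1 / 2) (of_real y)) has_field_derivative m) (at 1)"
    using DERIV_chain2[OF has_field_derivative_bessel_order[OF y] shift, of "1 / 2"] unfolding half m_def by simp
  have dB': "((\<lambda>s. bessel_B (s - 3 / 2) (of_real y)) has_field_derivative - m) (at 1)"
    using DERIV_chain2[OF has_field_derivative_bessel_order[OF y] shift, of "3 / 2"] unfolding half m_def bessel_M_uminus by simp
  define X where "X s = of_int n / 2 * bessel_B (s - 1 / 2) (of_real y) + of_int \<bar>n\<bar> / 2 * bessel_B (s - 3 / 2) (of_real y)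
      + (s - 1) / of_real (4 * pi * v) * bessel_B (s - 1 / 2) (of_real y)" for s
  have lin: "((\<lambda>s::complex. (s - 1) / of_real (4 * pi * v)) has_field_derivative 1 / of_real (4 * pi * v)) (at 1)"
    by (rule DERIV_cdivide[OF shift])
  have b': "bessel_B (1 - 1 / 2) (of_real y) = b" "bessel_B (1 - 3 / 2) (of_real y) = b"
    unfolding half bessel_B_uminus b_def by simp_all
  have b'': "bessel_B (1 / 2) (of_real y) = b" "bessel_B (- (1 / 2)) (of_real y) = b"
    unfolding bessel_B_uminus b_def by simp_all
  have dX: "(X has_field_derivative of_int n / 2 * m + of_int \<bar>n\<bar> / 2 * (- m) + 1 / of_real (4 * pi * v) * b) (at 1)"
    unfolding X_def[abs_def]
    by (rule DERIV_cong[OF DERIV_add[OF DERIV_add[OF DERIV_cmult[OF dB] DERIV_cmult[OF dB']] DERIV_mult[OF lin dB]]])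
       (simp add: b'')
  have X1: "X 1 = of_int n / 2 * b + of_int \<bar>n\<bar> / 2 * b" unfolding X_def b' by simp
  have "((\<lambda>s. sigma_star (s - 1 / 2) n * (r * e) * X s) has_field_derivative
      S' * (r * e) * X 1 + (of_int n / 2 * m + of_int \<bar>n\<bar> / 2 * (- m) + 1 / of_real (4 * pi * v) * b) * (S * (r * e))) (at 1)"
    by (rule DERIV_cong[OF DERIV_mult[OF DERIV_cmult_right[OF dS] dX]]) (simp add: S_def)
  hence "deriv (\<lambda>s. eis2_term u v s n) 1 =
      S' * (r * e) * X 1 + (of_int n / 2 * m + of_int \<bar>n\<bar> / 2 * (- m) + 1 / of_real (4 * pi * v) * b) * (S * (r * e))"
    unfolding eis2_term_def y_def[symmetric] X_def r_def e_def by (rule DERIV_imp_deriv)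
  also have "\<dots> = coeff_a' v n * exp (2 * of_real pi * \<i> * Complex u v) powi n"
  proof (cases "n > 0")
    case True
    hence cc: "c * c = of_int n" using c by simp
    have v': "complex_of_real v \<noteq> 0" using v by simp
    have "S' * (r * e) * X 1 + (of_int n / 2 * m + of_int \<bar>n\<bar> / 2 * (- m) + 1 / of_real (4 * pi * v) * b) * (S * (r * e)) =
       (S' * of_int n + S / of_real (4 * pi * v)) * e * (r * b)"
      unfolding X1 using True by (simp add: algebra_simps)
    also have "\<dots> = (c * S) * (1 / (of_real (4 * pi * v) * (c * c)) + S' / S) * (e * of_real (exp (- y)))"
      unfolding rb cc[symmetric] using S_nz c(1) v' by (simp add: field_simps)
    also have "of_real (4 * pi * v) * (c * c) = complex_of_real (4 * pi * of_int n * v)"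
      unfolding cc by simp
    finally show ?thesis
      unfolding unit_exp_powi cS e_def using True
      by (simp add: coeff_a'_def y_def sigma_log_deriv_def S'_def S_def)
  next
    case False
    hence n0: "n < 0" using n by simp
    hence cc: "c * c = - of_int n" using c by simp
    have v': "complex_of_real v \<noteq> 0" using v by simp
    have "S' * (r * e) * X 1 + (of_int n / 2 * m + of_int \<bar>n\<bar> / 2 * (- m) + 1 / of_real (4 * pi * v) * b) * (S * (r * e)) =
       S * e * (of_int n * (r * m) + 1 / of_real (4 * pi * v) * (r * b))"
      unfolding X1 using n0 by (simp add: algebra_simps)
    also have "\<dots> = S * e * (- (c * c) * (r * m) + 1 / of_real (4 * pi * v) * (r * b))" using cc by simp
    also have "S * e * (- (c * c) * (r * m) + 1 / of_real (4 * pi * v) * (r * b)) =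
        (c * S) * e * (of_real (exp y * Ei (- 2 * y)) + of_real (exp (- y)) / (of_real (4 * pi * v) * (c * c)))"
      unfolding rb rm using c(1) v' by (simp add: field_simps)
    also have "of_real (4 * pi * v) * (c * c) = complex_of_real (4 * pi * \<bar>of_int n\<bar> * v)"
      unfolding cc using n0 by simp
    also have "complex_of_real (exp y * Ei (- 2 * y)) + of_real (exp (- y)) / of_real (4 * pi * \<bar>of_int n\<bar> * v) =
       of_real (Ei (- 2 * y) + 1 / (4 * pi * \<bar>of_int n\<bar> * v) * exp (- 2 * y)) * of_real (exp y)"
    proof -
      \<comment> \<open>For n < 0 the power of q has absolute value exp y; this factor must be split
        off, which leaves the argument -2 y = -4 \<pi> |n| v of the stated coefficient.\<close>
      have "exp (- y) = exp (- 2 * y) * exp y" by (simp add: mult_exp_exp)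
      thus ?thesis by (simp add: algebra_simps)
    qed
    finally have fin: "S' * (r * e) * X 1 + (of_int n / 2 * m + of_int \<bar>n\<bar> / 2 * (- m) + 1 / of_real (4 * pi * v) * b) * (S * (r * e)) =
       (c * S) * e * (of_real (Ei (- 2 * y) + 1 / (4 * pi * \<bar>of_int n\<bar> * v) * exp (- 2 * y)) * of_real (exp y))" .
    have y2: "- 2 * y = - 4 * pi * \<bar>of_int n\<bar> * v" by (simp add: y_def)
    have y1: "- (2 * pi * of_int n * v) = y" using n0 by (simp add: y_def)
    show ?thesis
      unfolding fin unit_exp_powi cS y1 y2 e_def[symmetric] coeff_a'_def using n0 by (simp add: mult_ac)
  qed
  finally show ?thesis .
qed

text \<open>Analyticity at 1 belongs to the claim: it gives the value and the \<open>deriv\<close>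
  at s = 1 their intended meaning.\<close>

theorem theorem2p2:
  fixes u v :: real and \<tau> q :: complex
  assumes "v > 0"
    and "\<tau> = Complex u v"
    and "q = exp (2 * of_real pi * \<i> * \<tau>)"
  shows "eisenstein_E2 \<tau> analytic_on {1} \<and>
         ((\<lambda>m :: int. coeff_a v m * q powi m) has_sum eisenstein_E2 \<tau> 1) UNIV \<and>
         ((\<lambda>m :: int. coeff_a' v m * q powi m) has_sum deriv (eisenstein_E2 \<tau>) 1) UNIV"
proof (intro conjI)
  note v = assms(1)
  have q: "q = exp (2 * of_real pi * \<i> * Complex u v)" using assms by simp
  show "eisenstein_E2 \<tau> analytic_on {1}"
    unfolding assms(2) by (rule eisenstein_E2_analytic[OF v])
  have one: "1 \<in> ball (1 :: complex) (1 / 2)" by simp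
  have UNIV_eq: "insert 0 (UNIV - {0}) = (UNIV :: int set)" by auto
  have "((\<lambda>n. coeff_a v n * q powi n) has_sum eis2_sum u v 1) (UNIV - {0})"
    by (rule has_sum_cong[THEN iffD1, OF _ eis2_sum_has_sum[OF v one, of u]])
       (simp add: eis2_term_1[OF v] q)
  from has_sum_insert[OF _ this, of 0]
  show "((\<lambda>m. coeff_a v m * q powi m) has_sum eisenstein_E2 \<tau> 1) UNIV"
    unfolding UNIV_eq assms(2) eisenstein_E2_eq[OF v one] eis2_const_1[OF v] by simp
  have "((\<lambda>n. coeff_a' v n * q powi n) has_sum deriv (eis2_sum u v) 1) (UNIV - {0})"
    by (rule has_sum_cong[THEN iffD1, OF _ eis2_sum_deriv[OF v, of u]])
       (simp add: deriv_eis2_term_1[OF v] q)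
  from has_sum_insert[OF _ this, of 0]
  show "((\<lambda>m. coeff_a' v m * q powi m) has_sum deriv (eisenstein_E2 \<tau>) 1) UNIV"
    unfolding UNIV_eq assms(2) eisenstein_E2_deriv[OF v] deriv_eis2_const_1[OF v] by simp
qed

end
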